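(* Let $G$ be an irreducible near-brick that is not isomorphic to $K_4$ and not isomorphic to $\overline{C_6}$, and let $\Delta$ be the maximum degree of the vertices of $G$. Then $G$ has at least $\Delta-2$ removable edges.
   Context: All graphs are finite and may have multiple (parallel) edges but no loops; degrees count edges with multiplicity, and parallel edges are counted as distinct edges when counting removable edges. $K_4$ is the (simple) complete graph on four vertices, and $\overline{C_6}$ is the (simple) complement of the 6-cycle, i.e. the triangular prism. A perfect matching of a graph is a set of pairwise nonadjacent edges covering every vertex. A connected graph with at least two vertices is matching covered if each of its edges lies in a perfect matching of the graph. An edge $e$ of a matching covered graph $G$ is removable if $G-e$ is also matching covered. For a nonempty proper subset $X$ of $V(G)$, with $\overline{X}:=V(G)\setminus X$, let $\partial(X)$ be the set of edges of $G$ with one end in $X$ and the other in $\overline{X}$; this is called a cut with shores $X$ and $\overline{X}$. A cut is trivial if one of its shores is a singleton, and nontrivial otherwise. The two $\partial(X)$-contractions of $G$ are the graphs $G/X$ and $G/\overline{X}$ obtained from $G$ by shrinking $X$ (respectively $\overline{X}$) to a single vertex (edges inside the shrunk set are deleted, and multiple edges are kept). A cut $C$ of a matching covered graph $G$ is tight if $|M\cap C|=1$ for every perfect matching $M$ of $G$. If $C$ is a tight cut of a matching covered graph, both $C$-contractions are matching covered. A matching covered graph with no nontrivial tight cut is called a brace if it is bipartite, and a brick otherwise. Starting from a matching covered graph $G$ and repeatedly replacing a graph having a nontrivial tight cut $C$ by its two $C$-contractions, one ends with a list of bricks and braces (a tight cut decomposition of $G$). By a theorem of Lovász, any two tight cut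 decompositions of $G$ yield the same list of bricks and braces up to multiplicities of edges; hence the number of bricks in the list, denoted $b(G)$, depends only on $G$. A near-brick is a matching covered graph $G$ with $b(G)=1$. A single ear of a graph is a path of odd length in the graph whose internal vertices (if any) all have degree two in the graph. A graph is irreducible if it contains no single ear of length three or more. *)

theory Defs
  imports "HOL-Library.Multiset"
begin

text \<open>
  Multigraphs: parallel edges are different elements of \<open>edges\<close> with the same set of ends.
\<close>

record ('v, 'e) mgraph =
  verts :: "'v set"
  edges :: "'e set"
  ends :: "'e \<Rightarrow> 'v set"

definition loopless_multigraph :: "('v, 'e) mgraph \<Rightarrow> bool" where
  "loopless_multigraph G \<longleftrightarrow> finite (verts G) \<and> finite (edges G) \<and>
     (\<forall>e\<in>edges G. ends G e \<subseteq> verts G \<and> card (ends G e) = 2)"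

definition vertex_degree :: "('v, 'e) mgraph \<Rightarrow> 'v \<Rightarrow> nat" where
  "vertex_degree G v = card {e \<in> edges G. v \<in> ends G e}"

definition max_degree :: "('v, 'e) mgraph \<Rightarrow> nat" where
  "max_degree G = Max (vertex_degree G ` verts G)"

definition adjacency :: "('v, 'e) mgraph \<Rightarrow> ('v \<times> 'v) set" where
  "adjacency G = {(u, v). \<exists>e\<in>edges G. ends G e = {u, v}}"

definition connected_graph :: "('v, 'e) mgraph \<Rightarrow> bool" where
  "connected_graph G \<longleftrightarrow> (\<forall>u\<in>verts G. \<forall>v\<in>verts G. (u, v) \<in> (adjacency G)\<^sup>*)"

definition bipartite_graph :: "('v, 'e) mgraph \<Rightarrow> bool" where
  "bipartite_graph G \<longleftrightarrow> (\<exists>A B. A \<inter> B = {} \<and> A \<union> B = verts G \<and>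
     (\<forall>e\<in>edges G. \<exists>a\<in>A. \<exists>b\<in>B. ends G e = {a, b}))"

definition graph_iso :: "('v, 'e) mgraph \<Rightarrow> ('w, 'f) mgraph \<Rightarrow> bool" where
  "graph_iso G H \<longleftrightarrow> (\<exists>f g. bij_betw f (verts G) (verts H) \<and> bij_betw g (edges G) (edges H) \<and>
     (\<forall>e\<in>edges G. ends H (g e) = f ` ends G e))"


subsection \<open>Particular simple graphs\<close>

text \<open>In a simple graph an edge is the set of its two ends.\<close>

definition simple_graph :: "'v set \<Rightarrow> 'v set set \<Rightarrow> ('v, 'v set) mgraph" where
  "simple_graph V E = \<lparr>verts = V, edges = E, ends = (\<lambda>e. e)\<rparr>"

definition vertex_pairs :: "'v set \<Rightarrow> 'v set set" where
  "vertex_pairs V = {e. e \<subseteq> V \<and> card e = 2}"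

definition complete_graph :: "nat \<Rightarrow> (nat, nat set) mgraph" where
  "complete_graph n = simple_graph {..<n} (vertex_pairs {..<n})"

definition cycle_graph :: "nat \<Rightarrow> (nat, nat set) mgraph" where
  "cycle_graph n = simple_graph {..<n} {{i, Suc i mod n} | i. i < n}"

definition complement_graph :: "('v, 'v set) mgraph \<Rightarrow> ('v, 'v set) mgraph" where
  "complement_graph G = simple_graph (verts G) (vertex_pairs (verts G) - edges G)"


subsection \<open>Matching covered graphs and removable edges\<close>

definition perfect_matching :: "('v, 'e) mgraph \<Rightarrow> 'e set \<Rightarrow> bool" where
  "perfect_matching G M \<longleftrightarrow> M \<subseteq> edges G \<and>
     (\<forall>e\<in>M. \<forall>f\<in>M. e \<noteq> f \<longrightarrow> ends G e \<inter> ends G f = {}) \<and>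
     (\<forall>v\<in>verts G. \<exists>e\<in>M. v \<in> ends G e)"

definition matching_covered :: "('v, 'e) mgraph \<Rightarrow> bool" where
  "matching_covered G \<longleftrightarrow> loopless_multigraph G \<and> connected_graph G \<and> 2 \<le> card (verts G) \<and>
     (\<forall>e\<in>edges G. \<exists>M. perfect_matching G M \<and> e \<in> M)"

definition delete_edge :: "('v, 'e) mgraph \<Rightarrow> 'e \<Rightarrow> ('v, 'e) mgraph" where
  "delete_edge G e = G\<lparr>edges := edges G - {e}\<rparr>"

definition removable_edge :: "('v, 'e) mgraph \<Rightarrow> 'e \<Rightarrow> bool" where
  "removable_edge G e \<longleftrightarrow> matching_covered G \<and> e \<in> edges G \<and> matching_covered (delete_edge G e)"


subsection \<open>Tight cuts and their contractions\<close>

definition edge_cut :: "('v, 'e) mgraph \<Rightarrow> 'v set \<Rightarrow> 'e set" where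
  "edge_cut G X = {e \<in> edges G. ends G e \<inter> X \<noteq> {} \<and> ends G e \<inter> (verts G - X) \<noteq> {}}"

text \<open>
  Cuts are represented by a shore; in a connected graph a cut determines its pair of shores.
\<close>

definition tight_shore :: "('v, 'e) mgraph \<Rightarrow> 'v set \<Rightarrow> bool" where
  "tight_shore G X \<longleftrightarrow> X \<noteq> {} \<and> X \<subset> verts G \<and>
     (\<forall>M. perfect_matching G M \<longrightarrow> card (M \<inter> edge_cut G X) = 1)"

definition nontrivial_tight_shore :: "('v, 'e) mgraph \<Rightarrow> 'v set \<Rightarrow> bool" where
  "nontrivial_tight_shore G X \<longleftrightarrow> tight_shore G X \<and> card X \<noteq> 1 \<and> card (verts G - X) \<noteq> 1"

text \<open>
  The graph \<open>G/X\<close>. An arbitrary element of \<open>X\<close> serves as the vertex to which \<open>X\<close> is shrunk, so that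
  the vertex type does not change under repeated contraction.
\<close>

definition contract :: "('v, 'e) mgraph \<Rightarrow> 'v set \<Rightarrow> ('v, 'e) mgraph" where
  "contract G X = (let x = (SOME x. x \<in> X) in
     \<lparr>verts = insert x (verts G - X),
      edges = {e \<in> edges G. \<not> ends G e \<subseteq> X},
      ends = (\<lambda>e. (\<lambda>v. if v \<in> X then x else v) ` ends G e)\<rparr>)"


subsection \<open>Tight cut decompositions and near-bricks\<close>

definition brick :: "('v, 'e) mgraph \<Rightarrow> bool" where
  "brick G \<longleftrightarrow> matching_covered G \<and> \<not> (\<exists>X. nontrivial_tight_shore G X) \<and> \<not> bipartite_graph G"

text \<open>
  \<open>tight_cut_decomposition G D\<close>: the procedure started with \<open>G\<close> can end with the list \<open>D\<close>
  (as a multiset, since its order is immaterial).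
\<close>

inductive tight_cut_decomposition ::
    "('v, 'e) mgraph \<Rightarrow> ('v, 'e) mgraph multiset \<Rightarrow> bool" where
  indecomposable:
    "\<not> (\<exists>X. nontrivial_tight_shore G X) \<Longrightarrow> tight_cut_decomposition G {#G#}"
| split:
    "\<lbrakk>nontrivial_tight_shore G X;
      tight_cut_decomposition (contract G X) D\<^sub>1;
      tight_cut_decomposition (contract G (verts G - X)) D\<^sub>2\<rbrakk>
     \<Longrightarrow> tight_cut_decomposition G (D\<^sub>1 + D\<^sub>2)"

text \<open>
  The number \<open>b(G)\<close>, for matching covered \<open>G\<close>. By Lovasz's theorem it does not depend on the
  decomposition that is chosen.
\<close>

definition num_bricks :: "('v, 'e) mgraph \<Rightarrow> nat" where
  "num_bricks G = size (filter_mset brick (SOME D. tight_cut_decomposition G D))"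

definition near_brick :: "('v, 'e) mgraph \<Rightarrow> bool" where
  "near_brick G \<longleftrightarrow> matching_covered G \<and> num_bricks G = 1"


subsection \<open>Single ears and irreducible graphs\<close>

text \<open>
  A path is given by its vertices and its edges, in order; its length is \<open>length es\<close>.
\<close>

definition graph_path :: "('v, 'e) mgraph \<Rightarrow> 'v list \<Rightarrow> 'e list \<Rightarrow> bool" where
  "graph_path G vs es \<longleftrightarrow> length vs = Suc (length es) \<and> distinct vs \<and>
     set vs \<subseteq> verts G \<and> set es \<subseteq> edges G \<and>
     (\<forall>i<length es. ends G (es ! i) = {vs ! i, vs ! Suc i})"

definition single_ear :: "('v, 'e) mgraph \<Rightarrow> 'v list \<Rightarrow> 'e list \<Rightarrow> bool" where
  "single_ear G vs es \<longleftrightarrow> graph_path G vs es \<and> odd (length es) \<and>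
     (\<forall>i. 0 < i \<and> i < length es \<longrightarrow> vertex_degree G (vs ! i) = 2)"

definition irreducible_graph :: "('v, 'e) mgraph \<Rightarrow> bool" where
  "irreducible_graph G \<longleftrightarrow> \<not> (\<exists>vs es. single_ear G vs es \<and> 3 \<le> length es)"

end

theory Submission
  imports Defs "HOL-Library.Disjoint_Sets"
begin

text \<open>
  Let \<open>v\<close> be a vertex of maximum degree. For each edge \<open>e\<close> at \<open>v\<close> take the union of the perfect matchings
  that avoid \<open>e\<close>, restrict it to the component of \<open>v\<close>, and enlarge it to a maximal proper union of perfect
  matchings. Irreducibility makes this union connected, so its complement \<open>R\<close> is a class of edges, used
  together by every perfect matching or not at all, whose removal leaves a matching covered graph. The
  classes for different \<open>e\<close> are disjoint, because the components for two edges cover the graph.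

  In a near-brick such a class is a single removable edge or a doublet, a pair of edges whose removal leaves
  a bipartite graph, with one edge inside either colour class. In a brick this follows from the Tutte-Berge
  formula, and it passes through tight cuts with a bipartite contraction. If at most two of the classes
  at \<open>v\<close> are doublets, the others give the removable edges. Three doublets at \<open>v\<close> are pairwise
  exclusive, and the pairwise products of their colourings split the graph into classes that are joined
  like the vertices of \<open>K4\<close> or like the rungs of the prism. Then \<open>v\<close> has degree three and the graph has
  no further doublet, so that without a removable edge the same three doublets occur at every
  vertex of degree three, which forces the graph to be \<open>K4\<close> or the prism.
\<close>

section \<open>The Tutte-Berge formula\<close>

text \<open>The loss of 2 in the bound counts the edges at the vertex whose classes may be doublets;
  the remaining classes are disjoint singletons and thus give distinct removable edges. Nearly every
  contradiction comes from one exchange: two perfect matchings with the same edges in a cut can be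
  recombined along it. The task is therefore to find vertex sets whose cuts lie in a few classes of
  equivalent edges, where two matchings are easily made to agree. Such sets come from colourings: a
  doublet carries a two-colouring that fails exactly on it, so the product of the colourings of two
  doublets changes only across these two. The three doublets at \<open>v\<close> are exclusive
  because each one forces its own edge at \<open>v\<close> into every perfect matching that uses
  it.\<close>

definition delete_edges :: "('v, 'e) mgraph \<Rightarrow> 'e set \<Rightarrow> ('v, 'e) mgraph" where
  "delete_edges G R = G\<lparr>edges := edges G - R\<rparr>"

lemma delete_edges_simps [simp]:
  "verts (delete_edges G R) = verts G" "edges (delete_edges G R) = edges G - R"
  "ends (delete_edges G R) = ends G"
  by (auto simp: delete_edges_def)

lemma delete_edge_eq: "delete_edge G e = delete_edges G {e}"
  by (simp add: delete_edge_def delete_edges_def)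

lemma loopless_delete_edges: "loopless_multigraph G \<Longrightarrow> loopless_multigraph (delete_edges G R)"
  by (auto simp: loopless_multigraph_def)

lemma loopless_ends:
  assumes "loopless_multigraph G" "e \<in> edges G"
  obtains x y where "ends G e = {x, y}" "x \<noteq> y" "x \<in> verts G" "y \<in> verts G"
proof -
  have "card (ends G e) = 2" "ends G e \<subseteq> verts G"
    using assms by (auto simp: loopless_multigraph_def)
  then show ?thesis using that by (metis card_2_iff insert_subset)
qed

lemma loopless_other_end:
  assumes "loopless_multigraph G" "e \<in> edges G" "x \<in> ends G e"
  obtains y where "ends G e = {x, y}" "x \<noteq> y" "x \<in> verts G" "y \<in> verts G"
proof -
  obtain p q where pq: "ends G e = {p, q}" "p \<noteq> q" "p \<in> verts G" "q \<in> verts G"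
    using loopless_ends[OF assms(1,2)] .
  show ?thesis
  proof (cases "x = p")
    case True
    then show ?thesis using that[of q] pq by auto
  next
    case False
    then show ?thesis using that[of p] pq assms(3) by auto
  qed
qed

lemma finite_ends: "loopless_multigraph G \<Longrightarrow> e \<in> edges G \<Longrightarrow> finite (ends G e)"
  by (rule loopless_ends[of G e]) auto

lemma ends_nonempty: "loopless_multigraph G \<Longrightarrow> e \<in> edges G \<Longrightarrow> ends G e \<noteq> {}"
  by (rule loopless_ends[of G e]) auto

section \<open>Matchings inside a vertex set\<close>

definition matching_in :: "('v, 'e) mgraph \<Rightarrow> 'v set \<Rightarrow> 'e set \<Rightarrow> bool" where
  "matching_in G X M \<longleftrightarrow> M \<subseteq> edges G \<and> (\<forall>e\<in>M. ends G e \<subseteq> X) \<and>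
     (\<forall>e\<in>M. \<forall>f\<in>M. e \<noteq> f \<longrightarrow> ends G e \<inter> ends G f = {})"

lemma matching_in_cover:
  assumes "loopless_multigraph G" "matching_in G X M"
  shows "card (\<Union>(ends G ` M)) = 2 * card M"
proof -
  have fin: "finite M"
    using assms by (auto simp: matching_in_def loopless_multigraph_def intro: finite_subset)
  have "card (\<Union>(ends G ` M)) = (\<Sum>e\<in>M. card (ends G e))"
    using assms fin by (intro card_UN_disjoint) (auto simp: matching_in_def intro: finite_ends)
  also have "\<dots> = (\<Sum>e\<in>M. 2)"
    using assms by (intro sum.cong) (auto simp: matching_in_def loopless_multigraph_def)
  finally show ?thesis by simp
qed

lemma matching_in_insert:
  assumes "matching_in G X M" "e \<in> edges G" "ends G e \<subseteq> X" "ends G e \<inter> \<Union>(ends G ` M) = {}"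
  shows "matching_in G X (insert e M)"
proof -
  have "ends G e \<inter> ends G f = {}" "ends G f \<inter> ends G e = {}" if "f \<in> M" for f
    using assms(4) that by auto
  then show ?thesis using assms(1-3) by (auto simp: matching_in_def)
qed

lemma matching_in_Un:
  assumes "matching_in G X M" "matching_in G Y N" "X \<inter> Y = {}"
  shows "matching_in G (X \<union> Y) (M \<union> N)"
proof -
  have d: "ends G e \<inter> ends G f = {}" "ends G f \<inter> ends G e = {}" if "e \<in> M" "f \<in> N" for e f
  proof -
    have "ends G e \<subseteq> X" "ends G f \<subseteq> Y" using assms that by (auto simp: matching_in_def)
    then show "ends G e \<inter> ends G f = {}" "ends G f \<inter> ends G e = {}" using assms(3) by auto
  qed
  show ?thesis unfolding matching_in_def
  proof (intro conjI ballI impI)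
    show "M \<union> N \<subseteq> edges G" using assms by (simp add: matching_in_def)
    show "ends G e \<subseteq> X \<union> Y" if "e \<in> M \<union> N" for e
      using assms(1,2) that by (auto simp: matching_in_def)
    show "ends G e \<inter> ends G f = {}" if "e \<in> M \<union> N" "f \<in> M \<union> N" "e \<noteq> f" for e f
      using assms(1,2) that d[of e f] d[of f e] unfolding matching_in_def Un_iff by metis
  qed
qed

definition max_matching_in :: "('v, 'e) mgraph \<Rightarrow> 'v set \<Rightarrow> 'e set \<Rightarrow> bool" where
  "max_matching_in G X M \<longleftrightarrow> matching_in G X M \<and> (\<forall>N. matching_in G X N \<longrightarrow> card N \<le> card M)"

lemma matching_in_finite: "loopless_multigraph G \<Longrightarrow> matching_in G X M \<Longrightarrow> finite M"
  by (auto simp: matching_in_def loopless_multigraph_def intro: finite_subset)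

lemma matching_in_card: "loopless_multigraph G \<Longrightarrow> matching_in G X M \<Longrightarrow> card M \<le> card (edges G)"
  by (auto simp: matching_in_def loopless_multigraph_def intro: card_mono)

lemma max_matching_in_exists:
  assumes "loopless_multigraph G"
  obtains M where "max_matching_in G X M"
proof -
  have "matching_in G X {}" by (auto simp: matching_in_def)
  then obtain M where "matching_in G X M" "\<forall>N. matching_in G X N \<longrightarrow> card N \<le> card M"
    using ex_has_greatest_nat[of "matching_in G X" "{}" card "Suc (card (edges G))"]
      matching_in_card[OF assms] by (metis less_Suc_eq_le)
  then show ?thesis using that by (auto simp: max_matching_in_def)
qed

text \<open>
  Exchange argument: a maximum matching that misses \<open>t\<close> and shares as many edges as possible with \<open>M\<close>
  could be changed to share one more.
\<close>

lemma gallai_transitive: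
  assumes G: "loopless_multigraph G" and X: "X \<subseteq> verts G"
    and ut: "\<And>M. max_matching_in G X M \<Longrightarrow> u \<in> \<Union>(ends G ` M) \<or> t \<in> \<Union>(ends G ` M)"
    and tv: "\<And>M. max_matching_in G X M \<Longrightarrow> t \<in> \<Union>(ends G ` M) \<or> v \<in> \<Union>(ends G ` M)"
    and miss: "max_matching_in G X N0" "t \<notin> \<Union>(ends G ` N0)"
    and M: "max_matching_in G X M" and "u \<noteq> v"
  shows "u \<in> \<Union>(ends G ` M) \<or> v \<in> \<Union>(ends G ` M)"
proof (rule ccontr)
  assume uv: "\<not> ?thesis"
  define P where "P = (\<lambda>N. max_matching_in G X N \<and> t \<notin> \<Union>(ends G ` N))"
  have "finite M" using M matching_in_finite[OF G] by (auto simp: max_matching_in_def)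
  then have "\<forall>N. P N \<longrightarrow> card (M \<inter> N) < Suc (card M)"
    by (metis card_mono inf_le1 less_Suc_eq_le)
  moreover have "P N0" using miss by (simp add: P_def)
  ultimately obtain N where "P N" and Nmax: "\<And>N'. P N' \<Longrightarrow> card (M \<inter> N') \<le> card (M \<inter> N)"
    using ex_has_greatest_nat[of P N0 "\<lambda>N. card (M \<inter> N)" "Suc (card M)"] by blast
  then have N: "max_matching_in G X N" "t \<notin> \<Union>(ends G ` N)" by (auto simp: P_def)
  define VM VN where "VM = \<Union>(ends G ` M)" and "VN = \<Union>(ends G ` N)"
  have mM: "matching_in G X M" and mN: "matching_in G X N"
    using M N by (auto simp: max_matching_in_def)
  have fX: "finite X" using G X by (auto simp: loopless_multigraph_def intro: finite_subset)
  have fin: "finite VM" "finite VN" 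
    using mM mN fX by (auto simp: VM_def VN_def matching_in_def intro!: finite_subset[OF _ fX])
  have "card M = card N" using M N by (auto simp: max_matching_in_def intro: antisym)
  then have cVV: "card VM = card VN"
    using matching_in_cover[OF G mM] matching_in_cover[OF G mN] by (simp add: VM_def VN_def)
  have tM: "t \<in> VM" using ut[OF M] uv by (auto simp: VM_def)
  have uN: "u \<in> VN" "v \<in> VN" using ut[OF N(1)] tv[OF N(1)] N(2) by (auto simp: VN_def)
  \<comment> \<open>The two maximum matchings cover equally many vertices, and \<open>u\<close>,
    \<open>v\<close> are covered by \<open>N\<close> only. So besides \<open>t\<close> some further
    vertex \<open>x\<close> is covered by \<open>M\<close> only.\<close>
  have "card (VM - VN) = card (VN - VM)"
    using cVV fin by (metis card_le_sym_Diff le_antisym order_refl)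
  moreover have "card {u, v} \<le> card (VN - VM)"
    using uv uN fin by (intro card_mono) (auto simp: VM_def)
  ultimately have "2 \<le> card (VM - VN)" using \<open>u \<noteq> v\<close> by simp
  then have "\<not> VM - VN \<subseteq> {t}"
    using card_mono[of "{t}" "VM - VN"] by auto
  then obtain x where x: "x \<in> VM" "x \<notin> VN" "x \<noteq> t" by auto
  then obtain e where e: "e \<in> M" "x \<in> ends G e" by (auto simp: VM_def)
  have eE: "e \<in> edges G" using e mM by (auto simp: matching_in_def)
  obtain y where y: "ends G e = {x, y}" "x \<noteq> y"
    using loopless_other_end[OF G eE e(2)] .
  have eX: "ends G e \<subseteq> X" using e mM by (auto simp: matching_in_def)
  have eN: "e \<notin> N" using x e by (auto simp: VN_def)
  have "y \<in> VN"
  proof (rule ccontr)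
    assume "y \<notin> VN"
    then have "matching_in G X (insert e N)"
      using matching_in_insert[OF mN eE eX] x y unfolding VN_def by auto
    then have "card (insert e N) \<le> card N" using N by (auto simp: max_matching_in_def)
    then show False using eN matching_in_finite[OF G mN] by simp
  qed
  then obtain f where f: "f \<in> N" "y \<in> ends G f" by (auto simp: VN_def)
  have fM: "f \<notin> M"
    using f e y mM eN unfolding matching_in_def by (metis disjoint_iff insertCI)
  \<comment> \<open>Exchanging the edge of \<open>N\<close> at \<open>y\<close> for \<open>e\<close>
    keeps the size and still misses \<open>t\<close>, but gains a common edge with
    \<open>M\<close>.\<close>
  define N' where "N' = insert e (N - {f})"
  have dis: "ends G g \<inter> ends G e = {}" if "g \<in> N" "g \<noteq> f" for g
  proof -
    have "y \<notin> ends G g" using that f mN unfolding matching_in_def by (metis disjoint_iff)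
    moreover have "x \<notin> ends G g" using x that by (auto simp: VN_def)
    ultimately show ?thesis using y by auto
  qed
  have mN': "matching_in G X N'"
    using mN dis eX eE unfolding matching_in_def N'_def by (auto simp: Int_commute)
  have "card N' = card N"
    using f eN matching_in_finite[OF G mN] by (simp add: N'_def card_Suc_Diff1 del: card_Diff_insert card_Diff_singleton)
  then have "max_matching_in G X N'" using N(1) mN' by (auto simp: max_matching_in_def)
  moreover have "t \<notin> \<Union>(ends G ` N')"
    using N(2) x y f by (auto simp: N'_def)
  ultimately have "card (M \<inter> N') \<le> card (M \<inter> N)" using Nmax by (auto simp: P_def)
  moreover have "M \<inter> N' = insert e (M \<inter> N)" using e fM by (auto simp: N'_def)
  ultimately show False using eN \<open>finite M\<close> by simp
qed

text \<open>The members stand for odd components of the graph induced on \<open>Y\<close>. They are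
  closed under its edges but may be disconnected, so families of two separated pieces can simply be
  united.\<close>

definition odd_parts :: "('v, 'e) mgraph \<Rightarrow> 'v set \<Rightarrow> 'v set set \<Rightarrow> bool" where
  "odd_parts G Y KK \<longleftrightarrow> disjoint KK \<and>
     (\<forall>K\<in>KK. K \<subseteq> Y \<and> odd (card K) \<and>
        (\<forall>e\<in>edges G. ends G e \<inter> K \<noteq> {} \<and> ends G e \<subseteq> Y \<longrightarrow> ends G e \<subseteq> K))"

text \<open>The inequality is the deficiency formula without subtraction: \<open>M\<close> leaves at
  most \<open>card KK - card U\<close> vertices of \<open>X\<close> uncovered. The induction splits
  \<open>X\<close>, or moves into \<open>U\<close> a vertex that every maximum matching covers, or
  ends in the situation of Gallai's lemma, where at most one vertex is missed.\<close>

theorem tutte_berge: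
  assumes G: "loopless_multigraph G" and "X \<subseteq> verts G"
  shows "\<exists>M U KK. matching_in G X M \<and> U \<subseteq> X \<and> odd_parts G (X - U) KK \<and>
    card X + card U \<le> card KK + 2 * card M"
  using \<open>X \<subseteq> verts G\<close>
proof (induction "card X" arbitrary: X rule: less_induct)
  case less
  note X = less.prems
  have fX: "finite X" using G X by (auto simp: loopless_multigraph_def intro: finite_subset)
  obtain M where M: "max_matching_in G X M" using max_matching_in_exists[OF G] .
  then have mM: "matching_in G X M" by (simp add: max_matching_in_def)
  let ?rel = "\<lambda>u v. \<forall>M. max_matching_in G X M \<longrightarrow> u \<in> \<Union>(ends G ` M) \<or> v \<in> \<Union>(ends G ` M)"
  consider (split) Y where "Y \<subset> X" "Y \<noteq> {}"
      "\<forall>e\<in>edges G. ends G e \<subseteq> X \<longrightarrow> ends G e \<subseteq> Y \<or> ends G e \<subseteq> X - Y"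
    | (cov) t where "t \<in> X" "\<forall>M. max_matching_in G X M \<longrightarrow> t \<in> \<Union>(ends G ` M)"
    | (crit) "\<forall>u\<in>X. \<forall>v\<in>X. u \<noteq> v \<longrightarrow> ?rel u v"
  proof (rule ccontr)
    assume a: "\<not> thesis"
    have nsplit: "\<not> (Y \<subset> X \<and> Y \<noteq> {} \<and>
      (\<forall>e\<in>edges G. ends G e \<subseteq> X \<longrightarrow> ends G e \<subseteq> Y \<or> ends G e \<subseteq> X - Y))" for Y
      using a split by blast
    have miss: "\<exists>N. max_matching_in G X N \<and> t \<notin> \<Union>(ends G ` N)" if "t \<in> X" for t
      using a cov \<open>t \<in> X\<close> by blast
    obtain u v where uv: "u \<in> X" "v \<in> X" "u \<noteq> v" "\<not> ?rel u v" using a crit by blast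
    \<comment> \<open>When no vertex is covered by all maximum matchings, \<open>?rel\<close> is
      transitive by \<open>gallai_transitive\<close> and holds along edges. So the class
      \<open>Y\<close> of \<open>u\<close> is separated from the rest of \<open>X\<close>, and it
      misses \<open>v\<close>.\<close>
    define Y where "Y = {w \<in> X. w = u \<or> ?rel u w}"
    have adj: "?rel x y" if "e \<in> edges G" "ends G e = {x, y}" "ends G e \<subseteq> X" "x \<noteq> y" for e x y
    proof (intro allI impI, rule ccontr)
      fix N assume N: "max_matching_in G X N" "\<not> (x \<in> \<Union> (ends G ` N) \<or> y \<in> \<Union> (ends G ` N))"
      then have "matching_in G X N" by (simp add: max_matching_in_def)
      then have "matching_in G X (insert e N)"
        using matching_in_insert[of G X N e] N(2) that by auto
      moreover have "e \<notin> N" using N(2) that by auto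
      ultimately show False
        using N(1) matching_in_finite[OF G] unfolding max_matching_in_def
        by (metis card_insert_disjoint Suc_n_not_le_n)
    qed
    have step: "y \<in> Y" if "x \<in> Y" "e \<in> edges G" "ends G e = {x, y}" "ends G e \<subseteq> X" "x \<noteq> y" for e x y
    proof (cases "x = u \<or> y = u")
      case True
      then show ?thesis using adj[OF that(2-5)] that by (auto simp: Y_def)
    next
      case False
      then have ux: "?rel u x" "x \<in> X" using that by (auto simp: Y_def)
      obtain N0 where N0: "max_matching_in G X N0" "x \<notin> \<Union>(ends G ` N0)" using miss[OF ux(2)] by blast
      have "?rel u y"
      proof (intro allI impI)
        fix N assume N: "max_matching_in G X N"
        show "u \<in> \<Union> (ends G ` N) \<or> y \<in> \<Union> (ends G ` N)"
          using gallai_transitive[OF G X _ _ N0 N, of u y] ux(1) adj[OF that(2-5)] False by blast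
      qed
      then show ?thesis using that by (auto simp: Y_def)
    qed
    have "v \<notin> Y" "u \<in> Y" "Y \<subseteq> X" using uv by (auto simp: Y_def)
    then have "Y \<subset> X" "Y \<noteq> {}" using uv by auto
    moreover have "ends G e \<subseteq> Y \<or> ends G e \<subseteq> X - Y" if e: "e \<in> edges G" "ends G e \<subseteq> X" for e
    proof -
      obtain x y where xy: "ends G e = {x, y}" "x \<noteq> y" using loopless_ends[OF G e(1)] .
      then show ?thesis using step[of x e y] step[of y e x] e
        by (auto simp: insert_commute)
    qed
    ultimately show False using nsplit by blast
  qed
  then show ?case
  proof cases
    case split
    let ?Z = "X - Y"
    have lt: "card Y < card X" "card ?Z < card X"
      using split fX by (auto intro!: psubset_card_mono)
    have "Y \<subseteq> verts G" using X split by auto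
    then obtain M1 U1 K1 where 1: "matching_in G Y M1" "U1 \<subseteq> Y" "odd_parts G (Y - U1) K1"
      "card Y + card U1 \<le> card K1 + 2 * card M1" using less.hyps[OF lt(1)] by blast
    have "?Z \<subseteq> verts G" using X by auto
    then obtain M2 U2 K2 where 2: "matching_in G ?Z M2" "U2 \<subseteq> ?Z" "odd_parts G (?Z - U2) K2"
      "card ?Z + card U2 \<le> card K2 + 2 * card M2" using less.hyps[OF lt(2)] by blast
    have KY: "K \<subseteq> Y - U1" if "K \<in> K1" for K using 1(3) that by (auto simp: odd_parts_def)
    have KZ: "K \<subseteq> ?Z - U2" if "K \<in> K2" for K using 2(3) that by (auto simp: odd_parts_def)
    have YX: "Y \<subseteq> X" using split(1) by auto
    have fin: "finite U1" "finite U2" "finite K1" "finite K2"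
    proof -
      have "U1 \<subseteq> X" "U2 \<subseteq> X" using 1(2) 2(2) YX by auto
      then show "finite U1" "finite U2" using fX finite_subset by auto
      have "K1 \<subseteq> Pow X" "K2 \<subseteq> Pow X" using KY KZ YX by blast+
      then show "finite K1" "finite K2" using fX finite_subset[of _ "Pow X"] by auto
    qed
    have disj: "U1 \<inter> U2 = {}" "K1 \<inter> K2 = {}" "M1 \<inter> M2 = {}"
    proof -
      show "U1 \<inter> U2 = {}" using 1 2 by auto
      show "K1 \<inter> K2 = {}"
      proof (rule ccontr)
        assume "K1 \<inter> K2 \<noteq> {}"
        then obtain K where "K \<in> K1" "K \<in> K2" by auto
        then have "K \<subseteq> Y" "K \<subseteq> X - Y" "odd (card K)"
          using 1(3) KY KZ by (auto simp: odd_parts_def)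
        then have "K = {}" by auto
        then show False using \<open>odd (card K)\<close> by simp
      qed
      show "M1 \<inter> M2 = {}"
      proof (rule ccontr)
        assume "M1 \<inter> M2 \<noteq> {}"
        then obtain e where "e \<in> M1" "e \<in> M2" by auto
        then have "ends G e \<subseteq> Y" "ends G e \<subseteq> X - Y" "e \<in> edges G"
          using 1(1) 2(1) by (auto simp: matching_in_def)
        then show False using ends_nonempty[OF G, of e] by blast
      qed
    qed
    have M12: "matching_in G X (M1 \<union> M2)"
      using matching_in_Un[OF 1(1) 2(1)] split(1) by (simp add: Un_absorb1 psubset_imp_subset)
    have c: "card (U1 \<union> U2) = card U1 + card U2" "card (K1 \<union> K2) = card K1 + card K2"
      "card (M1 \<union> M2) = card M1 + card M2" "card X = card Y + card ?Z"
      using fin disj matching_in_finite[OF G 1(1)] matching_in_finite[OF G 2(1)] split(1) fX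
        card_Un_disjoint[of Y ?Z] finite_subset[of Y X]
      by (auto simp: card_Un_disjoint Un_absorb1)
    have 3: "odd_parts G (X - (U1 \<union> U2)) (K1 \<union> K2)"
      unfolding odd_parts_def
    proof (intro conjI ballI)
      have "disjoint K1" "disjoint K2" using 1(3) 2(3) unfolding odd_parts_def by auto
      moreover have "\<Union>K1 \<inter> \<Union>K2 = {}" using KY KZ by blast
      ultimately show "disjoint (K1 \<union> K2)" by (rule disjoint_union)
      fix K assume K: "K \<in> K1 \<union> K2"
      then show "odd (card K)" using 1(3) 2(3) unfolding odd_parts_def by auto
      have "K \<subseteq> Y - U1 \<or> K \<subseteq> ?Z - U2" using K KY KZ by blast
      then show "K \<subseteq> X - (U1 \<union> U2)" using 1(2) 2(2) YX by blast
      fix e assume e: "e \<in> edges G"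
      show "ends G e \<inter> K \<noteq> {} \<and> ends G e \<subseteq> X - (U1 \<union> U2) \<longrightarrow> ends G e \<subseteq> K"
      proof
        assume a: "ends G e \<inter> K \<noteq> {} \<and> ends G e \<subseteq> X - (U1 \<union> U2)"
        then have s: "ends G e \<subseteq> Y \<or> ends G e \<subseteq> X - Y" using split e by blast
        show "ends G e \<subseteq> K"
        proof (cases "K \<in> K1")
          case True
          then have k: "K \<subseteq> Y" using KY by auto
          then have "ends G e \<subseteq> Y - U1" using a s by auto
          then show ?thesis using True 1(3) e a unfolding odd_parts_def by auto
        next
          case False
          then have T: "K \<in> K2" using K by auto
          then have k: "K \<subseteq> X - Y" using KZ by auto
          then have "ends G e \<subseteq> X - Y - U2" using a s by auto
          then show ?thesis using T 2(3) e a unfolding odd_parts_def by auto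
        qed
      qed
    qed
    show ?thesis
      using M12 3 c 1 2 split(1)
      by (intro exI[of _ "M1 \<union> M2"] exI[of _ "U1 \<union> U2"] exI[of _ "K1 \<union> K2"]) auto
  next
    case cov
    have "card (X - {t}) < card X" "X - {t} \<subseteq> verts G"
      using card_Diff1_less[OF fX cov(1)] X by auto
    from less.hyps[OF this] obtain N U KK where N: "matching_in G (X - {t}) N" "U \<subseteq> X - {t}"
      "odd_parts G (X - {t} - U) KK" "card (X - {t}) + card U \<le> card KK + 2 * card N" by blast
    have mN: "matching_in G X N" using N(1) by (auto simp: matching_in_def)
    have "t \<notin> \<Union>(ends G ` N)" using N(1) by (auto simp: matching_in_def)
    then have "\<not> max_matching_in G X N" using cov by blast
    \<comment> \<open>\<open>N\<close> misses \<open>t\<close> and so is not maximum. The extra edge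
      of \<open>M\<close> counts two on the right, which pays for \<open>t\<close> both in
      \<open>card X\<close> and in \<open>card U\<close>.\<close>
    then have "card N < card M"
      using mN M unfolding max_matching_in_def by (metis leD le_less_trans linorder_not_le)
    moreover have "card (insert t U) = Suc (card U)"
      using N(2) fX by (intro card_insert_disjoint) (auto intro: finite_subset)
    moreover have "card X = Suc (card (X - {t}))" using cov fX by (simp add: card_Suc_Diff1 del: card_Diff_insert card_Diff_singleton)
    moreover have "X - {t} - U = X - insert t U" by auto
    ultimately show ?thesis
      using N mM cov(1) by (intro exI[of _ M] exI[of _ "insert t U"] exI[of _ KK]) auto
  next
    case crit
    let ?C = "\<Union>(ends G ` M)"
    have C: "?C \<subseteq> X" using mM by (auto simp: matching_in_def)
    have "u = v" if "u \<in> X - ?C" "v \<in> X - ?C" for u v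
      using crit M that by blast
    then have "card (X - ?C) \<le> 1"
      by (metis card_le_Suc0_iff_eq One_nat_def fX finite_Diff)
    then have le: "card X \<le> 1 + 2 * card M"
      using matching_in_cover[OF G mM] C fX
      by (metis card_Diff_subset diff_le_mono2 finite_subset le_diff_conv)
    \<comment> \<open>At most one vertex is missed, and parity decides: \<open>X\<close> itself is
      the only odd part, or there is none.\<close>
    show ?thesis
    proof (cases "odd (card X)")
      case True
      then have "odd_parts G (X - {}) {X}" by (auto simp: odd_parts_def)
      then show ?thesis using le mM by (intro exI[of _ M] exI[of _ "{}"] exI[of _ "{X}"]) auto
    next
      case False
      then have "card X \<le> 2 * card M" using le by presburger
      moreover have "odd_parts G (X - {}) {}" by (auto simp: odd_parts_def)
      ultimately show ?thesis using mM by (intro exI[of _ M] exI[of _ "{}"]) auto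
    qed
  qed
qed

section \<open>Perfect matchings and cuts\<close>

lemma in_edge_cut_iff:
  assumes "loopless_multigraph G" "e \<in> edges G"
  shows "e \<in> edge_cut G X \<longleftrightarrow> ends G e \<inter> X \<noteq> {} \<and> \<not> ends G e \<subseteq> X"
  using assms by (auto simp: edge_cut_def loopless_multigraph_def)

lemma edge_cut_delete_edges [simp]: "edge_cut (delete_edges G R) X = edge_cut G X - R"
  by (auto simp: edge_cut_def)

lemma edge_cut_Compl:
  "loopless_multigraph G \<Longrightarrow> X \<subseteq> verts G \<Longrightarrow> edge_cut G (verts G - X) = edge_cut G X"
  by (auto simp: edge_cut_def double_diff)

lemma perfect_matching_subset: "perfect_matching G M \<Longrightarrow> M \<subseteq> edges G"
  by (simp add: perfect_matching_def)

lemma perfect_matching_unique: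
  "perfect_matching G M \<Longrightarrow> e \<in> M \<Longrightarrow> f \<in> M \<Longrightarrow> v \<in> ends G e \<Longrightarrow> v \<in> ends G f \<Longrightarrow> e = f"
  unfolding perfect_matching_def by (metis disjoint_iff)

lemma perfect_matching_covers:
  assumes "perfect_matching G M" "v \<in> verts G"
  obtains e where "e \<in> M" "v \<in> ends G e" "e \<in> edges G"
  using assms unfolding perfect_matching_def by blast

lemma perfect_matching_delete_edges:
  "perfect_matching (delete_edges G R) M \<longleftrightarrow> perfect_matching G M \<and> M \<inter> R = {}"
  by (auto simp: perfect_matching_def)

lemma perfect_matching_finite:
  "loopless_multigraph G \<Longrightarrow> perfect_matching G M \<Longrightarrow> finite M"
  by (auto simp: perfect_matching_def loopless_multigraph_def intro: finite_subset)

lemma perfect_matching_sum: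
  assumes G: "loopless_multigraph G" and M: "perfect_matching G M"
  shows "sum h (verts G) = (\<Sum>e\<in>M. sum h (ends G e))"
proof -
  have "verts G = \<Union>(ends G ` M)"
    using G M by (auto simp: perfect_matching_def loopless_multigraph_def)
  moreover have "sum h (\<Union>(ends G ` M)) = (\<Sum>e\<in>M. sum h (ends G e))"
    using G M by (intro sum.UNION_disjoint)
      (auto intro: perfect_matching_finite finite_ends simp: perfect_matching_def)
  ultimately show ?thesis by simp
qed

lemma perfect_matching_card:
  assumes G: "loopless_multigraph G" and M: "perfect_matching G M"
  shows "card (verts G) = 2 * card M"
proof -
  have "card (verts G) = (\<Sum>e\<in>M. card (ends G e))"
    using perfect_matching_sum[OF G M, of "\<lambda>_. 1::nat"] by simp
  also have "\<dots> = (\<Sum>e\<in>M. 2)"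
    using G M by (intro sum.cong) (auto simp: perfect_matching_def loopless_multigraph_def)
  finally show ?thesis by simp
qed

text \<open>A matching edge has one end in \<open>X\<close> if it lies in the cut and two if it lies
  inside. This is the source of all parity arguments below.\<close>

lemma perfect_matching_shore:
  assumes G: "loopless_multigraph G" and M: "perfect_matching G M" and X: "X \<subseteq> verts G"
  shows "card X = card (M \<inter> edge_cut G X) + 2 * card {e \<in> M. ends G e \<subseteq> X}"
proof -
  have fin: "finite M" by (rule perfect_matching_finite[OF G M])
  have fV: "finite (verts G)" using G by (simp add: loopless_multigraph_def)
  have M': "e \<in> edges G" if "e \<in> M" for e using M that by (auto simp: perfect_matching_def)
  have eq: "card (ends G e \<inter> X) = (if e \<in> edge_cut G X then 1 else 0) + (if ends G e \<subseteq> X then 2 else 0)"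
    if eM: "e \<in> M" for e
  proof -
    obtain x y where "ends G e = {x, y}" "x \<noteq> y" using loopless_ends[OF G M'[OF eM]] .
    then show ?thesis using in_edge_cut_iff[OF G M'[OF eM], of X] by auto
  qed
  have "card X = (\<Sum>v\<in>verts G. if v \<in> X then 1 else 0)"
    using X fV by (simp add: sum.If_cases Int_absorb1)
  also have "\<dots> = (\<Sum>e\<in>M. \<Sum>v\<in>ends G e. if v \<in> X then 1 else 0)"
    by (rule perfect_matching_sum[OF G M])
  also have "\<dots> = (\<Sum>e\<in>M. card (ends G e \<inter> X))"
    by (intro sum.cong refl) (simp add: sum.If_cases finite_ends[OF G M'] Int_def)
  also have "\<dots> = (\<Sum>e\<in>M. (if e \<in> edge_cut G X then 1 else 0) + (if ends G e \<subseteq> X then 2 else 0))"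
    by (intro sum.cong refl eq)
  also have "\<dots> = card (M \<inter> edge_cut G X) + 2 * card {e \<in> M. ends G e \<subseteq> X}"
    using fin by (simp add: sum.distrib sum.If_cases Int_def)
  finally show ?thesis .
qed

lemma perfect_matching_parity:
  assumes "loopless_multigraph G" "perfect_matching G M" "X \<subseteq> verts G"
  shows "even (card (M \<inter> edge_cut G X)) \<longleftrightarrow> even (card X)"
  using perfect_matching_shore[OF assms] by simp

lemma perfect_matching_leaves_odd:
  assumes "loopless_multigraph G" "perfect_matching G M" "X \<subseteq> verts G" "odd (card X)"
  obtains e where "e \<in> M" "e \<in> edge_cut G X"
  using perfect_matching_parity[OF assms(1-3)] assms(4) that
  by (metis IntE card.empty even_zero ex_in_conv)

section \<open>Exchanging two perfect matchings across a cut\<close>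

definition splice :: "('v, 'e) mgraph \<Rightarrow> 'v set \<Rightarrow> 'e set \<Rightarrow> 'e set \<Rightarrow> 'e set" where
  "splice G X M N = {e \<in> M. ends G e \<inter> X \<noteq> {}} \<union> {e \<in> N. ends G e \<inter> X = {}}"

lemma splice_meets: "ends G e \<inter> X \<noteq> {} \<Longrightarrow> e \<in> splice G X M N \<longleftrightarrow> e \<in> M"
  by (auto simp: splice_def)

lemma splice_avoids: "ends G e \<inter> X = {} \<Longrightarrow> e \<in> splice G X M N \<longleftrightarrow> e \<in> N"
  by (auto simp: splice_def)

text \<open>An edge of \<open>M\<close> that leaves \<open>X\<close> belongs to \<open>N\<close> as
  well, so at its end outside \<open>X\<close> it replaces nothing and conflicts with nothing taken
  from \<open>N\<close>.\<close>

lemma splice_perfect_matching: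
  assumes G: "loopless_multigraph G" and M: "perfect_matching G M" and N: "perfect_matching G N"
    and agree: "M \<inter> edge_cut G X = N \<inter> edge_cut G X"
  shows "perfect_matching G (splice G X M N)"
proof -
  have leave: "e \<in> N" if "e \<in> M" "ends G e \<inter> X \<noteq> {}" "\<not> ends G e \<subseteq> X" for e
    using that agree in_edge_cut_iff[OF G, of e X] perfect_matching_subset[OF M] by blast
  have leave': "e \<in> M" if "e \<in> N" "ends G e \<inter> X \<noteq> {}" "\<not> ends G e \<subseteq> X" for e
    using that agree in_edge_cut_iff[OF G, of e X] perfect_matching_subset[OF N] by blast
  have dis: "e = f" if "v \<in> ends G e" "v \<in> ends G f" "e \<in> splice G X M N" "f \<in> splice G X M N" for e f v
  proof (cases "e \<in> M \<and> f \<in> M \<or> e \<in> N \<and> f \<in> N")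
    case True
    then show ?thesis using that(1,2) perfect_matching_unique M N by metis
  next
    case False
    then have "e \<in> M \<and> ends G e \<inter> X \<noteq> {} \<and> f \<in> N \<and> ends G f \<inter> X = {}
      \<or> f \<in> M \<and> ends G f \<inter> X \<noteq> {} \<and> e \<in> N \<and> ends G e \<inter> X = {}"
      using that(3,4) by (auto simp: splice_def)
    then show ?thesis using leave[of e] leave[of f] False that(1,2) by blast
  qed
  have cov: "\<exists>e\<in>splice G X M N. v \<in> ends G e" if v: "v \<in> verts G" for v
  proof (cases "v \<in> X")
    case True
    obtain e where "e \<in> M" "v \<in> ends G e" using perfect_matching_covers[OF M v] .
    then show ?thesis using True by (auto simp: splice_def)
  next
    case False
    obtain e where e: "e \<in> N" "v \<in> ends G e" using perfect_matching_covers[OF N v] .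
    then show ?thesis using leave'[OF e(1)] False by (auto simp: splice_def)
  qed
  have "splice G X M N \<subseteq> edges G"
    using perfect_matching_subset[OF M] perfect_matching_subset[OF N] by (auto simp: splice_def)
  then show ?thesis unfolding perfect_matching_def using dis cov by (metis disjoint_iff)
qed

lemma connected_graph_crossing:
  assumes "connected_graph G" "x \<in> verts G" "y \<in> verts G" "x \<in> X" "y \<notin> X"
    and G: "loopless_multigraph G"
  obtains e where "e \<in> edge_cut G X"
proof -
  have "(x, y) \<in> (adjacency G)\<^sup>*" using assms by (auto simp: connected_graph_def)
  then have "y \<in> X" if none: "edge_cut G X = {}"
  proof induction
    case base
    show ?case using assms by simp
  next
    case (step y z)
    then obtain e where "e \<in> edges G" "ends G e = {y, z}" by (auto simp: adjacency_def)
    then show ?case using step in_edge_cut_iff[OF G, of e X] none by auto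
  qed
  then show ?thesis using assms(5) that by blast
qed

lemma connected_graphI:
  assumes G: "loopless_multigraph G"
    and cross: "\<And>X. X \<subseteq> verts G \<Longrightarrow> X \<noteq> {} \<Longrightarrow> X \<noteq> verts G \<Longrightarrow> edge_cut G X \<noteq> {}"
  shows "connected_graph G"
  unfolding connected_graph_def
proof (intro ballI, rule ccontr)
  fix u v assume u: "u \<in> verts G" and v: "v \<in> verts G" and n: "(u, v) \<notin> (adjacency G)\<^sup>*"
  let ?X = "{w \<in> verts G. (u, w) \<in> (adjacency G)\<^sup>*}"
  have "u \<in> ?X" "v \<notin> ?X" using u n by auto
  then have "edge_cut G ?X \<noteq> {}" using v by (intro cross) auto
  then obtain e where e: "e \<in> edges G" "ends G e \<inter> ?X \<noteq> {}" "\<not> ends G e \<subseteq> ?X"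
    using in_edge_cut_iff[OF G, of _ ?X] by (auto simp: edge_cut_def)
  then obtain x where x: "x \<in> ends G e" "x \<in> ?X" by auto
  obtain y where y: "ends G e = {x, y}" "y \<in> verts G" using loopless_other_end[OF G e(1) x(1)] .
  then have "(x, y) \<in> adjacency G" using e(1) by (auto simp: adjacency_def)
  then have "y \<in> ?X" using x y by auto
  then show False using e(3) x y by auto
qed

lemma matching_coveredD:
  assumes "matching_covered G"
  shows "loopless_multigraph G" "connected_graph G" "2 \<le> card (verts G)"
  using assms by (auto simp: matching_covered_def)

lemma matching_covered_edge:
  assumes "matching_covered G" "e \<in> edges G"
  obtains M where "perfect_matching G M" "e \<in> M"
  using assms by (auto simp: matching_covered_def)

lemma matching_covered_delete_edge:
  assumes "matching_covered (delete_edges G R)" "e \<in> edges G" "e \<notin> R"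
  obtains M where "perfect_matching G M" "e \<in> M" "M \<inter> R = {}"
proof -
  obtain M where "perfect_matching (delete_edges G R) M" "e \<in> M"
    by (rule matching_covered_edge[OF assms(1), of e]) (use assms in auto)
  then show ?thesis using that unfolding perfect_matching_delete_edges by blast
qed

lemma matching_covered_crossing:
  assumes G: "matching_covered G" and "x \<in> verts G" "y \<in> verts G" "x \<in> X" "y \<notin> X"
  obtains e where "e \<in> edge_cut G X"
  by (rule connected_graph_crossing[OF matching_coveredD(2)[OF G] assms(2-5) matching_coveredD(1)[OF G]])

lemma matching_covered_delete_crossing:
  assumes G: "matching_covered (delete_edges G R)" and "x \<in> verts G" "y \<in> verts G" "x \<in> X" "y \<notin> X"
  obtains e where "e \<in> edge_cut G X" "e \<notin> R"
proof -
  obtain e where "e \<in> edge_cut (delete_edges G R) X"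
    by (rule matching_covered_crossing[OF G, of x y X]) (use assms in auto)
  then show ?thesis using that by auto
qed

lemma matching_covered_has_matching:
  assumes G: "matching_covered G"
  obtains M where "perfect_matching G M"
proof -
  have "card (verts G) \<ge> 2" "finite (verts G)"
    using G by (auto simp: matching_covered_def loopless_multigraph_def)
  then obtain x where x: "x \<in> verts G" by (metis card.empty ex_in_conv not_numeral_le_zero)
  have "verts G \<noteq> {x}" using \<open>card (verts G) \<ge> 2\<close> by auto
  then obtain y where y: "y \<in> verts G" "x \<noteq> y" using x by blast
  obtain e where "e \<in> edge_cut G {x}"
    by (rule matching_covered_crossing[OF G, of x y "{x}"]) (use x y in auto)
  then have "e \<in> edges G" by (auto simp: edge_cut_def)
  then show ?thesis using matching_covered_edge[OF G] that by metis
qed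

definition equivalent_edges :: "('v, 'e) mgraph \<Rightarrow> 'e set \<Rightarrow> bool" where
  "equivalent_edges G R \<longleftrightarrow> R \<subseteq> edges G \<and> (\<forall>M. perfect_matching G M \<longrightarrow> R \<subseteq> M \<or> R \<inter> M = {})"

lemma equivalent_edgesD:
  "equivalent_edges G R \<Longrightarrow> perfect_matching G M \<Longrightarrow> e \<in> R \<Longrightarrow> e \<in> M \<Longrightarrow> R \<subseteq> M"
  by (auto simp: equivalent_edges_def)

section \<open>Equivalent edges and barriers\<close>

text \<open>
  The set \<open>S\<close> comes from the Tutte-Berge formula for \<open>G - e\<close> minus the ends of \<open>f\<close>, a graph without
  perfect matching since every perfect matching with \<open>f\<close> contains \<open>e\<close>.
\<close>

lemma equivalent_pair_barrier:
  assumes mc: "matching_covered G" and eq: "equivalent_edges G R"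
    and del: "matching_covered (delete_edges G R)"
    and e: "e \<in> R" and f: "f \<in> R" and "e \<noteq> f"
  shows "\<exists>S KK. S \<subseteq> verts G \<and> disjoint KK \<and> verts G - S = \<Union>KK \<and> card S = card KK \<and> 2 \<le> card KK \<and>
    ends G f \<subseteq> S \<and> ends G e \<inter> S = {} \<and> \<not> (\<exists>K\<in>KK. ends G e \<subseteq> K) \<and>
    (\<forall>g\<in>edges G. ends G g \<subseteq> S \<longrightarrow> g = f) \<and>
    (\<forall>K\<in>KK. \<forall>g\<in>edges G. g \<noteq> e \<and> ends G g \<inter> K \<noteq> {} \<and> ends G g \<inter> S = {} \<longrightarrow> ends G g \<subseteq> K) \<and>
    (\<forall>K\<in>KK. odd (card K) \<and> tight_shore G K)"
proof -
  note G = matching_coveredD(1)[OF mc]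
  have fV: "finite (verts G)" using G by (simp add: loopless_multigraph_def)
  have eE: "e \<in> edges G" and fE: "f \<in> edges G" using e f eq by (auto simp: equivalent_edges_def)
  let ?G' = "delete_edges G {e}"
  have G': "loopless_multigraph ?G'" by (rule loopless_delete_edges[OF G])
  let ?X = "verts G - ends G f"
  have fends: "ends G f \<subseteq> verts G" "card (ends G f) = 2" using G fE by (auto simp: loopless_multigraph_def)
  obtain M1 where M1: "perfect_matching G M1" "f \<in> M1" using matching_covered_edge[OF mc fE] .
  then have eM1: "e \<in> M1" using equivalent_edgesD[OF eq M1(1) f] e by auto
  obtain N U KK where N: "matching_in ?G' ?X N" "U \<subseteq> ?X" "odd_parts ?G' (?X - U) KK"
    "card ?X + card U \<le> card KK + 2 * card N"
    using tutte_berge[OF G', of ?X] by auto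
  \<comment> \<open>A matching of \<open>?X\<close> without \<open>e\<close> that covered all of
    \<open>?X\<close> would form with \<open>f\<close> a perfect matching avoiding \<open>e\<close>.
    By parity at least two vertices stay uncovered.\<close>
  have Ncard: "2 * card N + 2 \<le> card ?X"
  proof (rule ccontr)
    assume small: "\<not> ?thesis"
    have "even (card (verts G))" using perfect_matching_card[OF G M1(1)] by simp
    moreover have cX: "card ?X = card (verts G) - 2" "2 \<le> card (verts G)"
      using fends fV card_mono[OF fV fends(1)] by (auto simp: card_Diff_subset finite_ends[OF G fE])
    ultimately have "even (card ?X)" by simp
    then have le: "card ?X \<le> 2 * card N" using small by presburger
    have cov: "card (\<Union>(ends ?G' ` N)) = 2 * card N" by (rule matching_in_cover[OF G' N(1)])
    have "\<Union>(ends ?G' ` N) \<subseteq> ?X" using N(1) by (auto simp: matching_in_def)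
    then have full: "\<Union>(ends ?G' ` N) = ?X" using cov le fV by (intro card_seteq) auto
    have "perfect_matching G (insert f N)"
      unfolding perfect_matching_def
    proof (intro conjI)
      show "insert f N \<subseteq> edges G" using N(1) fE by (auto simp: matching_in_def)
      have "ends G g \<inter> ends G f = {}" if "g \<in> N" for g using N(1) that by (auto simp: matching_in_def)
      then show "\<forall>g\<in>insert f N. \<forall>h\<in>insert f N. g \<noteq> h \<longrightarrow> ends G g \<inter> ends G h = {}"
        using N(1) by (auto simp: matching_in_def)
      show "\<forall>v\<in>verts G. \<exists>g\<in>insert f N. v \<in> ends G g" using full by auto
    qed
    then have "e \<in> insert f N" using equivalent_edgesD[OF eq _ f] e by auto
    then show False using \<open>e \<noteq> f\<close> N(1) by (auto simp: matching_in_def)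
  qed
  define S where "S = U \<union> ends G f"
  have SV: "S \<subseteq> verts G" using N(2) fends by (auto simp: S_def)
  have finS: "finite S" using SV fV by (rule finite_subset)
  have KS: "K \<subseteq> verts G - S" if "K \<in> KK" for K
    using N(3) that by (auto simp: odd_parts_def S_def)
  have Kodd: "odd (card K)" if "K \<in> KK" for K using N(3) that by (auto simp: odd_parts_def)
  have Kdisj: "disjoint KK" using N(3) by (auto simp: odd_parts_def)
  have Kedge: "ends G g \<subseteq> K" if "K \<in> KK" "g \<in> edges G" "g \<noteq> e" "ends G g \<inter> K \<noteq> {}" "ends G g \<inter> S = {}" for K g
  proof -
    have "ends G g \<subseteq> verts G" using G that(2) by (auto simp: loopless_multigraph_def)
    then have "ends G g \<subseteq> ?X - U" using that(5) by (auto simp: S_def)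
    then show ?thesis using N(3) that by (auto simp: odd_parts_def)
  qed
  have finKK: "finite KK" using KS fV by (intro finite_subset[of KK "Pow (verts G)"]) auto
  \<comment> \<open>The two ends of \<open>f\<close> added to \<open>U\<close> use up exactly the
    deficiency of two.\<close>
  have SKK: "card S \<le> card KK"
  proof -
    have "card S \<le> card U + 2" using card_Un_le[of U "ends G f"] fends by (simp add: S_def)
    then show ?thesis using N(4) Ncard by linarith
  qed
  text \<open>Counting the matching edges at \<open>S\<close>: the members of \<open>KK\<close> that \<open>e\<close> does not leave inject into \<open>S\<close>.\<close>
  have count: "\<exists>\<phi>. inj_on \<phi> L \<and> \<phi> ` L \<subseteq> S - T \<and> (\<forall>K\<in>L. \<exists>g\<in>M. \<phi> K \<in> ends G g \<and> ends G g \<inter> K \<noteq> {})"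
    if M: "perfect_matching G M" and L: "L \<subseteq> KK" "\<forall>K\<in>L. e \<in> M \<longrightarrow> e \<notin> edge_cut G K"
      and T: "\<forall>g\<in>M. ends G g \<inter> T \<noteq> {} \<longrightarrow> (\<forall>K\<in>L. ends G g \<inter> K = {})" for M L T
  proof -
    have "\<exists>x. x \<in> S - T \<and> (\<exists>g\<in>M. x \<in> ends G g \<and> ends G g \<inter> K \<noteq> {})" if K: "K \<in> L" for K
    proof -
      have KV: "K \<subseteq> verts G" and KKK: "K \<in> KK" using KS K L by auto
      obtain g where g: "g \<in> M" "g \<in> edge_cut G K"
        using perfect_matching_leaves_odd[OF G M KV Kodd[OF KKK]] .
      have gE: "g \<in> edges G" using g(2) by (auto simp: edge_cut_def)
      have gK: "ends G g \<inter> K \<noteq> {}" "\<not> ends G g \<subseteq> K" using g in_edge_cut_iff[OF G gE] by auto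
      have "g \<noteq> e" using g L(2) K by auto
      then have "ends G g \<inter> S \<noteq> {}" using Kedge[OF KKK gE] gK by blast
      then obtain x where "x \<in> ends G g" "x \<in> S" by auto
      moreover have "x \<notin> T" using T g(1) K gK calculation by blast
      ultimately show ?thesis using g gK by blast
    qed
    then obtain \<phi> where \<phi>: "\<And>K. K \<in> L \<Longrightarrow> \<phi> K \<in> S - T \<and> (\<exists>g\<in>M. \<phi> K \<in> ends G g \<and> ends G g \<inter> K \<noteq> {})"
      by metis
    have "inj_on \<phi> L"
    proof (rule inj_onI)
      fix K K' assume K: "K \<in> L" "K' \<in> L" "\<phi> K = \<phi> K'"
      obtain g where g: "g \<in> M" "\<phi> K \<in> ends G g" "ends G g \<inter> K \<noteq> {}" using \<phi>[OF K(1)] by auto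
      obtain g' where g': "g' \<in> M" "\<phi> K' \<in> ends G g'" "ends G g' \<inter> K' \<noteq> {}" using \<phi>[OF K(2)] by auto
      have "g = g'" using perfect_matching_unique[OF M g(1) g'(1) g(2)] g'(2) K(3) by simp
      have gE: "g \<in> edges G" using g(1) perfect_matching_subset[OF M] by auto
      obtain y where y: "ends G g = {\<phi> K, y}" using loopless_other_end[OF G gE g(2)] .
      have "\<phi> K \<in> S" using \<phi>[OF K(1)] by auto
      then have "\<phi> K \<notin> K" "\<phi> K \<notin> K'" using KS[of K] KS[of K'] K L by auto
      then have "y \<in> K" "y \<in> K'" using y g(3) g'(3) \<open>g = g'\<close> by auto
      then show "K = K'" using Kdisj K L by (auto simp: disjoint_def)
    qed
    then show ?thesis using \<phi> by blast
  qed
  \<comment> \<open>A perfect matching avoiding \<open>R\<close>, hence \<open>e\<close>, sends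
    every member of \<open>KK\<close> to its own vertex of \<open>S\<close>. This gives the opposite
    inequality.\<close>
  obtain M0 where M0: "perfect_matching (delete_edges G R) M0" using matching_covered_has_matching[OF del] .
  then have M0': "perfect_matching G M0" "M0 \<inter> R = {}" by (auto simp: perfect_matching_delete_edges)
  have KKS: "card KK \<le> card S"
  proof -
    obtain \<phi> where "inj_on \<phi> KK" "\<phi> ` KK \<subseteq> S - {}" using count[OF M0'(1), of KK "{}"] M0' e by auto
    then show ?thesis using finS by (metis Diff_empty card_inj_on_le)
  qed
  have cS: "card S = card KK" using SKK KKS by simp
  \<comment> \<open>With equality the injection of \<open>KK\<close> into \<open>S\<close> is onto,
    so every matching edge at \<open>S\<close> runs to a member of \<open>KK\<close>.\<close>
  have avoid: "\<exists>K\<in>KK. ends G g \<inter> K \<noteq> {}"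
    if M: "perfect_matching G M" "e \<notin> M" "g \<in> M" "ends G g \<inter> S \<noteq> {}" for M g
  proof -
    obtain \<phi> where \<phi>: "inj_on \<phi> KK" "\<phi> ` KK \<subseteq> S" "\<forall>K\<in>KK. \<exists>g\<in>M. \<phi> K \<in> ends G g \<and> ends G g \<inter> K \<noteq> {}"
      using count[OF M(1), of KK "{}"] M(2) by auto
    then have "\<phi> ` KK = S" using finS cS by (intro card_subset_eq) (auto simp: card_image)
    then obtain K where K: "K \<in> KK" "\<phi> K \<in> ends G g" using M(4) by blast
    then obtain g' where "g' \<in> M" "\<phi> K \<in> ends G g'" "ends G g' \<inter> K \<noteq> {}" using \<phi>(3) by blast
    then show ?thesis using perfect_matching_unique[OF M(1), of g' g] M(3) K by blast
  qed
  text \<open>A matching with \<open>e\<close> also contains \<open>f\<close>, and loses two vertices of \<open>S\<close> to \<open>f\<close>.\<close>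
  let ?L = "{K \<in> KK. e \<notin> edge_cut G K}"
  have emeet: "card {K \<in> KK. e \<in> edge_cut G K} \<le> 2 \<and>
    (ends G e \<inter> S = {} \<and> \<not> (\<exists>K\<in>KK. ends G e \<subseteq> K) \<and> card {K \<in> KK. e \<in> edge_cut G K} = 2 \<and> ends G e \<subseteq> \<Union>KK \<or>
     card {K \<in> KK. e \<in> edge_cut G K} \<le> 1)"
  proof -
    obtain x y where xy: "ends G e = {x, y}" "x \<noteq> y" "x \<in> verts G" "y \<in> verts G" using loopless_ends[OF G eE] .
    let ?A = "{K \<in> KK. e \<in> edge_cut G K}"
    have sub: "?A \<subseteq> {K \<in> KK. x \<in> K} \<union> {K \<in> KK. y \<in> K}" using xy by (auto simp: edge_cut_def)
    have uniq: "K = K'" if "K \<in> KK" "K' \<in> KK" "v \<in> K" "v \<in> K'" for K K' v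
      using Kdisj that by (auto simp: disjoint_def)
    have c1: "card {K \<in> KK. v \<in> K} \<le> 1" for v
      using finKK uniq by (subst card_le_Suc0_iff_eq[unfolded One_nat_def[symmetric]]) auto
    have c2: "card ?A \<le> card {K \<in> KK. x \<in> K} + card {K \<in> KK. y \<in> K}"
      using card_mono[OF _ sub] finKK card_Un_le[of "{K \<in> KK. x \<in> K}" "{K \<in> KK. y \<in> K}"] by simp
    show ?thesis
    proof (cases "card ?A \<le> 1")
      case True
      then show ?thesis by simp
    next
      case False
      have "card {K \<in> KK. x \<in> K} \<noteq> 0" "card {K \<in> KK. y \<in> K} \<noteq> 0" and two: "card ?A = 2"
        using False c1[of x] c1[of y] c2 by linarith+
      then have "{K \<in> KK. x \<in> K} \<noteq> {}" "{K \<in> KK. y \<in> K} \<noteq> {}" by (metis card.empty)+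
      then obtain K1 K2 where K12: "K1 \<in> KK" "x \<in> K1" "K2 \<in> KK" "y \<in> K2" by blast
      have "K1 \<noteq> K2"
      proof
        assume "K1 = K2"
        then have "K = K1" if "K \<in> ?A" for K using that sub uniq K12 by blast
        then have "?A \<subseteq> {K1}" by auto
        then have "card ?A \<le> card {K1}" by (intro card_mono) auto
        then show False using two by simp
      qed
      then have a1: "\<not> (\<exists>K\<in>KK. ends G e \<subseteq> K)" using uniq K12 xy by (metis insert_subset)
      have a2: "ends G e \<inter> S = {}" using xy K12 KS by auto
      have a3: "ends G e \<subseteq> \<Union>KK" using xy K12 by auto
      show ?thesis by (intro conjI disjI1 a1 a2 a3 two) (simp add: two)
    qed
  qed
  have cL: "card ?L + card {K \<in> KK. e \<in> edge_cut G K} = card KK"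
    using finKK by (subst card_Un_disjoint[symmetric]) (auto intro: arg_cong[where f = card])
  have with_e: "card ?L + 2 \<le> card S" "card ?L + 2 = card S \<Longrightarrow> g \<in> M \<Longrightarrow> ends G g \<inter> S \<noteq> {} \<Longrightarrow> g \<noteq> f \<Longrightarrow>
      \<exists>K\<in>KK. ends G g \<inter> K \<noteq> {}"
    if M: "perfect_matching G M" "e \<in> M" for M g
  proof -
    have fM: "f \<in> M" using equivalent_edgesD[OF eq M(1) e M(2)] f by auto
    have T: "\<forall>g\<in>M. ends G g \<inter> ends G f \<noteq> {} \<longrightarrow> (\<forall>K\<in>?L. ends G g \<inter> K = {})"
    proof (intro ballI impI)
      fix g K assume g: "g \<in> M" "ends G g \<inter> ends G f \<noteq> {}" "K \<in> ?L"
      then have "g = f" using perfect_matching_unique[OF M(1) g(1) fM] by blast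
      then show "ends G g \<inter> K = {}" using KS[of K] g(3) by (auto simp: S_def)
    qed
    have ex: "\<exists>\<phi>. inj_on \<phi> ?L \<and> \<phi> ` ?L \<subseteq> S - ends G f \<and> (\<forall>K\<in>?L. \<exists>g\<in>M. \<phi> K \<in> ends G g \<and> ends G g \<inter> K \<noteq> {})"
      by (rule count[OF M(1) _ _ T]) auto
    obtain \<phi> where \<phi>: "inj_on \<phi> ?L" "\<phi> ` ?L \<subseteq> S - ends G f"
      "\<forall>K\<in>?L. \<exists>g\<in>M. \<phi> K \<in> ends G g \<and> ends G g \<inter> K \<noteq> {}"
      using ex by (elim exE conjE) (rule that)
    have cSf: "card (S - ends G f) + 2 = card S"
      using fends finS card_mono[OF finS, of "ends G f"]
      by (subst card_Diff_subset) (auto simp: S_def finite_ends[OF G fE])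
    have "card ?L \<le> card (S - ends G f)" using \<phi> finS by (intro card_inj_on_le) auto
    then show "card ?L + 2 \<le> card S" using cSf by simp
    assume tight: "card ?L + 2 = card S" and g: "g \<in> M" "ends G g \<inter> S \<noteq> {}" "g \<noteq> f"
    have im: "\<phi> ` ?L = S - ends G f"
      using \<phi> cSf tight finS by (intro card_subset_eq) (auto simp: card_image)
    obtain x where x: "x \<in> ends G g" "x \<in> S" using g by auto
    have "x \<notin> ends G f" using perfect_matching_unique[OF M(1) g(1) fM x(1)] g(3) by auto
    then have "x \<in> \<phi> ` ?L" using im x by simp
    then obtain K where K0: "x = \<phi> K" "K \<in> ?L" by (rule imageE)
    then have K: "K \<in> KK" "\<phi> K \<in> ends G g" using x by auto
    obtain g' where "g' \<in> M" "\<phi> K \<in> ends G g'" "ends G g' \<inter> K \<noteq> {}" using bspec[OF \<phi>(3) K0(2)] by auto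
    then show "\<exists>K\<in>KK. ends G g \<inter> K \<noteq> {}"
      using perfect_matching_unique[OF M(1), of g' g] g(1) K by blast
  qed
  \<comment> \<open>A matching with \<open>e\<close> and \<open>f\<close> has two vertices of
    \<open>S\<close> fewer to offer, so \<open>e\<close> itself must serve two members of
    \<open>KK\<close>.\<close>
  have two: "card {K \<in> KK. e \<in> edge_cut G K} = 2" and eS: "ends G e \<inter> S = {}"
    and eK: "\<not> (\<exists>K\<in>KK. ends G e \<subseteq> K)" and eKK: "ends G e \<subseteq> \<Union>KK"
    using with_e(1)[OF M1(1) eM1] cL cS emeet by auto
  have L2: "card ?L + 2 = card S" using two cL cS by simp
  have KK2: "2 \<le> card KK" using two cL by simp
  have reach: "\<exists>K\<in>KK. ends G g \<inter> K \<noteq> {}" if g: "g \<in> edges G" "g \<noteq> f" "ends G g \<inter> S \<noteq> {}" for g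
  proof -
    obtain M where M: "perfect_matching G M" "g \<in> M" using matching_covered_edge[OF mc g(1)] .
    show ?thesis
      using avoid[OF M(1) _ M(2) g(3)] with_e(2)[OF M(1) _ L2 M(2) g(3) g(2)] by blast
  qed
  have inS: "g = f" if g: "g \<in> edges G" "ends G g \<subseteq> S" for g
  proof (rule ccontr)
    assume "g \<noteq> f"
    moreover have "ends G g \<inter> S \<noteq> {}" using g ends_nonempty[OF G g(1)] by auto
    ultimately obtain K where "K \<in> KK" "ends G g \<inter> K \<noteq> {}" using reach g by blast
    then show False using KS[of K] g(2) by auto
  qed
  have rest: "verts G - S = \<Union>KK"
  proof
    show "\<Union>KK \<subseteq> verts G - S" using KS by auto
    show "verts G - S \<subseteq> \<Union>KK"
    proof (rule ccontr)
      assume "\<not> ?thesis"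
      then obtain z where z: "z \<in> verts G" "z \<notin> S" "z \<notin> \<Union>KK" by auto
      obtain w where w: "w \<in> ends G e" using ends_nonempty[OF G eE] by auto
      have wV: "w \<in> verts G" using w eE G by (auto simp: loopless_multigraph_def)
      obtain g where g: "g \<in> edge_cut G (S \<union> \<Union>KK)"
        by (rule matching_covered_crossing[OF mc wV z(1), of "S \<union> \<Union>KK"]) (use w eKK z in auto)
      then have gE: "g \<in> edges G" by (auto simp: edge_cut_def)
      have g': "ends G g \<inter> (S \<union> \<Union>KK) \<noteq> {}" "\<not> ends G g \<subseteq> S \<union> \<Union>KK" using g in_edge_cut_iff[OF G gE] by auto
      have "g \<noteq> e" using g' eKK by auto
      have "g \<noteq> f" using g' by (auto simp: S_def)
      show False
      proof (cases "ends G g \<inter> S = {}")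
        case True
        then obtain K where "K \<in> KK" "ends G g \<inter> K \<noteq> {}" using g'(1) by auto
        then show False using Kedge[OF _ gE \<open>g \<noteq> e\<close> _ True] g'(2) by blast
      next
        case False
        obtain K where K: "K \<in> KK" "ends G g \<inter> K \<noteq> {}" using reach[OF gE \<open>g \<noteq> f\<close> False] by auto
        obtain p q where pq: "ends G g = {p, q}" using loopless_ends[OF G gE] .
        then show False using K False KS[OF K(1)] g'(2) by auto
      qed
    qed
  qed
  have tight: "tight_shore G K" if K: "K \<in> KK" for K
    unfolding tight_shore_def
  proof (intro conjI allI impI)
    have KV: "K \<subseteq> verts G" using KS[OF K] by auto
    show "K \<noteq> {}" using Kodd[OF K] by auto
    have "ends G f \<subseteq> verts G" "ends G f \<inter> K = {}" "ends G f \<noteq> {}"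
      using fends KS[OF K] ends_nonempty[OF G fE] by (auto simp: S_def)
    then show "K \<subset> verts G" using KV by auto
    fix M assume M: "perfect_matching G M"
    have fin: "finite M" by (rule perfect_matching_finite[OF G M])
    text \<open>The cuts of the members of \<open>KK\<close> use up exactly the available edges, so each is met once.\<close>
    have single: "g = h" if gh: "g \<in> M \<inter> edge_cut G K" "h \<in> M \<inter> edge_cut G K" for g h
    proof (cases "e \<in> M")
      case False
      obtain \<phi> where \<phi>: "inj_on \<phi> KK" "\<phi> ` KK \<subseteq> S" "\<forall>K\<in>KK. \<exists>g\<in>M. \<phi> K \<in> ends G g \<and> ends G g \<inter> K \<noteq> {}"
        using count[OF M, of KK "{}"] False by auto
      then have im: "\<phi> ` KK = S" using finS cS by (intro card_subset_eq) (auto simp: card_image)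
      have "\<phi> K \<in> ends G g'" if g': "g' \<in> M \<inter> edge_cut G K" for g'
      proof -
        have g'E: "g' \<in> edges G" using g' by (auto simp: edge_cut_def)
        have c: "ends G g' \<inter> K \<noteq> {}" "\<not> ends G g' \<subseteq> K" using g' in_edge_cut_iff[OF G g'E] by auto
        have "ends G g' \<inter> S \<noteq> {}" using Kedge[OF K g'E] g' False c by blast
        then obtain s where s: "s \<in> ends G g'" "s \<in> S" by auto
        then obtain K' where K': "K' \<in> KK" "s = \<phi> K'" using im by auto
        then obtain g'' where g'': "g'' \<in> M" "s \<in> ends G g''" "ends G g'' \<inter> K' \<noteq> {}" using \<phi>(3) by metis
        have "g'' = g'" using perfect_matching_unique[OF M, of g'' g' s] g'' g' s by auto
        obtain y where y: "ends G g' = {s, y}" using loopless_other_end[OF G g'E s(1)] .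
        have "y \<in> K" "y \<in> K'" using y c(1) g''(3) \<open>g'' = g'\<close> s(2) KS[OF K] KS[OF K'(1)] by auto
        then have "K = K'" using Kdisj K K'(1) by (auto simp: disjoint_def)
        then show ?thesis using s K' by simp
      qed
      then show ?thesis using perfect_matching_unique[OF M] gh by blast
    next
      case True
      have fM: "f \<in> M" using equivalent_edgesD[OF eq M e True] f by auto
      have T: "\<forall>g\<in>M. ends G g \<inter> ends G f \<noteq> {} \<longrightarrow> (\<forall>K\<in>?L. ends G g \<inter> K = {})"
      proof (intro ballI impI)
        fix g K assume g: "g \<in> M" "ends G g \<inter> ends G f \<noteq> {}" "K \<in> ?L"
        then have "g = f" using perfect_matching_unique[OF M g(1) fM] by blast
        then show "ends G g \<inter> K = {}" using KS[of K] g(3) by (auto simp: S_def)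
      qed
      have ex: "\<exists>\<phi>. inj_on \<phi> ?L \<and> \<phi> ` ?L \<subseteq> S - ends G f \<and> (\<forall>K\<in>?L. \<exists>g\<in>M. \<phi> K \<in> ends G g \<and> ends G g \<inter> K \<noteq> {})"
      by (rule count[OF M _ _ T]) auto
    obtain \<phi> where \<phi>: "inj_on \<phi> ?L" "\<phi> ` ?L \<subseteq> S - ends G f"
        "\<forall>K\<in>?L. \<exists>g\<in>M. \<phi> K \<in> ends G g \<and> ends G g \<inter> K \<noteq> {}"
        using ex by (elim exE conjE) (rule that)
      have cSf: "card (S - ends G f) + 2 = card S"
        using fends finS card_mono[OF finS, of "ends G f"]
        by (subst card_Diff_subset) (auto simp: S_def finite_ends[OF G fE])
      have im: "\<phi> ` ?L = S - ends G f"
        using \<phi> cSf L2 finS by (intro card_subset_eq) (auto simp: card_image)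
      have edge: "g' = e \<and> K \<notin> ?L \<or> K \<in> ?L \<and> \<phi> K \<in> ends G g'" if g': "g' \<in> M \<inter> edge_cut G K" for g'
      proof (cases "g' = e")
        case True
        then show ?thesis using g' by auto
      next
        case False
        have g'E: "g' \<in> edges G" using g' by (auto simp: edge_cut_def)
        have c: "ends G g' \<inter> K \<noteq> {}" "\<not> ends G g' \<subseteq> K" using g' in_edge_cut_iff[OF G g'E] by auto
        have "ends G g' \<inter> S \<noteq> {}" using Kedge[OF K g'E False] c by blast
        then obtain s where s: "s \<in> ends G g'" "s \<in> S" by auto
        have "g' \<noteq> f" using c(1) KS[OF K] by (auto simp: S_def)
        then have "s \<notin> ends G f" using perfect_matching_unique[OF M, of g' f s] g' fM s by auto
        then have "s \<in> \<phi> ` ?L" using im s by simp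
        then obtain K' where K': "s = \<phi> K'" "K' \<in> ?L" by (rule imageE)
        obtain g'' where g'': "g'' \<in> M" "s \<in> ends G g''" "ends G g'' \<inter> K' \<noteq> {}" using bspec[OF \<phi>(3) K'(2)] K'(1) by auto
        have "g'' = g'" using perfect_matching_unique[OF M, of g'' g' s] g'' g' s by auto
        obtain y where y: "ends G g' = {s, y}" using loopless_other_end[OF G g'E s(1)] .
        have "y \<in> K" "y \<in> K'" using y c(1) g''(3) \<open>g'' = g'\<close> s(2) KS[OF K] KS[of K'] K'(2) by auto
        then have "K = K'" using Kdisj K K'(2) by (auto simp: disjoint_def)
        then show ?thesis using s K' by simp
      qed
      show ?thesis
        using edge[OF gh(1)] edge[OF gh(2)] perfect_matching_unique[OF M, of g h] gh by blast
    qed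
    obtain g where g: "g \<in> M" "g \<in> edge_cut G K" using perfect_matching_leaves_odd[OF G M KV Kodd[OF K]] .
    then have "M \<inter> edge_cut G K = {g}" using single by blast
    then show "card (M \<inter> edge_cut G K) = 1" by simp
  qed
  show ?thesis
    by (intro exI[of _ S] exI[of _ KK])
      (use SV Kdisj rest cS KK2 eS eK inS Kedge Kodd tight in \<open>simp add: S_def\<close>)
qed

section \<open>Two-colourings and doublets\<close>

definition flips :: "('v, 'e) mgraph \<Rightarrow> ('v \<Rightarrow> bool) \<Rightarrow> 'e \<Rightarrow> bool" where
  "flips G c e \<longleftrightarrow> (\<exists>x y. ends G e = {x, y} \<and> c x \<and> \<not> c y)"

lemma flipsI: "ends G e = {x, y} \<Longrightarrow> c x \<noteq> c y \<Longrightarrow> flips G c e"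
  by (cases "c x") (auto simp: flips_def intro: insert_commute)

lemma flipsD: "flips G c e \<Longrightarrow> ends G e = {x, y} \<Longrightarrow> c x \<noteq> c y"
  by (auto simp: flips_def doubleton_eq_iff)

lemma flips_Not: "flips G (\<lambda>v. \<not> c v) e = flips G c e"
  by (auto simp: flips_def)

lemma flips_delete_edges [simp]: "flips (delete_edges G R) c e = flips G c e"
  by (simp add: flips_def)

lemma bipartite_graph_iff:
  assumes G: "loopless_multigraph G"
  shows "bipartite_graph G \<longleftrightarrow> (\<exists>c. \<forall>e\<in>edges G. flips G c e)"
proof
  assume "bipartite_graph G"
  then obtain A B where AB: "A \<inter> B = {}" "\<forall>e\<in>edges G. \<exists>a\<in>A. \<exists>b\<in>B. ends G e = {a, b}"
    by (auto simp: bipartite_graph_def)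
  have "flips G (\<lambda>v. v \<in> A) e" if "e \<in> edges G" for e
    using AB that unfolding flips_def by blast
  then show "\<exists>c. \<forall>e\<in>edges G. flips G c e" by blast
next
  assume "\<exists>c. \<forall>e\<in>edges G. flips G c e"
  then obtain c where c: "\<And>e. e \<in> edges G \<Longrightarrow> flips G c e" by blast
  have "\<exists>a\<in>{v \<in> verts G. c v}. \<exists>b\<in>{v \<in> verts G. \<not> c v}. ends G e = {a, b}" if e: "e \<in> edges G" for e
  proof -
    obtain x y where "ends G e = {x, y}" "c x" "\<not> c y" using c[OF e] by (auto simp: flips_def)
    moreover have "ends G e \<subseteq> verts G" using G e by (auto simp: loopless_multigraph_def)
    ultimately show ?thesis by auto
  qed
  then show "bipartite_graph G" unfolding bipartite_graph_def
    by (intro exI[of _ "{v \<in> verts G. c v}"] exI[of _ "{v \<in> verts G. \<not> c v}"]) auto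
qed

text \<open>The removable doublets of brick theory. The colouring \<open>c\<close> of the bipartite
  remainder is kept as a parameter, so that colourings of several doublets can be
  multiplied.\<close>

definition doublet :: "('v, 'e) mgraph \<Rightarrow> 'e set \<Rightarrow> ('v \<Rightarrow> bool) \<Rightarrow> bool" where
  "doublet G R c \<longleftrightarrow> equivalent_edges G R \<and> matching_covered (delete_edges G R) \<and>
     (\<forall>e\<in>edges G - R. flips G c e) \<and>
     (\<exists>a b. R = {a, b} \<and> a \<noteq> b \<and> (\<forall>x\<in>ends G a. c x) \<and> (\<forall>x\<in>ends G b. \<not> c x))"

definition sgn_of :: "bool \<Rightarrow> int" where
  "sgn_of b = (if b then 1 else - 1)"

lemma delete_edges_constant:
  assumes del: "matching_covered (delete_edges G R)"
    and const: "\<And>e x y. e \<in> edges G \<Longrightarrow> e \<notin> R \<Longrightarrow> ends G e = {x, y} \<Longrightarrow> h x = h y"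
    and "u \<in> verts G" "v \<in> verts G"
  shows "h u = (h v :: bool)"
proof (rule ccontr)
  assume ne: "h u \<noteq> h v"
  obtain e where e: "e \<in> edge_cut G {w. h w = h u}" "e \<notin> R"
    by (rule matching_covered_delete_crossing[OF del assms(3,4), of "{w. h w = h u}"]) (use ne in auto)
  have G: "loopless_multigraph (delete_edges G R)" by (rule matching_coveredD(1)[OF del])
  have eE: "e \<in> edges G" using e by (auto simp: edge_cut_def)
  obtain x y where xy: "ends G e = {x, y}"
    by (rule loopless_ends[OF G, of e]) (use eE e(2) in auto)
  have "h x = h y" by (rule const[OF eE e(2) xy])
  then show False using e(1) xy by (auto simp: edge_cut_def)
qed

text \<open>Edges inside \<open>X\<close> cancel, so the colour excess of \<open>X\<close> is the
  sign of the one end of the cut edge in \<open>X\<close>. The excess does not depend on the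
  matching; in a bipartite graph a tight shore therefore meets all its cut edges in one
  colour.\<close>

lemma shore_balance:
  assumes G: "loopless_multigraph G" and M: "perfect_matching G M" and X: "X \<subseteq> verts G"
    and fl: "\<And>e. e \<in> M \<Longrightarrow> ends G e \<subseteq> X \<Longrightarrow> flips G c e"
    and cut: "M \<inter> edge_cut G X = {g}" and x: "x \<in> ends G g" "x \<in> X"
  shows "(\<Sum>v\<in>X. sgn_of (c v)) = sgn_of (c x)"
proof -
  have fV: "finite (verts G)" using G by (simp add: loopless_multigraph_def)
  let ?h = "\<lambda>v. if v \<in> X then sgn_of (c v) else 0"
  have fM: "finite M" by (rule perfect_matching_finite[OF G M])
  have gM: "g \<in> M" using cut by auto
  have "(\<Sum>v\<in>X. sgn_of (c v)) = sum ?h (verts G)"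
    using fV X by (simp add: sum.If_cases Int_absorb1)
  also have "\<dots> = (\<Sum>e\<in>M. sum ?h (ends G e))" by (rule perfect_matching_sum[OF G M])
  also have "\<dots> = (\<Sum>e\<in>M. if e = g then sgn_of (c x) else 0)"
  proof (intro sum.cong refl)
    fix e assume e: "e \<in> M"
    have eE: "e \<in> edges G" using e perfect_matching_subset[OF M] by auto
    obtain p q where pq: "ends G e = {p, q}" "p \<noteq> q" using loopless_ends[OF G eE] .
    show "sum ?h (ends G e) = (if e = g then sgn_of (c x) else 0)"
    proof (cases "e = g")
      case True
      obtain y where y: "ends G e = {x, y}" "x \<noteq> y" using loopless_other_end[OF G eE] True x(1) by metis
      have "y \<notin> X" using True cut in_edge_cut_iff[OF G eE, of X] y x(2) by auto
      then show ?thesis using True y x(2) by simp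
    next
      case False
      then have "e \<notin> edge_cut G X" using cut e by auto
      then consider "ends G e \<inter> X = {}" | "ends G e \<subseteq> X" using in_edge_cut_iff[OF G eE] by auto
      then show ?thesis
      proof cases
        case 1
        then show ?thesis using pq False by auto
      next
        case 2
        then have "c p \<noteq> c q" using flipsD[OF fl[OF e 2] pq(1)] by simp
        then show ?thesis using pq 2 False by (auto simp: sgn_of_def)
      qed
    qed
  qed
  also have "\<dots> = sgn_of (c x)" using fM gM by simp
  finally show ?thesis .
qed

lemma sgn_of_inject [simp]: "sgn_of a = sgn_of b \<longleftrightarrow> a = b"
  by (auto simp: sgn_of_def)

text \<open>Each tight member of the barrier family meets its cut in one colour. A set
  \<open>P\<close> adapted to these colours is crossed by no edge other than \<open>e\<close> and
  \<open>f\<close>, although it separates the ends of \<open>e\<close>, which contradicts the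
  connectedness of \<open>G\<close> minus \<open>R\<close>.\<close>

lemma bipartite_no_equivalent_pair:
  assumes mc: "matching_covered G" and fl: "\<And>e. e \<in> edges G \<Longrightarrow> flips G c e"
    and eq: "equivalent_edges G R" and del: "matching_covered (delete_edges G R)"
    and e: "e \<in> R" and f: "f \<in> R"
  shows "e = f"
proof (rule ccontr)
  assume "e \<noteq> f"
  note G = matching_coveredD(1)[OF mc]
  obtain S KK where SV: "S \<subseteq> verts G" and Kd: "disjoint KK" and rest: "verts G - S = \<Union>KK"
    and eS: "ends G e \<inter> S = {}" and eK: "\<not> (\<exists>K\<in>KK. ends G e \<subseteq> K)"
    and inS: "\<forall>g\<in>edges G. ends G g \<subseteq> S \<longrightarrow> g = f"
    and Kedge: "\<forall>K\<in>KK. \<forall>g\<in>edges G. g \<noteq> e \<and> ends G g \<inter> K \<noteq> {} \<and> ends G g \<inter> S = {} \<longrightarrow> ends G g \<subseteq> K"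
    and tight: "\<forall>K\<in>KK. odd (card K) \<and> tight_shore G K"
    using equivalent_pair_barrier[OF mc eq del e f \<open>e \<noteq> f\<close>] by (elim exE conjE) (rule that)
  have eE: "e \<in> edges G" using e eq by (auto simp: equivalent_edges_def)
  have KV: "K \<subseteq> verts G" "K \<inter> S = {}" if "K \<in> KK" for K using rest that by auto
  have bal: "(\<Sum>v\<in>K. sgn_of (c v)) = sgn_of (c x)"
    if K: "K \<in> KK" "g \<in> edge_cut G K" "x \<in> ends G g" "x \<in> K" for K g x
  proof -
    have gE: "g \<in> edges G" using K by (auto simp: edge_cut_def)
    obtain M where M: "perfect_matching G M" "g \<in> M" using matching_covered_edge[OF mc gE] .
    have "card (M \<inter> edge_cut G K) = 1" using tight K(1) M(1) by (auto simp: tight_shore_def)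
    then obtain g' where "M \<inter> edge_cut G K = {g'}" by (auto simp: card_1_singleton_iff)
    moreover have "g \<in> M \<inter> edge_cut G K" using M(2) K(2) by simp
    ultimately have "M \<inter> edge_cut G K = {g}" by simp
    then show ?thesis using shore_balance[OF G M(1) KV(1)[OF K(1)]] fl perfect_matching_subset[OF M(1)] K by blast
  qed
  define \<epsilon> where "\<epsilon> K = ((\<Sum>v\<in>K. sgn_of (c v)) = 1)" for K
  have \<epsilon>: "\<epsilon> K = c x" if "K \<in> KK" "g \<in> edge_cut G K" "x \<in> ends G g" "x \<in> K" for K g x
    using bal[OF that] by (simp add: \<epsilon>_def sgn_of_def)
  \<comment> \<open>The opposite conventions on \<open>S\<close> and on the members of
    \<open>KK\<close> keep both ends of an edge between them on the same side, because such an edge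
    flips \<open>c\<close>.\<close>
  define P where "P = {v \<in> S. \<not> c v} \<union> \<Union>{K \<in> KK. \<epsilon> K}"
  have PK: "x \<in> P \<longleftrightarrow> \<epsilon> K" if "x \<in> K" "K \<in> KK" for x K
  proof -
    have u: "K' = K" if K': "K' \<in> KK" "x \<in> K'" for K'
      using disjointD[OF Kd K'(1) \<open>K \<in> KK\<close>] K'(2) \<open>x \<in> K\<close> by blast
    have "x \<notin> S" using KV(2)[OF \<open>K \<in> KK\<close>] \<open>x \<in> K\<close> by auto
    then have "x \<in> P \<longleftrightarrow> (\<exists>K'\<in>KK. \<epsilon> K' \<and> x \<in> K')" by (simp add: P_def) blast
    also have "\<dots> \<longleftrightarrow> \<epsilon> K" using u \<open>x \<in> K\<close> \<open>K \<in> KK\<close> by metis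
    finally show ?thesis .
  qed
  have PS: "x \<in> P \<longleftrightarrow> \<not> c x" if "x \<in> S" for x using that KV(2) by (auto simp: P_def)
  obtain x y where xy: "ends G e = {x, y}" "x \<noteq> y" "x \<in> verts G" "y \<in> verts G" using loopless_ends[OF G eE] .
  obtain K1 where K1: "K1 \<in> KK" "x \<in> K1" using rest xy eS by blast
  obtain K2 where K2: "K2 \<in> KK" "y \<in> K2" using rest xy eS by blast
  have "e \<in> edge_cut G K1" "e \<in> edge_cut G K2" using eK K1 K2 xy in_edge_cut_iff[OF G eE] by auto
  then have "x \<in> P \<longleftrightarrow> c x" "y \<in> P \<longleftrightarrow> c y" using PK \<epsilon> K1 K2 xy by auto
  then have xyP: "(x \<in> P) \<noteq> (y \<in> P)" using flipsD[OF fl[OF eE] xy(1)] by simp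
  then obtain g where g: "g \<in> edge_cut G P" "g \<notin> R"
    using matching_covered_delete_crossing[OF del xy(3,4), of P]
      matching_covered_delete_crossing[OF del xy(4,3), of P] by metis
  have gE: "g \<in> edges G" using g by (auto simp: edge_cut_def)
  have gne: "g \<noteq> e" "g \<noteq> f" using g e f by auto
  have gP: "ends G g \<inter> P \<noteq> {}" "\<not> ends G g \<subseteq> P" using g in_edge_cut_iff[OF G gE] by auto
  show False
  proof (cases "ends G g \<inter> S = {}")
    case True
    obtain p where p: "p \<in> ends G g" using gP by auto
    then have "p \<in> verts G - S" using True G gE by (auto simp: loopless_multigraph_def)
    then obtain K where K: "K \<in> KK" "p \<in> K" using rest by auto
    then have "ends G g \<subseteq> K" using Kedge gE gne True p by blast
    then show False using gP PK K by blast
  next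
    case False
    then obtain s where s: "s \<in> ends G g" "s \<in> S" by auto
    obtain k where k: "ends G g = {s, k}" "s \<noteq> k" "k \<in> verts G" using loopless_other_end[OF G gE s(1)] .
    have "k \<notin> S" using inS gE gne k s by auto
    then obtain K where K: "K \<in> KK" "k \<in> K" using rest k by auto
    have "s \<notin> K" using KV(2)[OF K(1)] s by auto
    then have "g \<in> edge_cut G K" using in_edge_cut_iff[OF G gE] k K by auto
    then have "k \<in> P \<longleftrightarrow> c k" using PK \<epsilon> K k by auto
    moreover have "c s \<noteq> c k" by (rule flipsD[OF fl[OF gE] k(1)])
    ultimately show False using gP k PS[OF s(2)] by auto
  qed
qed

text \<open>Without nontrivial tight cuts the members of the barrier family are single vertices, so
  \<open>S\<close> against the rest is a bipartition spoiled only by \<open>f\<close> inside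
  \<open>S\<close> and \<open>e\<close> outside.\<close>

lemma brick_equivalent_pair:
  assumes mc: "matching_covered G" and nt: "\<not> (\<exists>X. nontrivial_tight_shore G X)"
    and eq: "equivalent_edges G R" and del: "matching_covered (delete_edges G R)"
    and e: "e \<in> R" and f: "f \<in> R" and "e \<noteq> f"
  shows "\<exists>c. (\<forall>g\<in>edges G - {e, f}. flips G c g) \<and> (\<forall>x\<in>ends G f. c x) \<and> (\<forall>x\<in>ends G e. \<not> c x)"
proof -
  note G = matching_coveredD(1)[OF mc]
  have fV: "finite (verts G)" using G by (simp add: loopless_multigraph_def)
  obtain S KK where SV: "S \<subseteq> verts G" and rest: "verts G - S = \<Union>KK" and cS: "card S = card KK" "2 \<le> card KK"
    and fS: "ends G f \<subseteq> S" and eS: "ends G e \<inter> S = {}"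
    and inS: "\<forall>g\<in>edges G. ends G g \<subseteq> S \<longrightarrow> g = f"
    and Kedge: "\<forall>K\<in>KK. \<forall>g\<in>edges G. g \<noteq> e \<and> ends G g \<inter> K \<noteq> {} \<and> ends G g \<inter> S = {} \<longrightarrow> ends G g \<subseteq> K"
    and tight: "\<forall>K\<in>KK. odd (card K) \<and> tight_shore G K"
    using equivalent_pair_barrier[OF mc eq del e f \<open>e \<noteq> f\<close>] by (elim exE conjE) (rule that)
  have K1: "card K = 1" if K: "K \<in> KK" for K
  proof -
    have "S \<subseteq> verts G - K" using SV rest K by auto
    then have "2 \<le> card (verts G - K)" using card_mono[of "verts G - K" S] fV cS by simp
    then show ?thesis using nt tight K by (force simp: nontrivial_tight_shore_def)
  qed
  have "flips G (\<lambda>v. v \<in> S) g" if g: "g \<in> edges G" "g \<noteq> e" "g \<noteq> f" for g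
  proof -
    obtain x y where xy: "ends G g = {x, y}" "x \<noteq> y" "x \<in> verts G" "y \<in> verts G" using loopless_ends[OF G g(1)] .
    have "\<not> (x \<in> S \<and> y \<in> S)" using inS g xy by auto
    moreover have "\<not> (x \<notin> S \<and> y \<notin> S)"
    proof
      assume n: "x \<notin> S \<and> y \<notin> S"
      then obtain K where K: "K \<in> KK" "x \<in> K" using rest xy by blast
      have "ends G g \<inter> K \<noteq> {}" "ends G g \<inter> S = {}" using K xy n by auto
      then have "ends G g \<subseteq> K" using Kedge g K(1) by blast
      then show False using K1[OF K(1)] xy by (auto simp: card_1_singleton_iff)
    qed
    ultimately show ?thesis using flipsI[OF xy(1), of "\<lambda>v. v \<in> S"] by blast
  qed
  then show ?thesis using fS eS by (intro exI[of _ "\<lambda>v. v \<in> S"]) auto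
qed

text \<open>This form of the statement on bricks survives the gluing of a bipartite contraction. A
  class with one edge needs no clause: that edge is removable.\<close>

definition doublet_property :: "('v, 'e) mgraph \<Rightarrow> bool" where
  "doublet_property G \<longleftrightarrow> (\<forall>R. equivalent_edges G R \<and> matching_covered (delete_edges G R) \<and> 2 \<le> card R
     \<longrightarrow> (\<exists>c. doublet G R c))"

text \<open>A third element \<open>g\<close> would give one colouring for the pair \<open>e\<close>,
  \<open>f\<close> and another for \<open>e\<close>, \<open>g\<close>. On the connected graph
  \<open>G\<close> minus \<open>R\<close> they agree up to sign, yet \<open>f\<close> flips only the
  second.\<close>

lemma brick_doublet_property:
  assumes mc: "matching_covered G" and nt: "\<not> (\<exists>X. nontrivial_tight_shore G X)"
  shows "doublet_property G"
  unfolding doublet_property_def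
proof (intro allI impI, elim conjE)
  fix R assume eq: "equivalent_edges G R" and del: "matching_covered (delete_edges G R)" and "2 \<le> card R"
  note G = matching_coveredD(1)[OF mc]
  have "R \<noteq> {}" using \<open>2 \<le> card R\<close> by auto
  then obtain e where e: "e \<in> R" by auto
  have "R \<noteq> {e}" using \<open>2 \<le> card R\<close> by auto
  then obtain f where f: "f \<in> R" "e \<noteq> f" using e by blast
  obtain c where c: "\<forall>g\<in>edges G - {e, f}. flips G c g" "\<forall>x\<in>ends G f. c x" "\<forall>x\<in>ends G e. \<not> c x"
    using brick_equivalent_pair[OF mc nt eq del e f] by (elim exE conjE) (rule that)
  have "g = e \<or> g = f" if g: "g \<in> R" for g
  proof (rule ccontr)
    assume n: "\<not> ?thesis"
    then have "e \<noteq> g" by auto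
    obtain c' where c': "\<forall>h\<in>edges G - {e, g}. flips G c' h"
      using brick_equivalent_pair[OF mc nt eq del e g \<open>e \<noteq> g\<close>] by (elim exE conjE) (rule that)
    have fE: "f \<in> edges G" using f eq by (auto simp: equivalent_edges_def)
    obtain x y where xy: "ends G f = {x, y}" "x \<in> verts G" "y \<in> verts G" using loopless_ends[OF G fE] .
    have "(c x = c' x) = (c y = c' y)"
    proof (rule delete_edges_constant[OF del _ xy(2,3)])
      fix h p q assume h: "h \<in> edges G" "h \<notin> R" "ends G h = {p, q}"
      have "h \<in> edges G - {e, f}" "h \<in> edges G - {e, g}" using h e f g by auto
      then have "flips G c h" "flips G c' h" using c(1) c' by blast+
      then have "c p \<noteq> c q" "c' p \<noteq> c' q" using flipsD h(3) by metis+
      then show "(c p = c' p) = (c q = c' q)" by auto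
    qed
    moreover have "f \<in> edges G - {e, g}" using fE f n by auto
    then have "c' x \<noteq> c' y" using flipsD[OF bspec[OF c'] xy(1)] by auto
    ultimately show False using c(2) xy by auto
  qed
  then have "R = {f, e}" using e f by auto
  then have "doublet G R c"
    using eq del c f(2) unfolding doublet_def by (intro conjI ballI exI[of _ f] exI[of _ e]) auto
  then show "\<exists>c. doublet G R c" by blast
qed

section \<open>Contractions of tight cuts\<close>

definition shrink :: "'v set \<Rightarrow> 'v \<Rightarrow> 'v" where
  "shrink X v = (if v \<in> X then SOME x. x \<in> X else v)"

lemma contract_simps:
  "verts (contract G X) = insert (SOME x. x \<in> X) (verts G - X)"
  "edges (contract G X) = {e \<in> edges G. \<not> ends G e \<subseteq> X}"
  "ends (contract G X) e = shrink X ` ends G e"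
  by (simp_all add: contract_def Let_def shrink_def[abs_def])

lemma contract_delete_edges: "contract (delete_edges G R) X = delete_edges (contract G X) R"
  by (auto simp: contract_def delete_edges_def Let_def)

lemma shrink_outside [simp]: "v \<notin> X \<Longrightarrow> shrink X v = v"
  by (simp add: shrink_def)

lemma shrink_inside: "v \<in> X \<Longrightarrow> shrink X v = (SOME x. x \<in> X)"
  by (simp add: shrink_def)

lemma shrink_in_iff [simp]: "shrink X v \<in> X \<longleftrightarrow> v \<in> X"
  by (simp add: shrink_def) (metis someI)

lemma shrink_eq_outside: "w \<notin> X \<Longrightarrow> shrink X v = w \<longleftrightarrow> v = w"
  by (metis shrink_in_iff shrink_outside)

lemma contract_vertex_in_ends:
  assumes "ends G e \<inter> X \<noteq> {}"
  shows "(SOME x. x \<in> X) \<in> ends (contract G X) e"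
proof -
  obtain u where "u \<in> ends G e" "u \<in> X" using assms by auto
  then show ?thesis unfolding contract_simps using shrink_inside[of u X] by (metis imageI)
qed

lemma verts_contract: "X \<noteq> {} \<Longrightarrow> X \<subseteq> verts G \<Longrightarrow> verts (contract G X) = shrink X ` verts G"
  unfolding contract_simps by (auto simp: shrink_def image_iff)

lemma loopless_contract:
  assumes G: "loopless_multigraph G" and X: "X \<noteq> {}" "X \<subseteq> verts G"
  shows "loopless_multigraph (contract G X)"
  unfolding loopless_multigraph_def verts_contract[OF X]
proof (intro conjI ballI)
  show "finite (shrink X ` verts G)" "finite (edges (contract G X))"
    using G by (auto simp: loopless_multigraph_def contract_simps)
  fix e assume "e \<in> edges (contract G X)"
  then have e: "e \<in> edges G" "\<not> ends G e \<subseteq> X" by (auto simp: contract_simps)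
  obtain p q where pq: "ends G e = {p, q}" "p \<noteq> q" "p \<in> verts G" "q \<in> verts G"
    using loopless_ends[OF G e(1)] .
  show "ends (contract G X) e \<subseteq> shrink X ` verts G" using pq by (auto simp: contract_simps)
  have "shrink X p \<noteq> shrink X q" using pq e(2) by (metis insert_subset empty_subsetI shrink_in_iff shrink_outside)
  then show "card (ends (contract G X) e) = 2" using pq by (simp add: contract_simps)
qed

lemma tight_shoreD:
  assumes "tight_shore G X"
  shows "X \<noteq> {}" "X \<subseteq> verts G" "X \<noteq> verts G"
  using assms by (auto simp: tight_shore_def)

lemma tight_shore_cut:
  assumes "tight_shore G X" "perfect_matching G M"
  obtains h where "M \<inter> edge_cut G X = {h}"
  using assms by (auto simp: tight_shore_def card_1_singleton_iff)

lemma tight_shore_Compl: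
  assumes G: "loopless_multigraph G" and "tight_shore G X"
  shows "tight_shore G (verts G - X)"
  using assms edge_cut_Compl[OF G, of X] by (auto simp: tight_shore_def)

lemma tight_shore_delete_edges: "tight_shore G X \<Longrightarrow> tight_shore (delete_edges G R) X"
proof -
  have "M \<inter> (C - R) = M \<inter> C" if "M \<inter> R = {}" for M C using that by auto
  then show "tight_shore G X \<Longrightarrow> tight_shore (delete_edges G R) X"
    by (auto simp: tight_shore_def perfect_matching_delete_edges)
qed

lemma edge_cut_meets:
  "loopless_multigraph G \<Longrightarrow> e \<in> edges G \<Longrightarrow> ends G e \<inter> X \<noteq> {} \<Longrightarrow> \<not> ends G e \<subseteq> X \<Longrightarrow> e \<in> edge_cut G X"
  by (simp add: in_edge_cut_iff)

text \<open>Since \<open>h\<close> is the only edge of \<open>M\<close> in the cut, the contracted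
  vertex is covered exactly once.\<close>

lemma perfect_matching_contract:
  assumes G: "loopless_multigraph G" and X: "X \<noteq> {}" "X \<subseteq> verts G"
    and M: "perfect_matching G M" and cut: "M \<inter> edge_cut G X = {h}"
  shows "perfect_matching (contract G X) (M \<inter> edges (contract G X))"
  unfolding perfect_matching_def
proof (intro conjI ballI impI)
  let ?H = "contract G X"
  show "M \<inter> edges ?H \<subseteq> edges ?H" by simp
  have uniq: "e = f" if ef: "e \<in> M \<inter> edges ?H" "f \<in> M \<inter> edges ?H" "w \<in> ends ?H e" "w \<in> ends ?H f" for e f w
  proof -
    obtain u where u: "u \<in> ends G e" "w = shrink X u" using ef(3) by (auto simp: contract_simps)
    obtain v where v: "v \<in> ends G f" "w = shrink X v" using ef(4) by (auto simp: contract_simps)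
    note uv = u(1) v(1) u(2) v(2)
    have o: "e \<in> edges G" "f \<in> edges G" "\<not> ends G e \<subseteq> X" "\<not> ends G f \<subseteq> X" using ef by (auto simp: contract_simps)
    show ?thesis
    proof (cases "w \<in> X")
      case True
      then have "u \<in> X" "v \<in> X" using uv(3,4) by (metis shrink_in_iff)+
      then have "e \<in> edge_cut G X" "f \<in> edge_cut G X"
        using edge_cut_meets[OF G o(1) _ o(3)] edge_cut_meets[OF G o(2) _ o(4)] uv by auto
      then have "e \<in> {h}" "f \<in> {h}" using ef(1,2) unfolding cut[symmetric] by auto
      then show ?thesis by simp
    next
      case False
      then have "u = v" using uv by (metis shrink_in_iff shrink_outside)
      then show ?thesis using perfect_matching_unique[OF M _ _ uv(1)] uv(2) ef by auto
    qed
  qed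
  then show "e \<in> M \<inter> edges ?H \<Longrightarrow> f \<in> M \<inter> edges ?H \<Longrightarrow> e \<noteq> f \<Longrightarrow> ends ?H e \<inter> ends ?H f = {}" for e f
    by blast
  fix w assume w: "w \<in> verts ?H"
  show "\<exists>e\<in>M \<inter> edges ?H. w \<in> ends ?H e"
  proof (cases "w \<in> X")
    case True
    then have wx: "w = (SOME x. x \<in> X)" using w by (auto simp: contract_simps)
    have h: "h \<in> M" "h \<in> edges G" "h \<in> edge_cut G X" using cut by (auto simp: edge_cut_def)
    then have h': "ends G h \<inter> X \<noteq> {}" "\<not> ends G h \<subseteq> X" using in_edge_cut_iff[OF G h(2)] by auto
    then have "w \<in> ends ?H h" using wx contract_vertex_in_ends by metis
    moreover have "h \<in> M \<inter> edges ?H" using h h' by (simp add: contract_simps)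
    ultimately show ?thesis by blast
  next
    case False
    then have "w \<in> verts G" using w X by (auto simp: contract_simps some_in_eq)
    then obtain e where e: "e \<in> M" "w \<in> ends G e" "e \<in> edges G" by (rule perfect_matching_covers[OF M])
    have "w \<in> ends ?H e" using imageI[OF e(2), of "shrink X"] False by (simp add: contract_simps)
    moreover have "e \<in> M \<inter> edges ?H" using e False by (auto simp: contract_simps)
    ultimately show ?thesis by blast
  qed
qed

text \<open>At the contracted vertex \<open>N\<close> uses only \<open>h\<close>, so what remains
  uncovered is \<open>X\<close> without the end of \<open>h\<close>, and this is what the edges of
  \<open>M\<close> inside \<open>X\<close> cover.\<close>

lemma perfect_matching_uncontract:
  assumes G: "loopless_multigraph G" and X: "X \<noteq> {}" "X \<subseteq> verts G"
    and N: "perfect_matching (contract G X) N"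
    and M: "perfect_matching G M" and cut: "M \<inter> edge_cut G X = {h}" and hN: "h \<in> N"
  shows "perfect_matching G (N \<union> {e \<in> M. ends G e \<subseteq> X})"
  unfolding perfect_matching_def
proof (intro conjI ballI impI)
  let ?H = "contract G X" and ?M = "N \<union> {e \<in> M. ends G e \<subseteq> X}"
  have NH: "N \<subseteq> edges ?H" by (rule perfect_matching_subset[OF N])
  then have NE: "e \<in> edges G" "\<not> ends G e \<subseteq> X" if "e \<in> N" for e using that by (auto simp: contract_simps)
  then show "?M \<subseteq> edges G" using perfect_matching_subset[OF M] by auto
  have hE: "h \<in> edges G" "h \<in> M" using cut by (auto simp: edge_cut_def)
  have h: "ends G h \<inter> X \<noteq> {}" "\<not> ends G h \<subseteq> X" using cut in_edge_cut_iff[OF G hE(1), of X] by auto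
  have Ncut: "e = h" if e: "e \<in> N" "ends G e \<inter> X \<noteq> {}" for e
  proof -
    have "(SOME x. x \<in> X) \<in> ends ?H e" "(SOME x. x \<in> X) \<in> ends ?H h"
      using e(2) h(1) by (auto intro: contract_vertex_in_ends)
    then show ?thesis using perfect_matching_unique[OF N e(1) hN] by blast
  qed
  have uniq: "e = f" if ef: "e \<in> ?M" "f \<in> ?M" "v \<in> ends G e" "v \<in> ends G f" for e f v
  proof (cases "e \<in> N \<and> f \<in> N")
    case True
    have "shrink X v \<in> ends ?H e" "shrink X v \<in> ends ?H f"
      using ef(3,4) by (simp_all add: contract_simps)
    then show ?thesis using perfect_matching_unique[OF N] True by metis
  next
    case False
    then have "v \<in> X" using ef by auto
    then have "e \<in> M" "f \<in> M" using Ncut[of e] Ncut[of f] ef hE(2) by auto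
    then show ?thesis by (rule perfect_matching_unique[OF M _ _ ef(3,4)])
  qed
  then show "e \<in> ?M \<Longrightarrow> f \<in> ?M \<Longrightarrow> e \<noteq> f \<Longrightarrow> ends G e \<inter> ends G f = {}" for e f
    by blast
  fix v assume v: "v \<in> verts G"
  show "\<exists>e\<in>?M. v \<in> ends G e"
  proof (cases "v \<in> X")
    case True
    obtain e where e: "e \<in> M" "v \<in> ends G e" "e \<in> edges G" using perfect_matching_covers[OF M v] .
    show ?thesis
    proof (cases "ends G e \<subseteq> X")
      case False
      then have "e \<in> edge_cut G X" using edge_cut_meets[OF G e(3) _ False] e(2) True by auto
      then have "e \<in> M \<inter> edge_cut G X" using e(1) by simp
      then have "e = h" using cut by simp
      then show ?thesis using e(2) hN by auto
    next
      case True
      then show ?thesis using e by (intro bexI[of _ e]) auto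
    qed
  next
    case False
    then have "v \<in> verts ?H" using v by (auto simp: contract_simps)
    then obtain e where e: "e \<in> N" "v \<in> ends ?H e" using perfect_matching_covers[OF N] by blast
    then obtain u where "u \<in> ends G e" "shrink X u = v" by (auto simp: contract_simps)
    then show ?thesis using e False by (auto simp: shrink_eq_outside)
  qed
qed

lemma matching_covered_contract:
  assumes mc: "matching_covered G" and tight: "tight_shore G X"
  shows "matching_covered (contract G X)"
  unfolding matching_covered_def
proof (intro conjI ballI)
  let ?H = "contract G X"
  note G = matching_coveredD(1)[OF mc]
  note X = tight_shoreD[OF tight]
  show H: "loopless_multigraph ?H" by (rule loopless_contract[OF G X(1,2)])
  show "connected_graph ?H"
  proof (rule connected_graphI[OF H])
    fix Y assume Y: "Y \<subseteq> verts ?H" "Y \<noteq> {}" "Y \<noteq> verts ?H"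
    obtain u where u: "u \<in> verts G" "shrink X u \<in> Y" using Y verts_contract[OF X(1,2)] by auto
    obtain v where v: "v \<in> verts G" "shrink X v \<notin> Y" using Y verts_contract[OF X(1,2)] by auto
    obtain e where e: "e \<in> edge_cut G {w. shrink X w \<in> Y}"
      by (rule matching_covered_crossing[OF mc u(1) v(1), of "{w. shrink X w \<in> Y}"]) (use u v in auto)
    then have eE: "e \<in> edges G" by (auto simp: edge_cut_def)
    obtain p q where pq: "p \<in> ends G e" "q \<in> ends G e" "shrink X p \<in> Y" "shrink X q \<notin> Y"
      using e by (auto simp: edge_cut_def)
    have "shrink X p = shrink X q" if "ends G e \<subseteq> X" using that pq shrink_inside by (metis subsetD)
    then have "\<not> ends G e \<subseteq> X" using pq(3,4) by auto
    then have eH: "e \<in> edges ?H" using eE by (simp add: contract_simps)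
    have "e \<in> edge_cut ?H Y"
      using pq by (intro edge_cut_meets[OF H eH]) (auto simp: contract_simps)
    then show "edge_cut ?H Y \<noteq> {}" by auto
  qed
  have fin: "finite (verts ?H)" using H by (simp add: loopless_multigraph_def)
  obtain v where v: "v \<in> verts G" "v \<notin> X" using X by auto
  have "(SOME x. x \<in> X) \<in> X" using X(1) by (simp add: some_in_eq)
  then have "v \<noteq> (SOME x. x \<in> X)" using v(2) by metis
  then have "card {v, SOME x. x \<in> X} = 2" by simp
  moreover have "card {v, SOME x. x \<in> X} \<le> card (verts ?H)"
    using v by (intro card_mono[OF fin]) (auto simp: contract_simps)
  ultimately show "2 \<le> card (verts ?H)" by simp
  fix e assume e: "e \<in> edges ?H"
  then have "e \<in> edges G" by (simp add: contract_simps)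
  then obtain M where M: "perfect_matching G M" "e \<in> M" using matching_covered_edge[OF mc] by blast
  obtain h where "M \<inter> edge_cut G X = {h}" using tight_shore_cut[OF tight M(1)] .
  then show "\<exists>M. perfect_matching ?H M \<and> e \<in> M"
    using perfect_matching_contract[OF G X(1,2) M(1)] M(2) e by blast
qed

text \<open>The edge \<open>h\<close> of \<open>N\<close> at the contracted vertex lies in some
  perfect matching of \<open>G\<close>. By tightness it is the only cut edge there, so the part
  inside \<open>X\<close> completes \<open>N\<close>.\<close>

lemma perfect_matching_contract_lift:
  assumes mc: "matching_covered G" and tight: "tight_shore G X" and N: "perfect_matching (contract G X) N"
  obtains M where "perfect_matching G M" "M \<inter> edges (contract G X) = N"
proof -
  let ?H = "contract G X"
  note G = matching_coveredD(1)[OF mc]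
  note X = tight_shoreD[OF tight]
  have NH: "N \<subseteq> edges ?H" by (rule perfect_matching_subset[OF N])
  have xX: "(SOME x. x \<in> X) \<in> X" using X(1) by (simp add: some_in_eq)
  have "(SOME x. x \<in> X) \<in> verts ?H" by (simp add: contract_simps)
  then obtain h where h: "h \<in> N" "(SOME x. x \<in> X) \<in> ends ?H h" using perfect_matching_covers[OF N] by blast
  then have hE: "h \<in> edges G" "\<not> ends G h \<subseteq> X" using NH by (auto simp: contract_simps)
  obtain u where u: "u \<in> ends G h" "shrink X u = (SOME x. x \<in> X)" using h(2) by (auto simp: contract_simps)
  have "u \<in> X" using u(2) xX shrink_in_iff[of X u] by simp
  then have hc: "h \<in> edge_cut G X" using u hE by (intro edge_cut_meets[OF G]) auto
  obtain M where M: "perfect_matching G M" "h \<in> M" using matching_covered_edge[OF mc hE(1)] .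
  obtain h' where h': "M \<inter> edge_cut G X = {h'}" using tight_shore_cut[OF tight M(1)] .
  then have "M \<inter> edge_cut G X = {h}" using hc M(2) by auto
  then have "perfect_matching G (N \<union> {e \<in> M. ends G e \<subseteq> X})"
    using perfect_matching_uncontract[OF G X(1,2) N M(1) _ h(1)] by blast
  moreover have "(N \<union> {e \<in> M. ends G e \<subseteq> X}) \<inter> edges ?H = N" using NH by (auto simp: contract_simps)
  ultimately show ?thesis using that by blast
qed

lemma equivalent_edges_contract:
  assumes mc: "matching_covered G" and tight: "tight_shore G X" and eq: "equivalent_edges G R"
  shows "equivalent_edges (contract G X) (R \<inter> edges (contract G X))"
  unfolding equivalent_edges_def
proof (intro conjI allI impI)
  fix N assume N: "perfect_matching (contract G X) N"
  obtain M where M: "perfect_matching G M" "M \<inter> edges (contract G X) = N"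
    using perfect_matching_contract_lift[OF mc tight N] .
  have "R \<subseteq> M \<or> R \<inter> M = {}" using eq M(1) by (auto simp: equivalent_edges_def)
  then show "R \<inter> edges (contract G X) \<subseteq> N \<or> R \<inter> edges (contract G X) \<inter> N = {}" using M(2) by blast
qed simp

text \<open>In the bipartite contraction all cut edges end in \<open>X\<close> at vertices coloured
  unlike the contracted vertex. Up to sign, \<open>c2\<close> therefore gives all these vertices the
  colour that \<open>c1\<close> gives to the vertex standing for \<open>X\<close>.\<close>

lemma merge_colouring:
  assumes G: "loopless_multigraph G" and X: "X \<noteq> {}" "X \<subseteq> verts G" "X \<noteq> verts G"
    and fl: "\<forall>e\<in>edges (contract G (verts G - X)). flips (contract G (verts G - X)) c2 e"
  obtains c where "\<forall>e\<in>edges (contract G X). flips (contract G X) c1 e \<longrightarrow> flips G c e"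
    "\<forall>e\<in>edges (contract G X). \<forall>b. (\<forall>v\<in>ends (contract G X) e. c1 v = b) \<longrightarrow> (\<forall>v\<in>ends G e. c v = b)"
    "\<forall>e\<in>edges G - edges (contract G X). flips G c e"
proof -
  let ?H = "contract G X" and ?Y = "verts G - X"
  let ?H' = "contract G ?Y"
  define x1 x2 where "x1 = (SOME x. x \<in> X)" and "x2 = (SOME x. x \<in> ?Y)"
  define c where "c v = (if v \<in> X then ((c2 v = c2 x2) \<noteq> c1 x1) else c1 v)" for v
  have key: "c v = c1 (shrink X v)" if e: "e \<in> edges ?H" "v \<in> ends G e" for e v
  proof (cases "v \<in> X")
    case False
    then show ?thesis by (simp add: c_def)
  next
    case True
    have eE: "e \<in> edges G" "\<not> ends G e \<subseteq> X" using e by (auto simp: contract_simps)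
    obtain w where w: "ends G e = {v, w}" "v \<noteq> w" "w \<in> verts G" using loopless_other_end[OF G eE(1) e(2)] .
    have wY: "w \<in> ?Y" using w eE(2) True by auto
    have "e \<in> edges ?H'" using eE(1) True w by (auto simp: contract_simps)
    then have "flips ?H' c2 e" using fl by blast
    moreover have "ends ?H' e = {v, x2}" using w True wY shrink_inside[OF wY] by (simp add: contract_simps x2_def)
    ultimately have "c2 v \<noteq> c2 x2" using flipsD by metis
    then show ?thesis using True shrink_inside[OF True] by (simp add: c_def x1_def)
  qed
  show ?thesis
  proof (rule that[of c]; intro ballI allI impI)
    fix e assume e: "e \<in> edges ?H" "flips ?H c1 e"
    have eE: "e \<in> edges G" using e by (auto simp: contract_simps)
    obtain p q where pq: "ends G e = {p, q}" using loopless_ends[OF G eE] .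
    have "ends ?H e = {shrink X p, shrink X q}" using pq by (simp add: contract_simps)
    then have "c1 (shrink X p) \<noteq> c1 (shrink X q)" by (rule flipsD[OF e(2)])
    then show "flips G c e" using key[OF e(1)] pq by (intro flipsI[OF pq]) auto
  next
    fix e b v assume e: "e \<in> edges ?H" "\<forall>v\<in>ends ?H e. c1 v = b" "v \<in> ends G e"
    then show "c v = b" using key[OF e(1,3)] by (auto simp: contract_simps)
  next
    fix e assume "e \<in> edges G - edges ?H"
    then have e: "e \<in> edges G" "ends G e \<subseteq> X" by (auto simp: contract_simps)
    obtain p q where pq: "ends G e = {p, q}" using loopless_ends[OF G e(1)] .
    have pX: "p \<in> X" "q \<in> X" using pq e(2) by auto
    have "e \<in> edges ?H'" using e pq pX by (auto simp: contract_simps)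
    then have "flips ?H' c2 e" using fl by blast
    moreover have "ends ?H' e = {p, q}" using pq pX by (simp add: contract_simps)
    ultimately have "c2 p \<noteq> c2 q" using flipsD by metis
    then show "flips G c e" using pX by (intro flipsI[OF pq]) (auto simp: c_def)
  qed
qed

section \<open>Near-bricks\<close>

lemma delete_edges_Int: "delete_edges G (R \<inter> edges G) = delete_edges G R"
  by (simp add: delete_edges_def Diff_Int)

lemma bipartite_merge:
  assumes mc: "matching_covered G" and tight: "tight_shore G X"
    and H: "bipartite_graph (contract G X)" and H': "bipartite_graph (contract G (verts G - X))"
  shows "bipartite_graph G"
proof -
  note G = matching_coveredD(1)[OF mc]
  note X = tight_shoreD[OF tight]
  obtain c1 where c1: "\<forall>e\<in>edges (contract G X). flips (contract G X) c1 e"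
    using H bipartite_graph_iff[OF loopless_contract[OF G X(1,2)]] by blast
  have "loopless_multigraph (contract G (verts G - X))" using X by (intro loopless_contract[OF G]) auto
  then obtain c2 where c2: "\<forall>e\<in>edges (contract G (verts G - X)). flips (contract G (verts G - X)) c2 e"
    using H' bipartite_graph_iff by blast
  obtain c where "\<forall>e\<in>edges (contract G X). flips (contract G X) c1 e \<longrightarrow> flips G c e"
    "\<forall>e\<in>edges G - edges (contract G X). flips G c e"
    using merge_colouring[OF G X c2] .
  then have "\<forall>e\<in>edges G. flips G c e" using c1 by blast
  then show ?thesis using bipartite_graph_iff[OF G] by blast
qed

text \<open>The bipartite contraction contains at most one edge of \<open>R\<close>. An edge of
  \<open>R\<close> inside \<open>X\<close> would then have a partner wholly outside
  \<open>X\<close>, and an exchange across the tight cut separates the two. So \<open>R\<close>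
  survives in the other contraction, whose colouring extends.\<close>

lemma doublet_property_merge:
  assumes mc: "matching_covered G" and tight: "tight_shore G X"
    and H: "doublet_property (contract G X)" and H': "bipartite_graph (contract G (verts G - X))"
  shows "doublet_property G"
  unfolding doublet_property_def
proof (intro allI impI, elim conjE)
  fix R assume eq: "equivalent_edges G R" and del: "matching_covered (delete_edges G R)" and cR: "2 \<le> card R"
  let ?H = "contract G X" and ?H' = "contract G (verts G - X)"
  note G = matching_coveredD(1)[OF mc]
  note X = tight_shoreD[OF tight]
  have tight': "tight_shore G (verts G - X)" by (rule tight_shore_Compl[OF G tight])
  have RE: "R \<subseteq> edges G" using eq by (simp add: equivalent_edges_def)
  have mc': "matching_covered ?H'" by (rule matching_covered_contract[OF mc tight'])
  obtain c2 where c2: "\<forall>e\<in>edges ?H'. flips ?H' c2 e"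
    using H' bipartite_graph_iff[OF matching_coveredD(1)[OF mc']] by blast
  have delH: "matching_covered (delete_edges ?H R)"
    using matching_covered_contract[OF del tight_shore_delete_edges[OF tight]] by (simp add: contract_delete_edges)
  have delH': "matching_covered (delete_edges ?H' R)"
    using matching_covered_contract[OF del tight_shore_delete_edges[OF tight']] by (simp add: contract_delete_edges)
  have one: "e = f" if "e \<in> R" "e \<in> edges ?H'" "f \<in> R" "f \<in> edges ?H'" for e f
    using bipartite_no_equivalent_pair[OF mc' _ equivalent_edges_contract[OF mc tight' eq], of c2 e f]
      c2 delH' that by (simp add: delete_edges_Int)
  have "R \<subseteq> edges ?H"
  proof
    fix g assume g: "g \<in> R"
    show "g \<in> edges ?H"
    proof (rule ccontr)
      assume "g \<notin> edges ?H"
      then have gX: "ends G g \<subseteq> X" and gE: "g \<in> edges G" using g RE by (auto simp: contract_simps)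
      have gne: "ends G g \<noteq> {}" by (rule ends_nonempty[OF G gE])
      then have gH': "g \<in> edges ?H'" using gX gE by (auto simp: contract_simps)
      have "R \<noteq> {g}" using cR by auto
      then obtain g' where g': "g' \<in> R" "g' \<noteq> g" using g by blast
      then have "g' \<notin> edges ?H'" using one g gH' by blast
      then have g'Y: "ends G g' \<inter> X = {}" using g' RE by (auto simp: contract_simps)
      \<comment> \<open>\<open>M1\<close> uses \<open>g\<close>; \<open>M2\<close>, through the same
        cut edge \<open>h\<close>, avoids \<open>R\<close>. Their exchange contains \<open>g\<close>
        but not \<open>g'\<close>.\<close>
      obtain M1 where M1: "perfect_matching G M1" "g \<in> M1" using matching_covered_edge[OF mc gE] .
      obtain h where h: "M1 \<inter> edge_cut G X = {h}" using tight_shore_cut[OF tight M1(1)] .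
      have hc: "h \<in> edge_cut G X" "h \<in> edges G" using h by (auto simp: edge_cut_def)
      have hX: "ends G h \<inter> X \<noteq> {}" "\<not> ends G h \<subseteq> X" using in_edge_cut_iff[OF G hc(2)] hc by auto
      have "h \<notin> R"
      proof
        assume "h \<in> R"
        moreover have "h \<in> edges ?H'" using hX hc by (auto simp: contract_simps)
        ultimately have "h = g" using one g gH' by blast
        then show False using gX hX by auto
      qed
      obtain M2 where M2: "perfect_matching G M2" "h \<in> M2" "M2 \<inter> R = {}"
        using matching_covered_delete_edge[OF del hc(2) \<open>h \<notin> R\<close>] .
      obtain h2 where "M2 \<inter> edge_cut G X = {h2}" using tight_shore_cut[OF tight M2(1)] .
      then have agree: "M1 \<inter> edge_cut G X = M2 \<inter> edge_cut G X" using h M2(2) hc by auto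
      let ?M = "splice G X M1 M2"
      have pm: "perfect_matching G ?M" by (rule splice_perfect_matching[OF G M1(1) M2(1) agree])
      have "g \<in> ?M" using splice_meets[of G g X M1 M2] gX gne M1(2) by (simp add: Int_absorb2)
      then have "g' \<in> ?M" using equivalent_edgesD[OF eq pm g] g'(1) by auto
      then show False using splice_avoids[OF g'Y] M2(3) g'(1) by blast
    qed
  qed
  then have RH: "R \<inter> edges ?H = R" by auto
  then have "equivalent_edges ?H R" using equivalent_edges_contract[OF mc tight eq] by simp
  then obtain c1 where c1: "doublet ?H R c1" using H delH cR by (auto simp: doublet_property_def)
  obtain c where c: "\<forall>e\<in>edges ?H. flips ?H c1 e \<longrightarrow> flips G c e"
    "\<forall>e\<in>edges ?H. \<forall>b. (\<forall>v\<in>ends ?H e. c1 v = b) \<longrightarrow> (\<forall>v\<in>ends G e. c v = b)"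
    "\<forall>e\<in>edges G - edges ?H. flips G c e"
    using merge_colouring[OF G X c2] .
  obtain a b where ab: "R = {a, b}" "a \<noteq> b" "\<forall>x\<in>ends ?H a. c1 x" "\<forall>x\<in>ends ?H b. \<not> c1 x"
    and fl: "\<forall>e\<in>edges ?H - R. flips ?H c1 e"
    using c1 by (auto simp: doublet_def)
  have "\<forall>e\<in>edges G - R. flips G c e" using c(1,3) fl by blast
  moreover have "a \<in> edges ?H" "b \<in> edges ?H" using \<open>R \<subseteq> edges ?H\<close> ab by auto
  then have "\<forall>v\<in>ends G a. c v" "\<forall>v\<in>ends G b. \<not> c v"
    using c(2) ab(3,4) by metis+
  ultimately have "doublet G R c" using eq del ab(1,2) unfolding doublet_def by blast
  then show "\<exists>c. doublet G R c" by blast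
qed

text \<open>A single brick lies on one side of every tight cut used. The other side has none, and
  the first claim, that it is bipartite, is what merging needs.\<close>

lemma decomposition_few_bricks:
  assumes "tight_cut_decomposition G D" "matching_covered G"
  shows "(size (filter_mset brick D) = 0 \<longrightarrow> bipartite_graph G) \<and>
    (size (filter_mset brick D) = 1 \<longrightarrow> doublet_property G)"
  using assms
proof (induction rule: tight_cut_decomposition.induct)
  case (indecomposable G)
  then show ?case using brick_doublet_property[of G] by (auto simp: brick_def)
next
  case (split G X D1 D2)
  note G = matching_coveredD(1)[OF split.prems]
  have tight: "tight_shore G X" using split.hyps by (simp add: nontrivial_tight_shore_def)
  have tight': "tight_shore G (verts G - X)" by (rule tight_shore_Compl[OF G tight])
  have X: "verts G - (verts G - X) = X" using tight_shoreD[OF tight] by auto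
  note IH = split.IH(1)[OF matching_covered_contract[OF split.prems tight]]
    split.IH(2)[OF matching_covered_contract[OF split.prems tight']]
  show ?case
  proof (intro conjI impI)
    assume "size (filter_mset brick (D1 + D2)) = 0"
    then show "bipartite_graph G" using IH bipartite_merge[OF split.prems tight] by auto
  next
    assume "size (filter_mset brick (D1 + D2)) = 1"
    then have "size (filter_mset brick D1) + size (filter_mset brick D2) = 1" by simp
    then consider "size (filter_mset brick D1) = 1" "size (filter_mset brick D2) = 0"
      | "size (filter_mset brick D1) = 0" "size (filter_mset brick D2) = 1" by linarith
    then show "doublet_property G"
    proof cases
      case 1
      then show ?thesis using IH doublet_property_merge[OF split.prems tight] by blast
    next
      case 2
      then show ?thesis using IH doublet_property_merge[OF split.prems tight'] X by metis
    qed
  qed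
qed

lemma card_verts_contract:
  assumes G: "loopless_multigraph G" and "X \<subseteq> verts G" "X \<noteq> {}" "card X \<noteq> 1"
  shows "card (verts (contract G X)) < card (verts G)"
proof -
  have fin: "finite (verts G)" "finite X" using G assms by (auto simp: loopless_multigraph_def intro: finite_subset)
  then have "card X \<noteq> 0" using assms by simp
  then have "2 \<le> card X" using assms(4) by linarith
  moreover have "card X \<le> card (verts G)" using fin assms by (intro card_mono)
  moreover have "card (verts G - X) = card (verts G) - card X" using fin assms by (intro card_Diff_subset)
  moreover have "card (verts (contract G X)) \<le> Suc (card (verts G - X))"
    unfolding contract_simps by (rule card_insert_le_m1) auto
  ultimately show ?thesis by linarith
qed

text \<open>\<open>num_bricks\<close> reads off a decomposition chosen by \<open>SOME\<close>, so
  one must exist; contracting a nontrivial shore lowers the number of vertices.\<close>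

lemma tight_cut_decomposition_exists:
  "matching_covered G \<Longrightarrow> \<exists>D. tight_cut_decomposition G D"
proof (induction "card (verts G)" arbitrary: G rule: less_induct)
  case less
  note G = matching_coveredD(1)[OF less.prems]
  show ?case
  proof (cases "\<exists>X. nontrivial_tight_shore G X")
    case False
    then show ?thesis using tight_cut_decomposition.indecomposable by blast
  next
    case True
    then obtain X where X: "nontrivial_tight_shore G X" by blast
    then have tight: "tight_shore G X" and c: "card X \<noteq> 1" "card (verts G - X) \<noteq> 1"
      by (auto simp: nontrivial_tight_shore_def)
    note tight' = tight_shore_Compl[OF G tight]
    have "card (verts (contract G X)) < card (verts G)" "card (verts (contract G (verts G - X))) < card (verts G)"
      using card_verts_contract[OF G] tight_shoreD[OF tight] tight_shoreD[OF tight'] c by auto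
    then obtain D1 D2 where "tight_cut_decomposition (contract G X) D1"
      "tight_cut_decomposition (contract G (verts G - X)) D2"
      using less.hyps matching_covered_contract[OF less.prems] tight tight' by metis
    then show ?thesis using tight_cut_decomposition.split[OF X] by blast
  qed
qed

lemma near_brick_doublet_property:
  assumes "near_brick G"
  shows "doublet_property G" 
proof -
  have mc: "matching_covered G" and n: "num_bricks G = 1" using assms by (auto simp: near_brick_def)
  have "tight_cut_decomposition G (SOME D. tight_cut_decomposition G D)"
    using tight_cut_decomposition_exists[OF mc] by (rule someI_ex)
  then show ?thesis using decomposition_few_bricks[OF _ mc] n by (auto simp: num_bricks_def)
qed

section \<open>Removable classes at a vertex\<close>

lemma vertex_degree_le:
  assumes "loopless_multigraph G" "vertex_degree G v \<le> n" "F \<subseteq> {e \<in> edges G. v \<in> ends G e}" "card F = n"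
  shows "{e \<in> edges G. v \<in> ends G e} = F"
proof -
  have fin: "finite {e \<in> edges G. v \<in> ends G e}" using assms(1) by (simp add: loopless_multigraph_def)
  then have "card {e \<in> edges G. v \<in> ends G e} \<le> card F" using assms(2,4) by (simp add: vertex_degree_def)
  then show ?thesis using card_seteq[OF fin assms(3)] by simp
qed

text \<open>A perfect matching through \<open>h\<close> must cover \<open>w\<close> by an edge
  \<open>g\<close> other than \<open>e\<close> and disjoint from \<open>h\<close>. Then
  \<open>h\<close>, \<open>e\<close>, \<open>g\<close> form a path with inner vertices
  \<open>u\<close> and \<open>w\<close>.\<close>

lemma single_ear_of_length_three:
  assumes mc: "matching_covered G" and e: "e \<in> edges G" "ends G e = {u, w}" "u \<noteq> w"
    and h: "h \<in> edge_cut G {u, w}" "u \<in> ends G h"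
    and deg: "vertex_degree G u \<le> 2" "vertex_degree G w \<le> 2"
  shows "\<not> irreducible_graph G"
proof -
  note G = matching_coveredD(1)[OF mc]
  have hE: "h \<in> edges G" using h by (auto simp: edge_cut_def)
  obtain u' where u': "ends G h = {u, u'}" "u \<noteq> u'" "u \<in> verts G" "u' \<in> verts G"
    using loopless_other_end[OF G hE h(2)] .
  have wu': "u' \<noteq> w" using in_edge_cut_iff[OF G hE] h(1) u' by auto
  have wV: "w \<in> verts G" using e G by (auto simp: loopless_multigraph_def)
  obtain M where M: "perfect_matching G M" "h \<in> M" using matching_covered_edge[OF mc hE] .
  obtain g where g: "g \<in> M" "w \<in> ends G g" "g \<in> edges G" using perfect_matching_covers[OF M(1) wV] .
  obtain w' where w': "ends G g = {w, w'}" "w \<noteq> w'" "w' \<in> verts G" using loopless_other_end[OF G g(3,2)] .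
  have hw: "h \<noteq> g" using u' w' wu' \<open>u \<noteq> w\<close> by auto
  then have disj: "ends G h \<inter> ends G g = {}" using perfect_matching_unique[OF M(1) M(2) g(1)] by blast
  then have ne: "u' \<noteq> w'" "u \<noteq> w'" using u' w' by auto
  have eh: "e \<noteq> h" using e u' wu' by auto
  have eg: "e \<noteq> g" using e w' ne \<open>u \<noteq> w\<close> by auto
  have "{f \<in> edges G. u \<in> ends G f} = {e, h}"
    using deg(1) e h hE eh by (intro vertex_degree_le[OF G deg(1)]) auto
  moreover have "{f \<in> edges G. w \<in> ends G f} = {e, g}"
    using deg(2) e g eg by (intro vertex_degree_le[OF G deg(2)]) auto
  ultimately have d2: "vertex_degree G u = 2" "vertex_degree G w = 2"
    using eh eg by (simp_all add: vertex_degree_def)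
  have ends: "ends G h = {u', u}" "ends G e = {u, w}" "ends G g = {w, w'}" using u' e w' by auto
  have "graph_path G [u', u, w, w'] [h, e, g]"
    unfolding graph_path_def using ends u' w' wu' ne e g hE wV
    by (auto simp: less_Suc_eq numeral_3_eq_3)
  moreover have "\<forall>i. 0 < i \<and> i < 3 \<longrightarrow> vertex_degree G ([u', u, w, w'] ! i) = 2"
    using d2 by (auto simp: less_Suc_eq numeral_3_eq_3)
  ultimately have "single_ear G [u', u, w, w'] [h, e, g]"
    by (simp add: single_ear_def numeral_3_eq_3)
  then show ?thesis unfolding irreducible_graph_def by (auto intro!: exI[of _ "[u', u, w, w']"] exI[of _ "[h, e, g]"])
qed

text \<open>Irreducibility enters the proof here. The vertex \<open>v\<close> guarantees that some
  edge leaves the pair \<open>u\<close>, \<open>w\<close>.\<close>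

lemma adjacent_degree_three:
  assumes mc: "matching_covered G" and irr: "irreducible_graph G"
    and v: "v \<in> verts G" "3 \<le> vertex_degree G v"
    and e: "e \<in> edges G" "ends G e = {u, w}" "u \<noteq> w"
  shows "3 \<le> vertex_degree G u \<or> 3 \<le> vertex_degree G w"
proof (rule ccontr)
  assume n: "\<not> ?thesis"
  note G = matching_coveredD(1)[OF mc]
  have uV: "u \<in> verts G" using e G by (auto simp: loopless_multigraph_def)
  have "v \<notin> {u, w}" using v n by auto
  then obtain h where h: "h \<in> edge_cut G {u, w}"
    using matching_covered_crossing[OF mc uV v(1), of "{u, w}"] by auto
  then have "u \<in> ends G h \<or> w \<in> ends G h" by (auto simp: edge_cut_def)
  then show False
  proof
    assume "u \<in> ends G h"
    then show False using single_ear_of_length_three[OF mc e h] n irr by simp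
  next
    assume "w \<in> ends G h"
    moreover have "ends G e = {w, u}" "h \<in> edge_cut G {w, u}" using e h by (auto simp: insert_commute)
    ultimately show False using single_ear_of_length_three[OF mc e(1), of w u h] e(3) n irr by simp
  qed
qed

section \<open>Components of unions of perfect matchings\<close>

definition edge_closed :: "('v, 'e) mgraph \<Rightarrow> 'e set \<Rightarrow> 'v set \<Rightarrow> bool" where
  "edge_closed G T W \<longleftrightarrow> (\<forall>e\<in>T. ends G e \<inter> W \<noteq> {} \<longrightarrow> ends G e \<subseteq> W)"

definition component :: "('v, 'e) mgraph \<Rightarrow> 'e set \<Rightarrow> 'v \<Rightarrow> 'v set" where
  "component G T v = \<Inter>{W. v \<in> W \<and> edge_closed G T W}"

lemma edge_closedD: "edge_closed G T W \<Longrightarrow> e \<in> T \<Longrightarrow> x \<in> ends G e \<Longrightarrow> x \<in> W \<Longrightarrow> ends G e \<subseteq> W"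
  unfolding edge_closed_def by blast

lemma component_self: "v \<in> component G T v"
  by (simp add: component_def)

lemma component_least: "v \<in> W \<Longrightarrow> edge_closed G T W \<Longrightarrow> component G T v \<subseteq> W"
  by (auto simp: component_def)

lemma component_closed: "edge_closed G T (component G T v)"
  unfolding edge_closed_def
proof (intro ballI impI)
  fix e assume e: "e \<in> T" "ends G e \<inter> component G T v \<noteq> {}"
  then obtain x where x: "x \<in> ends G e" "x \<in> component G T v" by auto
  show "ends G e \<subseteq> component G T v"
  proof
    fix y assume y: "y \<in> ends G e"
    show "y \<in> component G T v"
      unfolding component_def
    proof (intro InterI, clarify)
      fix W assume W: "v \<in> W" "edge_closed G T W"
      then have "x \<in> W" using component_least[OF W] x by auto
      then show "y \<in> W" using edge_closedD[OF W(2) e(1) x(1)] y by auto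
    qed
  qed
qed

lemma component_mono: "T \<subseteq> T' \<Longrightarrow> component G T v \<subseteq> component G T' v"
  using component_closed[of G T' v] by (intro component_least component_self) (auto simp: edge_closed_def)

lemma component_verts:
  "loopless_multigraph G \<Longrightarrow> T \<subseteq> edges G \<Longrightarrow> v \<in> verts G \<Longrightarrow> component G T v \<subseteq> verts G"
  by (intro component_least) (auto simp: edge_closed_def loopless_multigraph_def)

text \<open>Only edges that meet a component matter for it, so edges elsewhere may be discarded from
  \<open>T\<close> without shrinking it.\<close>

lemma component_local:
  assumes "\<And>e. e \<in> T \<Longrightarrow> ends G e \<inter> component G T v \<noteq> {} \<Longrightarrow> e \<in> T'"
  shows "component G T v \<subseteq> component G T' v"
proof -
  let ?W = "component G T v" and ?W' = "component G T' v"
  have "edge_closed G T (?W \<inter> ?W')"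
    unfolding edge_closed_def
  proof (intro ballI impI)
    fix e assume e: "e \<in> T" "ends G e \<inter> (?W \<inter> ?W') \<noteq> {}"
    then obtain x where x: "x \<in> ends G e" "x \<in> ?W" "x \<in> ?W'" by auto
    then have "e \<in> T'" using assms e by blast
    then show "ends G e \<subseteq> ?W \<inter> ?W'"
      using edge_closedD[OF component_closed e(1) x(1,2)] edge_closedD[OF component_closed _ x(1,3)] by auto
  qed
  then have "?W \<subseteq> ?W \<inter> ?W'" by (intro component_least) (simp_all add: component_self)
  then show ?thesis by blast
qed

text \<open>Equivalently, \<open>T\<close> is a union of perfect matchings.\<close>

definition matching_closed :: "('v, 'e) mgraph \<Rightarrow> 'e set \<Rightarrow> bool" where
  "matching_closed G T \<longleftrightarrow> (\<forall>e\<in>T. \<exists>M. perfect_matching G M \<and> e \<in> M \<and> M \<subseteq> T)"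

lemma matching_closed_Un:
  "matching_closed G T \<Longrightarrow> perfect_matching G M \<Longrightarrow> matching_closed G (T \<union> M)"
  unfolding matching_closed_def by (metis Un_iff Un_upper2 le_supI1)

lemma matching_closed_edges: "matching_closed G T \<Longrightarrow> T \<subseteq> edges G"
  unfolding matching_closed_def using perfect_matching_subset by blast

lemma edge_closed_no_cut: "loopless_multigraph G \<Longrightarrow> edge_closed G T W \<Longrightarrow> M \<subseteq> T \<Longrightarrow> M \<inter> edge_cut G W = {}"
  by (auto simp: edge_closed_def edge_cut_def)

section \<open>Cores and the classes outside them\<close>

definition avoiding :: "('v, 'e) mgraph \<Rightarrow> 'e \<Rightarrow> 'e set" where
  "avoiding G e = \<Union>{M. perfect_matching G M \<and> e \<notin> M}"

definition core_verts :: "('v, 'e) mgraph \<Rightarrow> 'v \<Rightarrow> 'e \<Rightarrow> 'v set" where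
  "core_verts G v e = component G (avoiding G e) v"

text \<open>Of the matchings avoiding \<open>e\<close> only the part in the component of
  \<open>v\<close> is fixed. Edges elsewhere may be dropped, which the enlargement to a connected
  union requires.\<close>

definition core :: "('v, 'e) mgraph \<Rightarrow> 'v \<Rightarrow> 'e \<Rightarrow> 'e set" where
  "core G v e = {f \<in> avoiding G e. ends G f \<inter> core_verts G v e \<noteq> {}}"

lemma matching_closed_avoiding: "matching_closed G (avoiding G e)"
  unfolding matching_closed_def avoiding_def by auto

lemma core_inside: "f \<in> core G v e \<Longrightarrow> ends G f \<subseteq> core_verts G v e"
  using component_closed[of G "avoiding G e" v] by (auto simp: core_def core_verts_def edge_closed_def)

lemma avoiding_inside:
  "f \<in> avoiding G e \<Longrightarrow> ends G f \<inter> core_verts G v e \<noteq> {} \<Longrightarrow> ends G f \<subseteq> core_verts G v e"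
  using component_closed[of G "avoiding G e" v] by (auto simp: core_verts_def edge_closed_def)

lemma avoidingI: "perfect_matching G M \<Longrightarrow> e \<notin> M \<Longrightarrow> f \<in> M \<Longrightarrow> f \<in> avoiding G e"
  by (auto simp: avoiding_def)

lemma avoiding_no_cut:
  assumes "loopless_multigraph G" "perfect_matching G M" "e \<notin> M"
  shows "M \<inter> edge_cut G (core_verts G v e) = {}"
proof -
  have "M \<subseteq> avoiding G e" using avoidingI[OF assms(2,3)] by (rule subsetI)
  then show ?thesis unfolding core_verts_def by (rule edge_closed_no_cut[OF assms(1) component_closed])
qed

text \<open>
  Otherwise keep all of \<open>T\<close> inside the component, only one perfect matching \<open>M0\<close> outside, and add a
  perfect matching \<open>M\<close> that leaves the component. The result must be the whole edge set, so that two
  adjacent vertices outside the component have degree at most two.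
\<close>

lemma closed_set_maximal_component:
  assumes mc: "matching_covered G" and irr: "irreducible_graph G"
    and v: "v \<in> verts G" "3 \<le> vertex_degree G v"
    and T: "matching_closed G T" "T \<noteq> edges G" "T \<noteq> {}" "C \<subseteq> T"
    and max: "\<And>T'. matching_closed G T' \<Longrightarrow> T' \<noteq> edges G \<Longrightarrow> C \<subseteq> T' \<Longrightarrow> card (component G T' v) \<le> card (component G T v)"
    and C: "\<And>e. e \<in> C \<Longrightarrow> ends G e \<inter> component G T v \<noteq> {}"
  shows "component G T v = verts G"
proof (rule ccontr)
  let ?W = "component G T v"
  note G = matching_coveredD(1)[OF mc]
  have fV: "finite (verts G)" using G by (simp add: loopless_multigraph_def)
  have TE: "T \<subseteq> edges G" by (rule matching_closed_edges[OF T(1)])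
  have WV: "?W \<subseteq> verts G" by (rule component_verts[OF G TE v(1)])
  assume "?W \<noteq> verts G"
  then obtain z where z: "z \<in> verts G" "z \<notin> ?W" using WV by blast
  obtain h where h: "h \<in> edge_cut G ?W"
    using matching_covered_crossing[OF mc v(1) z(1) component_self z(2)] .
  have hE: "h \<in> edges G" using h by (auto simp: edge_cut_def)
  have hW: "ends G h \<inter> ?W \<noteq> {}" "\<not> ends G h \<subseteq> ?W" using in_edge_cut_iff[OF G hE] h by auto
  obtain M where M: "perfect_matching G M" "h \<in> M" using matching_covered_edge[OF mc hE] .
  obtain M0 where M0: "perfect_matching G M0" "M0 \<subseteq> T" using T(1,3) unfolding matching_closed_def by blast
  define T' where "T' = {e \<in> T. ends G e \<inter> ?W \<noteq> {}} \<union> {e \<in> M0. ends G e \<inter> ?W = {}}"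
  have T'T: "T' \<subseteq> T" using M0 by (auto simp: T'_def)
  have M0T': "M0 \<subseteq> T'" using M0 by (auto simp: T'_def)
  have closed: "matching_closed G T'"
    unfolding matching_closed_def
  proof
    fix e assume e: "e \<in> T'"
    show "\<exists>M. perfect_matching G M \<and> e \<in> M \<and> M \<subseteq> T'"
    proof (cases "ends G e \<inter> ?W = {}")
      case True
      then show ?thesis using e M0(1) M0T' by (auto simp: T'_def)
    next
      case False
      obtain N where N: "perfect_matching G N" "e \<in> N" "N \<subseteq> T"
        using T(1) e T'T unfolding matching_closed_def by blast
      have "N \<inter> edge_cut G ?W = M0 \<inter> edge_cut G ?W"
        using edge_closed_no_cut[OF G component_closed N(3)] edge_closed_no_cut[OF G component_closed M0(2)] by blast
      then have "perfect_matching G (splice G ?W N M0)" by (rule splice_perfect_matching[OF G N(1) M0(1)])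
      moreover have "e \<in> splice G ?W N M0" using splice_meets[OF False] N(2) by blast
      moreover have "splice G ?W N M0 \<subseteq> T'" using N(3) by (auto simp: splice_def T'_def)
      ultimately show ?thesis by blast
    qed
  qed
  have "?W \<subseteq> component G T' v" by (rule component_local) (auto simp: T'_def)
  then have big: "?W \<subseteq> component G (T' \<union> M) v" using component_mono[of T' "T' \<union> M" G v] by blast
  have closed'': "matching_closed G (T' \<union> M)" by (rule matching_closed_Un[OF closed M(1)])
  have "ends G h \<subseteq> component G (T' \<union> M) v"
    using component_closed[of G "T' \<union> M" v] big hW(1) M(2) unfolding edge_closed_def by blast
  then have "?W \<subset> component G (T' \<union> M) v" using big hW(2) by blast
  moreover have "finite (component G (T' \<union> M) v)"
    using component_verts[OF G matching_closed_edges[OF closed''] v(1)] fV by (rule finite_subset)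
  ultimately have lt: "card ?W < card (component G (T' \<union> M) v)" by (intro psubset_card_mono)
  have "C \<subseteq> T' \<union> M" using T(4) C by (auto simp: T'_def)
  then have all: "T' \<union> M = edges G" using max[OF closed''] lt by (meson leD)
  have low: "vertex_degree G y \<le> 2" if y: "y \<in> verts G" "y \<notin> ?W" for y
  proof -
    have sub: "{e \<in> edges G. y \<in> ends G e} \<subseteq> {e \<in> M0. y \<in> ends G e} \<union> {e \<in> M. y \<in> ends G e}"
    proof
      fix e assume e: "e \<in> {e \<in> edges G. y \<in> ends G e}"
      have "e \<in> M0" if "e \<notin> M"
      proof -
        have eT: "e \<in> T'" using e all that by blast
        have "ends G e \<inter> ?W = {}"
          using component_closed[of G T v] eT T'T e y(2) unfolding edge_closed_def by blast
        then show ?thesis using eT by (auto simp: T'_def)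
      qed
      then show "e \<in> {e \<in> M0. y \<in> ends G e} \<union> {e \<in> M. y \<in> ends G e}" using e by blast
    qed
    have one: "card {e \<in> N. y \<in> ends G e} \<le> 1" if N: "perfect_matching G N" for N
      using perfect_matching_unique[OF N] perfect_matching_finite[OF G N]
      by (subst One_nat_def, subst card_le_Suc0_iff_eq) auto
    have "vertex_degree G y \<le> card ({e \<in> M0. y \<in> ends G e} \<union> {e \<in> M. y \<in> ends G e})"
      unfolding vertex_degree_def
      using perfect_matching_finite[OF G M0(1)] perfect_matching_finite[OF G M(1)] by (intro card_mono[OF _ sub]) auto
    also have "\<dots> \<le> card {e \<in> M0. y \<in> ends G e} + card {e \<in> M. y \<in> ends G e}" by (rule card_Un_le)
    finally show ?thesis using one[OF M0(1)] one[OF M(1)] by linarith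
  qed
  obtain f where f: "f \<in> M0" "z \<in> ends G f" "f \<in> edges G" using perfect_matching_covers[OF M0(1) z(1)] .
  obtain y where y: "ends G f = {z, y}" "z \<noteq> y" "y \<in> verts G" using loopless_other_end[OF G f(3,2)] by blast
  have "y \<notin> ?W" using component_closed[of G T v] f(1) M0(2) z(2) y(1) unfolding edge_closed_def by blast
  then show False
    using adjacent_degree_three[OF mc irr v f(3) y(1,2)] low[OF z] low[OF y(3)] by linarith
qed

text \<open>Two maximizations among proper unions of perfect matchings containing the core: first
  the component of \<open>v\<close>, which becomes the whole vertex set, then the number of edges.
  Any perfect matching not inside the result \<open>S\<close> completes it to all edges, hence
  contains the whole complement of \<open>S\<close>.\<close>

lemma exists_removable_class:
  assumes mc: "matching_covered G" and irr: "irreducible_graph G"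
    and v: "v \<in> verts G" "3 \<le> vertex_degree G v" and e0: "e0 \<in> edges G" "v \<in> ends G e0"
  shows "\<exists>R. R \<noteq> {} \<and> equivalent_edges G R \<and> matching_covered (delete_edges G R) \<and> R \<inter> core G v e0 = {}"
proof -
  note G = matching_coveredD(1)[OF mc]
  have fV: "finite (verts G)" "finite (edges G)" using G by (auto simp: loopless_multigraph_def)
  let ?C = "core G v e0" and ?T0 = "avoiding G e0"
  have "\<not> {e \<in> edges G. v \<in> ends G e} \<subseteq> {e0}"
    using v(2) card_mono[of "{e0}" "{e \<in> edges G. v \<in> ends G e}"] by (auto simp: vertex_degree_def)
  \<comment> \<open>A second edge at \<open>v\<close> makes the core nonempty, as \<open>T\<close>
    must be later.\<close>
  then obtain e1 where e1: "e1 \<in> edges G" "v \<in> ends G e1" "e1 \<noteq> e0" by blast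
  obtain M1 where M1: "perfect_matching G M1" "e1 \<in> M1" using matching_covered_edge[OF mc e1(1)] .
  then have "e0 \<notin> M1" using perfect_matching_unique[OF M1(1), of e0 e1 v] e1 e0 by auto
  then have e1T: "e1 \<in> ?T0" using M1 by (intro avoidingI)
  then have e1C: "e1 \<in> ?C" using e1(2) by (auto simp: core_def core_verts_def intro: component_self)
  have CT: "?C \<subseteq> ?T0" by (auto simp: core_def)
  have "e0 \<notin> ?T0" by (auto simp: avoiding_def)
  define F where "F T \<longleftrightarrow> matching_closed G T \<and> T \<noteq> edges G \<and> ?C \<subseteq> T" for T
  have F0: "F ?T0" using \<open>e0 \<notin> ?T0\<close> e0 CT matching_closed_avoiding by (auto simp: F_def)
  have compV: "component G T v \<subseteq> verts G" if "F T" for T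
    using component_verts[OF G matching_closed_edges v(1)] that by (auto simp: F_def)
  have "card (component G T v) < Suc (card (verts G))" if "F T" for T
    using card_mono[OF fV(1) compV[OF that]] by simp
  then obtain T where T: "F T" "\<And>T'. F T' \<Longrightarrow> card (component G T' v) \<le> card (component G T v)"
    using ex_has_greatest_nat[of F ?T0 "\<lambda>T. card (component G T v)" "Suc (card (verts G))"] F0 by blast
  have "core_verts G v e0 \<subseteq> component G T v"
    unfolding core_verts_def using T(1)
    by (intro component_local) (auto simp: F_def core_def core_verts_def)
  then have C: "ends G e \<inter> component G T v \<noteq> {}" if "e \<in> ?C" for e
    using that by (auto simp: core_def)
  have "component G T v = verts G"
  proof (rule closed_set_maximal_component[OF mc irr v])
    show "matching_closed G T" "T \<noteq> edges G" "T \<noteq> {}" "?C \<subseteq> T" using T(1) e1C by (auto simp: F_def)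
    show "\<And>T'. matching_closed G T' \<Longrightarrow> T' \<noteq> edges G \<Longrightarrow> ?C \<subseteq> T' \<Longrightarrow> card (component G T' v) \<le> card (component G T v)"
      using T(2) by (auto simp: F_def)
  qed (rule C)
  then have "F T \<and> component G T v = verts G" using T by simp
  moreover have "card T < Suc (card (edges G))" if "F T \<and> component G T v = verts G" for T
    using card_mono[OF fV(2) matching_closed_edges, of T] that by (auto simp: F_def)
  \<comment> \<open>Second maximization, over the unions that are already connected and
    spanning.\<close>
  ultimately obtain S where S: "F S" "component G S v = verts G"
    "\<And>S'. F S' \<Longrightarrow> component G S' v = verts G \<Longrightarrow> card S' \<le> card S"
    using ex_has_greatest_nat[of "\<lambda>T. F T \<and> component G T v = verts G" T card "Suc (card (edges G))"] by blast
  have SE: "S \<subseteq> edges G" using matching_closed_edges S(1) by (auto simp: F_def)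
  let ?R = "edges G - S"
  have "?R \<noteq> {}" using SE S(1) by (auto simp: F_def)
  moreover have "equivalent_edges G ?R"
    unfolding equivalent_edges_def
  proof (intro conjI allI impI)
    fix M assume M: "perfect_matching G M"
    show "?R \<subseteq> M \<or> ?R \<inter> M = {}"
    proof (cases "M \<subseteq> S")
      case False
      have cl: "matching_closed G (S \<union> M)" using matching_closed_Un[OF _ M] S(1) by (auto simp: F_def)
      have fin: "finite (S \<union> M)" using matching_closed_edges[OF cl] fV(2) by (rule finite_subset)
      have "S \<union> M = edges G"
      proof (rule ccontr)
        assume "S \<union> M \<noteq> edges G"
        then have FS: "F (S \<union> M)" using cl S(1) by (auto simp: F_def)
        have "component G (S \<union> M) v = verts G"
          using compV[OF FS] component_mono[of S "S \<union> M" G v] S(2) by auto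
        then have "card (S \<union> M) \<le> card S" using S(3)[OF FS] by simp
        moreover have "card S < card (S \<union> M)" using False fin by (intro psubset_card_mono) auto
        ultimately show False by simp
      qed
      then show ?thesis by blast
    qed blast
  qed simp
  moreover have "matching_covered (delete_edges G ?R)"
    unfolding matching_covered_def
  proof (intro conjI ballI)
    show G': "loopless_multigraph (delete_edges G ?R)" by (rule loopless_delete_edges[OF G])
    show "2 \<le> card (verts (delete_edges G ?R))" using matching_coveredD(3)[OF mc] by simp
    show "\<exists>M. perfect_matching (delete_edges G ?R) M \<and> e \<in> M" if "e \<in> edges (delete_edges G ?R)" for e
    proof -
      have "e \<in> S" using that SE by auto
      then obtain M where "perfect_matching G M" "e \<in> M" "M \<subseteq> S" using S(1) unfolding F_def matching_closed_def by blast
      then show ?thesis unfolding perfect_matching_delete_edges by blast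
    qed
    show "connected_graph (delete_edges G ?R)"
    proof (rule connected_graphI[OF G'])
      fix X assume X: "X \<subseteq> verts (delete_edges G ?R)" "X \<noteq> {}" "X \<noteq> verts (delete_edges G ?R)"
      show "edge_cut (delete_edges G ?R) X \<noteq> {}"
      proof
        assume "edge_cut (delete_edges G ?R) X = {}"
        then have none: "e \<notin> edge_cut G X" if "e \<in> S" for e using that by auto
        have split: "ends G e \<subseteq> X \<or> ends G e \<subseteq> verts G - X" if e: "e \<in> S" for e
        proof -
          have "e \<in> edges G" using e SE by auto
          moreover have "ends G e \<subseteq> verts G" using calculation G by (auto simp: loopless_multigraph_def)
          ultimately show ?thesis using none[OF e] in_edge_cut_iff[OF G, of e X] by blast
        qed
        then have "edge_closed G S X" "edge_closed G S (verts G - X)" unfolding edge_closed_def by blast+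
        then have "verts G \<subseteq> X \<or> verts G \<subseteq> verts G - X"
          using component_least[of v X G S] component_least[of v "verts G - X" G S] S(2) v(1) by auto
        then show False using X by auto
      qed
    qed
  qed
  moreover have "?R \<inter> ?C = {}" using S(1) by (auto simp: F_def)
  ultimately show ?thesis by (intro exI[of _ ?R] conjI)
qed

text \<open>A matching through a third edge \<open>ek\<close> at \<open>v\<close> avoids both
  \<open>ei\<close> and \<open>ej\<close>. Used on the core vertices of \<open>ej\<close>, with
  \<open>M\<close> outside, it yields a perfect matching that contains \<open>g\<close> and avoids
  \<open>ei\<close>.\<close>

lemma splice_at_core:
  assumes mc: "matching_covered G" and v: "v \<in> verts G"
    and ek: "ek \<in> edges G" "v \<in> ends G ek" and ei: "v \<in> ends G ei" and ne: "ek \<noteq> ei" "ek \<noteq> ej"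
    and ej: "v \<in> ends G ej"
    and M: "perfect_matching G M" "ej \<notin> M" and g: "g \<in> M" "ends G g \<inter> core_verts G v ej = {}"
  shows "g \<in> avoiding G ei"
proof -
  note G = matching_coveredD(1)[OF mc]
  let ?W = "core_verts G v ej"
  obtain N where N: "perfect_matching G N" "ek \<in> N" using matching_covered_edge[OF mc ek(1)] .
  have "ej \<notin> N" using perfect_matching_unique[OF N(1) N(2) _ ek(2) ej] ne(2) by blast
  then have "N \<inter> edge_cut G ?W = M \<inter> edge_cut G ?W"
    using avoiding_no_cut[OF G N(1)] avoiding_no_cut[OF G M] by simp
  then have S: "perfect_matching G (splice G ?W N M)" by (rule splice_perfect_matching[OF G N(1) M(1)])
  have "v \<in> ?W" by (simp add: core_verts_def component_self)
  then have "ends G ek \<inter> ?W \<noteq> {}" using ek by auto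
  then have "ek \<in> splice G ?W N M" using N(2) by (simp add: splice_meets)
  then have "ei \<notin> splice G ?W N M" using perfect_matching_unique[OF S _ _ ek(2) ei] ne(1) by blast
  moreover have "g \<in> splice G ?W N M" using g by (simp add: splice_avoids)
  ultimately show ?thesis using avoidingI[OF S] by blast
qed

lemma avoiding_not_cut:
  assumes G: "loopless_multigraph G" and "g \<in> avoiding G e"
  shows "g \<notin> edge_cut G (core_verts G v e)"
  using assms avoiding_no_cut[OF G] unfolding avoiding_def by blast

text \<open>Every perfect matching misses \<open>ei\<close> or \<open>ej\<close>. An edge of it
  either meets the corresponding component, hence lies in that core, or is transferred by
  \<open>splice_at_core\<close> to the other index. As a consequence, edge sets avoiding the two
  cores are disjoint.\<close>

lemma cores_cover:
  assumes mc: "matching_covered G" and v: "v \<in> verts G"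
    and ek: "ek \<in> edges G" "v \<in> ends G ek" and ei: "v \<in> ends G ei" and ej: "v \<in> ends G ej"
    and ne: "ek \<noteq> ei" "ek \<noteq> ej" "ei \<noteq> ej"
  shows "edges G \<subseteq> core G v ei \<union> core G v ej"
proof -
  note G = matching_coveredD(1)[OF mc]
  let ?Wi = "core_verts G v ei" and ?Wj = "core_verts G v ej"
  note A = splice_at_core[OF mc v ek ei ne(1,2) ej]
  note B = splice_at_core[OF mc v ek ej ne(2,1) ei]
  have vW: "v \<in> ?Wi" "v \<in> ?Wj" by (simp_all add: core_verts_def component_self)
  have WV: "?Wi \<subseteq> verts G" "?Wj \<subseteq> verts G"
    unfolding core_verts_def
    by (auto intro!: component_verts[OF G matching_closed_edges[OF matching_closed_avoiding] v, THEN subsetD])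
  have both: "ei \<notin> M \<or> ej \<notin> M" if "perfect_matching G M" for M
    using perfect_matching_unique[OF that _ _ ei ej] ne(3) by blast
  \<comment> \<open>An edge leaving the union of both components would, by the same transfer, be
    disjoint from each of them.\<close>
  have V: "verts G \<subseteq> ?Wi \<union> ?Wj"
  proof (rule ccontr)
    assume "\<not> ?thesis"
    then obtain z where z: "z \<in> verts G" "z \<notin> ?Wi \<union> ?Wj" by auto
    obtain g where g: "g \<in> edge_cut G (?Wi \<union> ?Wj)"
      by (rule matching_covered_crossing[OF mc v z(1), of "?Wi \<union> ?Wj"]) (use vW z in auto)
    then have gE: "g \<in> edges G" by (auto simp: edge_cut_def)
    have g': "ends G g \<inter> (?Wi \<union> ?Wj) \<noteq> {}" "\<not> ends G g \<subseteq> ?Wi \<union> ?Wj"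
      using g in_edge_cut_iff[OF G gE] by auto
    obtain M where M: "perfect_matching G M" "g \<in> M" using matching_covered_edge[OF mc gE] .
    have "ends G g \<inter> ?Wi = {} \<and> ends G g \<inter> ?Wj = {}"
    proof (cases "ej \<in> M")
      case False
      then have "ends G g \<inter> ?Wj = {}" using avoiding_inside[OF avoidingI[OF M(1) _ M(2)]] g' by blast
      moreover have "g \<in> avoiding G ei" by (rule A[OF M(1) False M(2) calculation])
      then have "ends G g \<inter> ?Wi = {}" using avoiding_inside[of g G ei v] g'(2) by auto
      ultimately show ?thesis by simp
    next
      case True
      then have F: "ei \<notin> M" using both[OF M(1)] by blast
      then have "ends G g \<inter> ?Wi = {}" using avoiding_inside[OF avoidingI[OF M(1) _ M(2)]] g' by blast
      moreover have "g \<in> avoiding G ej" by (rule B[OF M(1) F M(2) calculation])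
      then have "ends G g \<inter> ?Wj = {}" using avoiding_inside[of g G ej v] g'(2) by auto
      ultimately show ?thesis by simp
    qed
    then show False using g' by blast
  qed
  show ?thesis
  proof
    fix g assume gE: "g \<in> edges G"
    obtain M where M: "perfect_matching G M" "g \<in> M" using matching_covered_edge[OF mc gE] .
    have gV: "ends G g \<subseteq> verts G" "ends G g \<noteq> {}" using gE G ends_nonempty[OF G gE] by (auto simp: loopless_multigraph_def)
    show "g \<in> core G v ei \<union> core G v ej"
    proof (cases "ej \<in> M")
      case False
      show ?thesis
      proof (cases "ends G g \<inter> ?Wj = {}")
        case True
        have "g \<in> avoiding G ei" by (rule A[OF M(1) False M(2) True])
        moreover have "ends G g \<inter> ?Wi \<noteq> {}" using True V gV by blast
        ultimately show ?thesis by (simp add: core_def)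
      next
        case F: False
        then show ?thesis using avoidingI[OF M(1) False M(2)] by (simp add: core_def)
      qed
    next
      case True
      then have N: "ei \<notin> M" using both[OF M(1)] by blast
      show ?thesis
      proof (cases "ends G g \<inter> ?Wi = {}")
        case True
        have "g \<in> avoiding G ej" by (rule B[OF M(1) N M(2) True])
        moreover have "ends G g \<inter> ?Wj \<noteq> {}" using True V gV by blast
        ultimately show ?thesis by (simp add: core_def)
      next
        case F: False
        then show ?thesis using avoidingI[OF M(1) N M(2)] by (simp add: core_def)
      qed
    qed
  qed
qed

lemma doubletD:
  assumes "doublet G R c"
  shows "equivalent_edges G R" "matching_covered (delete_edges G R)" "R \<subseteq> edges G"
    "\<And>e x y. e \<in> edges G \<Longrightarrow> e \<notin> R \<Longrightarrow> ends G e = {x, y} \<Longrightarrow> c x \<noteq> c y"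
    "\<And>e x y. e \<in> R \<Longrightarrow> x \<in> ends G e \<Longrightarrow> y \<in> ends G e \<Longrightarrow> c x = c y"
proof -
  show "equivalent_edges G R" "matching_covered (delete_edges G R)"
    using assms by (auto simp: doublet_def)
  then show "R \<subseteq> edges G" by (simp add: equivalent_edges_def)
  show "c x \<noteq> c y" if "e \<in> edges G" "e \<notin> R" "ends G e = {x, y}" for e x y
    using assms that flipsD[OF _ that(3)] by (auto simp: doublet_def)
  show "c x = c y" if "e \<in> R" "x \<in> ends G e" "y \<in> ends G e" for e x y
    using assms that by (auto simp: doublet_def)
qed

text \<open>
  If \<open>M1\<close> avoids \<open>ei\<close>, then \<open>Ri\<close> lies outside the core of \<open>ei\<close> and \<open>Rj\<close> inside. The set \<open>P\<close> where \<open>ci\<close> and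
  \<open>cj\<close> compare as at \<open>v\<close> has the cut \<open>Ri \<union> Rj\<close>, and splicing along it produces a perfect matching that
  avoids \<open>ei\<close> and yet leaves the core.
\<close>

lemma doublet_matched_with_edge:
  assumes mc: "matching_covered G" and v: "v \<in> verts G"
    and ek: "ek \<in> edges G" "v \<in> ends G ek" and ei: "v \<in> ends G ei" and ej: "ej \<in> edges G" "v \<in> ends G ej"
    and ne: "ek \<noteq> ei" "ek \<noteq> ej" "ei \<noteq> ej"
    and Ri: "doublet G Ri ci" "Ri \<inter> core G v ei = {}"
    and Rj: "doublet G Rj cj" "Rj \<inter> core G v ej = {}"
    and M1: "perfect_matching G M1" "Ri \<subseteq> M1"
  shows "ei \<in> M1"
proof (rule ccontr)
  assume eiM1: "ei \<notin> M1"
  note G = matching_coveredD(1)[OF mc]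
  note di = doubletD[OF Ri(1)] and dj = doubletD[OF Rj(1)]
  let ?W = "core_verts G v ei"
  have vW: "v \<in> ?W" by (simp add: core_verts_def component_self)
  have Riout: "ends G a \<inter> ?W = {}" if "a \<in> Ri" for a
    using avoidingI[OF M1(1) eiM1] M1(2) Ri(2) that by (auto simp: core_def)
  have Rjcore: "Rj \<subseteq> core G v ei" using cores_cover[OF mc v ek ei ej(2) ne] Rj(2) dj(3) by blast
  have Rjin: "ends G a \<subseteq> ?W" if "a \<in> Rj" for a by (rule core_inside[OF subsetD[OF Rjcore that]])
  have disj: "Ri \<inter> Rj = {}" using Rjcore Ri(2) by blast
  define h where "h x = (ci x = cj x)" for x
  define P where "P = {x \<in> verts G. h x = h v}"
  have hflip: "h x \<noteq> h y" if "e \<in> Ri" "ends G e = {x, y}" for e x y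
    using di(5)[of e x y] dj(4)[of e x y] that di(3) disj by (auto simp: h_def)
  have hconst: "h x = h y" if "e \<in> edges G" "e \<notin> Ri" "e \<notin> Rj" "ends G e = {x, y}" for e x y
    using di(4)[of e x y] dj(4)[of e x y] that by (auto simp: h_def)
  have cutP: "edge_cut G P \<subseteq> Ri \<union> Rj"
  proof
    fix e assume e: "e \<in> edge_cut G P"
    then have eE: "e \<in> edges G" by (auto simp: edge_cut_def)
    obtain x y where xy: "ends G e = {x, y}" "x \<in> verts G" "y \<in> verts G" using loopless_ends[OF G eE] .
    then have "h x \<noteq> h y" using e in_edge_cut_iff[OF G eE, of P] by (auto simp: P_def)
    then show "e \<in> Ri \<union> Rj" using hconst[OF eE _ _ xy(1)] by auto
  qed
  obtain a where a: "a \<in> Ri" using Ri(1) by (auto simp: doublet_def)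
  then have aE: "a \<in> edges G" using di(3) by auto
  obtain x y where xy: "ends G a = {x, y}" "x \<in> verts G" "y \<in> verts G" using loopless_ends[OF G aE] .
  \<comment> \<open>Both ends of an edge of \<open>Ri\<close> lie outside the core and differ in
    \<open>h\<close>, so \<open>Q\<close> is nonempty. An edge \<open>g\<close> leaving
    \<open>Q\<close> outside \<open>Ri\<close> preserves \<open>h\<close>, so it must lead into the
    core.\<close>
  define Q where "Q = {x \<in> verts G. x \<notin> ?W \<and> h x \<noteq> h v}"
  have "x \<in> Q \<or> y \<in> Q" using hflip[OF a xy(1)] Riout[OF a] xy by (auto simp: Q_def)
  then obtain z where z: "z \<in> Q" "z \<in> verts G" using xy by auto
  have "v \<notin> Q" by (simp add: Q_def)
  obtain g where g: "g \<in> edge_cut G Q" "g \<notin> Ri"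
    using matching_covered_delete_crossing[OF di(2) z(2) v z(1) \<open>v \<notin> Q\<close>] .
  have gE: "g \<in> edges G" using g by (auto simp: edge_cut_def)
  obtain p where p: "p \<in> ends G g" "p \<in> Q" using g by (auto simp: edge_cut_def)
  obtain q where q: "ends G g = {p, q}" "q \<in> verts G" using loopless_other_end[OF G gE p(1)] .
  have qQ: "q \<notin> Q" using in_edge_cut_iff[OF G gE] g(1) p q by auto
  have "g \<notin> Rj" using Rjin p by (auto simp: Q_def)
  then have "h p = h q" using hconst[OF gE g(2) _ q(1)] by blast
  then have "q \<in> ?W" using qQ q(2) p(2) by (auto simp: Q_def)
  then have gcut: "g \<in> edge_cut G ?W" using p q in_edge_cut_iff[OF G gE] by (auto simp: Q_def)
  have gP: "ends G g \<inter> P = {}" using \<open>h p = h q\<close> p q by (auto simp: P_def Q_def)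
  obtain M where M: "perfect_matching G M" "g \<in> M" "M \<inter> Ri = {}"
    using matching_covered_delete_edge[OF di(2) gE g(2)] .
  have notei: "ei \<notin> N" if "perfect_matching G N" "e \<in> N" "v \<in> ends G e" "e \<noteq> ei" for N e
    using perfect_matching_unique[OF that(1,2) _ that(3) ei] that(4) by blast
  have "ek \<notin> Ri" using Riout[of ek] ek vW by auto
  then obtain Nout where Nout: "perfect_matching G Nout" "ek \<in> Nout" "Nout \<inter> Ri = {}"
    using matching_covered_delete_edge[OF di(2) ek(1)] by blast
  have Nout_ei: "ei \<notin> Nout" by (rule notei[OF Nout(1,2) ek(2) ne(1)])
  \<comment> \<open>\<open>Nin\<close> and \<open>Nout\<close> avoid \<open>ei\<close>, so neither
    crosses the boundary of \<open>?W\<close> and they can be joined there: \<open>Rj\<close> is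
    treated inside as \<open>M\<close> treats it, and \<open>Ri\<close> is absent outside.\<close>
  obtain Nin where Nin: "perfect_matching G Nin" "ei \<notin> Nin" "Nin \<inter> Rj = M \<inter> Rj"
  proof (cases "M \<inter> Rj = {}")
    case True
    have "\<not> (ek \<in> Rj \<and> ej \<in> Rj)"
    proof
      assume b: "ek \<in> Rj \<and> ej \<in> Rj"
      obtain N where N: "perfect_matching G N" "ek \<in> N" using matching_covered_edge[OF mc ek(1)] .
      then have "ej \<in> N" using equivalent_edgesD[OF dj(1) N(1)] b by blast
      then show False using perfect_matching_unique[OF N(1,2) _ ek(2) ej(2)] ne(2) by blast
    qed
    then obtain e where e: "e \<in> {ek, ej}" "e \<notin> Rj" by blast
    then have e': "e \<in> edges G" "v \<in> ends G e" "e \<noteq> ei" using ek ej ne by auto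
    obtain N where N: "perfect_matching G N" "e \<in> N" "N \<inter> Rj = {}"
      using matching_covered_delete_edge[OF dj(2) e'(1) e(2)] .
    show ?thesis using that[OF N(1) notei[OF N(1,2) e'(2,3)]] N(3) True by simp
  next
    case False
    then have sub: "Rj \<subseteq> M" using equivalent_edgesD[OF dj(1) M(1)] by blast
    obtain b where b: "b \<in> Rj" using Rj(1) by (auto simp: doublet_def)
    then have "b \<in> avoiding G ei" using Rjcore by (auto simp: core_def)
    then obtain N where N: "perfect_matching G N" "ei \<notin> N" "b \<in> N" by (auto simp: avoiding_def)
    then have "Rj \<subseteq> N" using equivalent_edgesD[OF dj(1) N(1) b] by blast
    then show ?thesis using that[OF N(1,2)] sub by blast
  qed
  let ?N = "splice G ?W Nin Nout"
  have "Nin \<inter> edge_cut G ?W = Nout \<inter> edge_cut G ?W"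
    using avoiding_no_cut[OF G Nin(1,2)] avoiding_no_cut[OF G Nout(1) Nout_ei] by simp
  then have N: "perfect_matching G ?N" by (rule splice_perfect_matching[OF G Nin(1) Nout(1)])
  have eiW: "ends G ei \<inter> ?W \<noteq> {}" using ei vW by auto
  have N_ei: "ei \<notin> ?N" using Nin(2) eiW by (simp add: splice_meets)
  have N_Rj: "e \<in> ?N \<longleftrightarrow> e \<in> M" if "e \<in> Rj" for e
  proof -
    have "e \<in> edges G" using that dj(3) by auto
    then have "ends G e \<inter> ?W \<noteq> {}" using Rjin[OF that] ends_nonempty[OF G] by blast
    then have "e \<in> ?N \<longleftrightarrow> e \<in> Nin" by (simp add: splice_meets)
    then show ?thesis using Nin(3) that by blast
  qed
  have N_Ri: "e \<notin> ?N" if "e \<in> Ri" for e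
    using Riout[OF that] Nout(3) that by (auto simp: splice_avoids)
  \<comment> \<open>Exchange along \<open>P\<close>: \<open>?N\<close> on the side of
    \<open>v\<close>, hence without \<open>ei\<close>, and \<open>M\<close> with \<open>g\<close> on
    the other side. This matching avoids \<open>ei\<close> and crosses out of
    \<open>?W\<close>.\<close>
  have "?N \<inter> edge_cut G P = M \<inter> edge_cut G P" using cutP N_Rj N_Ri M(3) by blast
  then have S: "perfect_matching G (splice G P ?N M)" by (rule splice_perfect_matching[OF G N M(1)])
  have "g \<in> splice G P ?N M" using gP M(2) by (simp add: splice_avoids)
  moreover have "ends G ei \<inter> P \<noteq> {}" using ei v by (auto simp: P_def)
  then have "ei \<notin> splice G P ?N M" using N_ei by (simp add: splice_meets)
  ultimately show False using avoiding_not_cut[OF G avoidingI[OF S]] gcut by blast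
qed

section \<open>Triples of exclusive doublets\<close>

lemma doublet_neg:
  assumes "doublet G R c"
  shows "doublet G R (\<lambda>x. \<not> c x)"
proof -
  obtain a b where "R = {a, b}" "a \<noteq> b" "\<forall>x\<in>ends G a. c x" "\<forall>x\<in>ends G b. \<not> c x"
    using assms by (auto simp: doublet_def)
  then have "\<exists>a b. R = {a, b} \<and> a \<noteq> b \<and> (\<forall>x\<in>ends G a. \<not> c x) \<and> (\<forall>x\<in>ends G b. \<not> \<not> c x)"
    by (intro exI[of _ b] exI[of _ a]) auto
  then show ?thesis using assms unfolding doublet_def flips_Not by blast
qed

lemma doublet_shift: "doublet G R c \<Longrightarrow> doublet G R (\<lambda>x. c x \<noteq> t)"
  using doublet_neg[of G R c] by (cases t) auto

lemma doublets_equal: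
  assumes R: "doublet G R c" and R': "doublet G R' c'" and "e \<in> R" "e \<in> R'"
  shows "R = R'"
proof -
  have "f \<in> R2" if 1: "doublet G R1 k1" "doublet G R2 k2" "e \<in> R1" "e \<in> R2" "f \<in> R1" for R1 R2 k1 k2 f
  proof (rule ccontr)
    assume n: "f \<notin> R2"
    have fE: "f \<in> edges G" using doubletD(3)[OF 1(1)] 1(5) by auto
    obtain M where M: "perfect_matching G M" "f \<in> M" "M \<inter> R2 = {}"
      using matching_covered_delete_edge[OF doubletD(2)[OF 1(2)] fE n] .
    then have "e \<in> M" using equivalent_edgesD[OF doubletD(1)[OF 1(1)] M(1) 1(5)] 1(3) by blast
    then show False using M(3) 1(4) by blast
  qed
  then show ?thesis using assms by blast
qed

text \<open>Exclusivity is assumed in one direction for each pair; as doublets are used entirely or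
  not at all, the other follows (\<open>excl\<close>). So \<open>rotate\<close> and
  \<open>swap\<close> permute the indices and most facts are proved for one index only.\<close>

locale doublet_triple =
  fixes G :: "('v, 'e) mgraph" and R1 R2 R3 :: "'e set" and c1 c2 c3 :: "'v \<Rightarrow> bool"
  assumes mc: "matching_covered G"
    and doublet1: "doublet G R1 c1" and doublet2: "doublet G R2 c2" and doublet3: "doublet G R3 c3"
    and excl12: "perfect_matching G M \<Longrightarrow> R1 \<subseteq> M \<Longrightarrow> R2 \<inter> M = {}"
    and excl13: "perfect_matching G M \<Longrightarrow> R1 \<subseteq> M \<Longrightarrow> R3 \<inter> M = {}"
    and excl23: "perfect_matching G M \<Longrightarrow> R2 \<subseteq> M \<Longrightarrow> R3 \<inter> M = {}"
begin

lemma G: "loopless_multigraph G"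
  by (rule matching_coveredD(1)[OF mc])

text \<open>With \<open>True\<close> as +1, equality of booleans is multiplication: each
  \<open>di\<close> is the product of the other two colourings and \<open>sg\<close> the product of
  all three. So \<open>di\<close> changes exactly on the other two doublets, and \<open>sg\<close>
  exactly on the edges outside all three. The product of the \<open>di\<close> is +1, which leaves
  four classes.\<close>

definition "d1 x = (c2 x = c3 x)"
definition "d2 x = (c1 x = c3 x)"
definition "d3 x = (c1 x = c2 x)"
definition "sg x = ((c1 x = c2 x) = c3 x)"

lemma d_rel: "d1 x = (d2 x = d3 x)" "sg x = (d1 x = c1 x)" "sg x = (d2 x = c2 x)" "sg x = (d3 x = c3 x)"
  by (auto simp: d1_def d2_def d3_def sg_def)

lemma sub: "R1 \<subseteq> edges G" "R2 \<subseteq> edges G" "R3 \<subseteq> edges G"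
  using doubletD(3) doublet1 doublet2 doublet3 by blast+

lemma all_or_none:
  assumes "perfect_matching G M"
  shows "R1 \<subseteq> M \<or> R1 \<inter> M = {}" "R2 \<subseteq> M \<or> R2 \<inter> M = {}" "R3 \<subseteq> M \<or> R3 \<inter> M = {}"
  using doubletD(1)[OF doublet1] doubletD(1)[OF doublet2] doubletD(1)[OF doublet3] assms
  by (simp_all add: equivalent_edges_def)

lemma nonempty: "R1 \<noteq> {}" "R2 \<noteq> {}" "R3 \<noteq> {}"
  using doublet1 doublet2 doublet3 by (auto simp: doublet_def)

lemma disjoint12: "R1 \<inter> R2 = {}" and disjoint13: "R1 \<inter> R3 = {}" and disjoint23: "R2 \<inter> R3 = {}"
proof -
  have *: "A \<inter> B = {}" if "doublet G A c" "\<And>M. perfect_matching G M \<Longrightarrow> A \<subseteq> M \<Longrightarrow> B \<inter> M = {}" for A B c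
  proof (rule ccontr)
    assume "A \<inter> B \<noteq> {}"
    then obtain e where e: "e \<in> A" "e \<in> B" by auto
    then have "e \<in> edges G" using doubletD(3)[OF that(1)] by auto
    then obtain M where M: "perfect_matching G M" "e \<in> M" using matching_covered_edge[OF mc] by blast
    then have "A \<subseteq> M" using equivalent_edgesD[OF doubletD(1)[OF that(1)] M(1) e(1)] by blast
    then show False using that(2)[OF M(1)] e M(2) by blast
  qed
  show "R1 \<inter> R2 = {}" "R1 \<inter> R3 = {}" "R2 \<inter> R3 = {}"
    using *[OF doublet1 excl12] *[OF doublet1 excl13] *[OF doublet2 excl23] by blast+
qed

lemma rotate: "doublet_triple G R2 R3 R1 c2 c3 c1"
proof
  fix M assume M: "perfect_matching G M"
  show "R2 \<subseteq> M \<Longrightarrow> R1 \<inter> M = {}" using excl12[OF M] all_or_none(1)[OF M] nonempty by blast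
  show "R3 \<subseteq> M \<Longrightarrow> R1 \<inter> M = {}" using excl13[OF M] all_or_none(1)[OF M] nonempty by blast
  show "R2 \<subseteq> M \<Longrightarrow> R3 \<inter> M = {}" by (rule excl23[OF M])
qed (rule mc doublet1 doublet2 doublet3)+

lemma excl: 
  assumes "perfect_matching G M"
  shows "R1 \<subseteq> M \<Longrightarrow> R2 \<inter> M = {} \<and> R3 \<inter> M = {}" "R2 \<subseteq> M \<Longrightarrow> R1 \<inter> M = {} \<and> R3 \<inter> M = {}"
    "R3 \<subseteq> M \<Longrightarrow> R1 \<inter> M = {} \<and> R2 \<inter> M = {}"
  using excl12[OF assms] excl13[OF assms] excl23[OF assms] all_or_none[OF assms] nonempty by blast+

lemma swap: "doublet_triple G R2 R1 R3 c2 c1 c3"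
proof
  fix M assume M: "perfect_matching G M"
  show "R2 \<subseteq> M \<Longrightarrow> R1 \<inter> M = {}" "R2 \<subseteq> M \<Longrightarrow> R3 \<inter> M = {}" "R1 \<subseteq> M \<Longrightarrow> R3 \<inter> M = {}"
    using excl[OF M] by blast+
qed (rule mc doublet1 doublet2 doublet3)+

lemma shift: "doublet_triple G R1 R2 R3 (\<lambda>x. c1 x \<noteq> t1) (\<lambda>x. c2 x \<noteq> t2) (\<lambda>x. c3 x \<noteq> t3)"
proof
  fix M assume M: "perfect_matching G M"
  show "R1 \<subseteq> M \<Longrightarrow> R2 \<inter> M = {}" "R1 \<subseteq> M \<Longrightarrow> R3 \<inter> M = {}" "R2 \<subseteq> M \<Longrightarrow> R3 \<inter> M = {}"
    using excl[OF M] by blast+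
qed (rule mc doublet_shift doublet1 doublet2 doublet3)+

lemma edge_free:
  assumes "e \<in> edges G" "e \<notin> R1" "e \<notin> R2" "e \<notin> R3" "ends G e = {x, y}"
  shows "d1 x = d1 y" "d2 x = d2 y" "d3 x = d3 y" "sg x \<noteq> sg y"
  using doubletD(4)[OF doublet1 assms(1,2,5)] doubletD(4)[OF doublet2 assms(1,3,5)]
    doubletD(4)[OF doublet3 assms(1,4,5)]
  by (auto simp: d1_def d2_def d3_def sg_def)

lemma edge_R1:
  assumes "e \<in> R1" "ends G e = {x, y}"
  shows "c1 x = c1 y" "d1 x = d1 y" "d2 x \<noteq> d2 y" "d3 x \<noteq> d3 y" "sg x = sg y"
proof -
  have e: "e \<in> edges G" "e \<notin> R2" "e \<notin> R3" using assms sub disjoint12 disjoint13 by auto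
  show "c1 x = c1 y" using doubletD(5)[OF doublet1 assms(1)] assms(2) by auto
  then show "d1 x = d1 y" "d2 x \<noteq> d2 y" "d3 x \<noteq> d3 y" "sg x = sg y"
    using doubletD(4)[OF doublet2 e(1,2) assms(2)] doubletD(4)[OF doublet3 e(1,3) assms(2)]
    by (auto simp: d1_def d2_def d3_def sg_def)
qed

lemma edge_R2:
  assumes "e \<in> R2" "ends G e = {x, y}"
  shows "c2 x = c2 y" "d2 x = d2 y" "d1 x \<noteq> d1 y" "d3 x \<noteq> d3 y" "sg x = sg y"
proof -
  have e: "e \<in> edges G" "e \<notin> R1" "e \<notin> R3" using assms sub disjoint12 disjoint23 by auto
  show "c2 x = c2 y" using doubletD(5)[OF doublet2 assms(1)] assms(2) by auto
  then show "d2 x = d2 y" "d1 x \<noteq> d1 y" "d3 x \<noteq> d3 y" "sg x = sg y"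
    using doubletD(4)[OF doublet1 e(1,2) assms(2)] doubletD(4)[OF doublet3 e(1,3) assms(2)]
    by (auto simp: d1_def d2_def d3_def sg_def)
qed

lemma edge_R3:
  assumes "e \<in> R3" "ends G e = {x, y}"
  shows "c3 x = c3 y" "d3 x = d3 y" "d1 x \<noteq> d1 y" "d2 x \<noteq> d2 y" "sg x = sg y"
proof -
  have e: "e \<in> edges G" "e \<notin> R1" "e \<notin> R2" using assms sub disjoint13 disjoint23 by auto
  show "c3 x = c3 y" using doubletD(5)[OF doublet3 assms(1)] assms(2) by auto
  then show "d3 x = d3 y" "d1 x \<noteq> d1 y" "d2 x \<noteq> d2 y" "sg x = sg y"
    using doubletD(4)[OF doublet1 e(1,2) assms(2)] doubletD(4)[OF doublet2 e(1,3) assms(2)]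
    by (auto simp: d1_def d2_def d3_def sg_def)
qed

lemma in_edge_cut_doubleton:
  assumes "e \<in> edges G" "ends G e = {x, y}"
  shows "e \<in> edge_cut G X \<longleftrightarrow> (x \<in> X) \<noteq> (y \<in> X)"
  using in_edge_cut_iff[OF G assms(1)] assms(2) by auto

lemma cut_d1: "edge_cut G {x \<in> verts G. d1 x = t} = R2 \<union> R3"
proof (intro equalityI subsetI)
  fix e assume e: "e \<in> edge_cut G {x \<in> verts G. d1 x = t}"
  then have eE: "e \<in> edges G" by (auto simp: edge_cut_def)
  obtain x y where xy: "ends G e = {x, y}" "x \<in> verts G" "y \<in> verts G" using loopless_ends[OF G eE] .
  have "d1 x \<noteq> d1 y" using e in_edge_cut_doubleton[OF eE xy(1)] xy by auto
  then show "e \<in> R2 \<union> R3" using edge_free(1)[OF eE _ _ _ xy(1)] edge_R1(2)[OF _ xy(1)] by auto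
next
  fix e assume e: "e \<in> R2 \<union> R3"
  then have eE: "e \<in> edges G" using sub by auto
  obtain x y where xy: "ends G e = {x, y}" "x \<in> verts G" "y \<in> verts G" using loopless_ends[OF G eE] .
  have "d1 x \<noteq> d1 y" using e edge_R2(3)[OF _ xy(1)] edge_R3(3)[OF _ xy(1)] by auto
  then show "e \<in> edge_cut G {x \<in> verts G. d1 x = t}" using in_edge_cut_doubleton[OF eE xy(1)] xy by auto
qed

text \<open>An edge outside \<open>R1\<close>, \<open>R2\<close>, \<open>R3\<close> contributes nothing to the sum of the signs \<open>sg\<close>.\<close>

lemma sum_sg:
  assumes M: "perfect_matching G M"
  shows "(\<Sum>x\<in>verts G. sgn_of (sg x)) = (\<Sum>e\<in>M \<inter> (R1 \<union> R2 \<union> R3). \<Sum>x\<in>ends G e. sgn_of (sg x))"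
proof -
  have fM: "finite M" by (rule perfect_matching_finite[OF G M])
  have "(\<Sum>x\<in>verts G. sgn_of (sg x)) = (\<Sum>e\<in>M. \<Sum>x\<in>ends G e. sgn_of (sg x))"
    by (rule perfect_matching_sum[OF G M])
  also have "\<dots> = (\<Sum>e\<in>M \<inter> (R1 \<union> R2 \<union> R3). \<Sum>x\<in>ends G e. sgn_of (sg x))"
  proof (rule sum.mono_neutral_right[OF fM], simp, intro ballI)
    fix e assume e: "e \<in> M - M \<inter> (R1 \<union> R2 \<union> R3)"
    then have eE: "e \<in> edges G" using perfect_matching_subset[OF M] by auto
    obtain x y where xy: "ends G e = {x, y}" "x \<noteq> y" using loopless_ends[OF G eE] .
    have "sg x \<noteq> sg y" using edge_free(4)[OF eE _ _ _ xy(1)] e by auto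
    then show "(\<Sum>x\<in>ends G e. sgn_of (sg x)) = 0" using xy by (auto simp: sgn_of_def)
  qed
  finally show ?thesis .
qed

text \<open>A perfect matching containing \<open>R1\<close> contains no edge of the other two
  doublets, so only \<open>a\<close> and \<open>b\<close> contribute, each with two equal
  signs.\<close>

lemma sum_sg_R1:
  assumes ab: "R1 = {a, b}" "a \<noteq> b" and x: "x \<in> ends G a" and y: "y \<in> ends G b"
  shows "(\<Sum>x\<in>verts G. sgn_of (sg x)) = 2 * (sgn_of (sg x) + sgn_of (sg y))"
proof -
  have aE: "a \<in> edges G" "b \<in> edges G" using sub ab by auto
  obtain M where M: "perfect_matching G M" "a \<in> M" using matching_covered_edge[OF mc aE(1)] .
  then have R1M: "R1 \<subseteq> M" using all_or_none(1)[OF M(1)] ab by blast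
  then have "M \<inter> (R1 \<union> R2 \<union> R3) = {a, b}" using excl[OF M(1)] ab by auto
  then have *: "(\<Sum>x\<in>verts G. sgn_of (sg x)) = (\<Sum>x\<in>ends G a. sgn_of (sg x)) + (\<Sum>x\<in>ends G b. sgn_of (sg x))"
    using sum_sg[OF M(1)] ab(2) by simp
  obtain x' where x': "ends G a = {x, x'}" "x \<noteq> x'" using loopless_other_end[OF G aE(1) x] .
  obtain y' where y': "ends G b = {y, y'}" "y \<noteq> y'" using loopless_other_end[OF G aE(2) y] .
  have "sg x = sg x'" "sg y = sg y'" using edge_R1(5) x' y' ab by auto
  then show ?thesis using * x' y' by simp
qed

end

section \<open>Position of the doublets relative to the classes\<close>

context doublet_triple
begin

lemma in_verts: "e \<in> edges G \<Longrightarrow> x \<in> ends G e \<Longrightarrow> x \<in> verts G"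
  using G by (auto simp: loopless_multigraph_def)

text \<open>Each edge of \<open>Ri\<close> would join the class with all signs true to the class
  where only \<open>di\<close> is true. Then only \<open>R1\<close> leaves the class
  \<open>W\<close>, and removing \<open>R1\<close> disconnects the graph.\<close>

lemma star_impossible:
  assumes "\<And>e x. e \<in> R1 \<Longrightarrow> x \<in> ends G e \<Longrightarrow> d1 x" "\<And>e x. e \<in> R2 \<Longrightarrow> x \<in> ends G e \<Longrightarrow> d2 x"
    "\<And>e x. e \<in> R3 \<Longrightarrow> x \<in> ends G e \<Longrightarrow> d3 x"
  shows False
proof -
  define W where "W = {x \<in> verts G. \<not> d2 x \<and> \<not> d3 x}"
  obtain e where e: "e \<in> R1" using nonempty by auto
  then have eE: "e \<in> edges G" using sub by auto
  obtain x y where xy: "ends G e = {x, y}" "x \<in> verts G" "y \<in> verts G" using loopless_ends[OF G eE] .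
  have "d1 x" "d1 y" using assms(1)[OF e] xy by auto
  then have "(x \<in> W) \<noteq> (y \<in> W)" using edge_R1(3)[OF e xy(1)] d_rel(1)[of x] d_rel(1)[of y] xy by (auto simp: W_def)
  then obtain g where g: "g \<in> edge_cut G W" "g \<notin> R1"
    using matching_covered_delete_crossing[OF doubletD(2)[OF doublet1] xy(2,3), of W]
      matching_covered_delete_crossing[OF doubletD(2)[OF doublet1] xy(3,2), of W] by metis
  then have gE: "g \<in> edges G" by (auto simp: edge_cut_def)
  obtain p q where pq: "ends G g = {p, q}" "p \<in> verts G" "q \<in> verts G" using loopless_ends[OF G gE] .
  have c: "(p \<in> W) \<noteq> (q \<in> W)" using g in_edge_cut_doubleton[OF gE pq(1)] by simp
  have "g \<notin> R2" using assms(2)[of g] pq c by (auto simp: W_def)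
  moreover have "g \<notin> R3" using assms(3)[of g] pq c by (auto simp: W_def)
  ultimately show False using edge_free[OF gE g(2) _ _ pq(1)] c pq by (auto simp: W_def)
qed

text \<open>No edge of a doublet meets the class with all signs true, and other edges stay within
  classes; connectedness makes this class empty.\<close>

lemma triangle_classes:
  assumes "\<And>e x. e \<in> R1 \<Longrightarrow> x \<in> ends G e \<Longrightarrow> \<not> d1 x" "\<And>e x. e \<in> R2 \<Longrightarrow> x \<in> ends G e \<Longrightarrow> \<not> d2 x"
    "\<And>e x. e \<in> R3 \<Longrightarrow> x \<in> ends G e \<Longrightarrow> \<not> d3 x" and z: "z \<in> verts G"
  shows "\<not> (d1 z \<and> d2 z \<and> d3 z)"
proof
  assume zW: "d1 z \<and> d2 z \<and> d3 z"
  define W where "W = {x \<in> verts G. d1 x \<and> d2 x \<and> d3 x}"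
  obtain e where e: "e \<in> R1" using nonempty by auto
  then have eE: "e \<in> edges G" using sub by auto
  obtain x y where xy: "ends G e = {x, y}" "x \<in> verts G" "y \<in> verts G" using loopless_ends[OF G eE] .
  have "x \<notin> W" "z \<in> W" using assms(1)[OF e] xy z zW by (auto simp: W_def)
  then obtain g where g: "g \<in> edge_cut G W" using matching_covered_crossing[OF mc z xy(2), of W] by metis
  then have gE: "g \<in> edges G" by (auto simp: edge_cut_def)
  obtain p q where pq: "ends G g = {p, q}" "p \<in> verts G" "q \<in> verts G" using loopless_ends[OF G gE] .
  have c: "(p \<in> W) \<noteq> (q \<in> W)" using g in_edge_cut_doubleton[OF gE pq(1)] by simp
  have "g \<notin> R1" "g \<notin> R2" "g \<notin> R3" using assms(1-3)[of g] pq c by (auto simp: W_def)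
  then show False using edge_free[OF gE _ _ _ pq(1)] c pq by (auto simp: W_def)
qed

text \<open>The two edges of \<open>R1\<close> have opposite \<open>c1\<close>, and
  \<open>sg\<close> is the product of \<open>d1\<close> and \<open>c1\<close>. Hence they agree in
  exactly one of \<open>d1\<close> and \<open>sg\<close>, and the sum tells which.\<close>

lemma R1_sg:
  "\<exists>t. (\<forall>e\<in>R1. \<forall>x\<in>ends G e. d1 x = t) \<and> (\<Sum>x\<in>verts G. sgn_of (sg x)) = 0
     \<or> (\<forall>e\<in>R1. \<forall>x\<in>ends G e. sg x = t) \<and> (\<Sum>x\<in>verts G. sgn_of (sg x)) = 4 * sgn_of t"
proof -
  obtain a b where ab: "R1 = {a, b}" "a \<noteq> b" "\<forall>x\<in>ends G a. c1 x" "\<forall>x\<in>ends G b. \<not> c1 x"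
    using doublet1 by (auto simp: doublet_def)
  have aE: "a \<in> edges G" "b \<in> edges G" using sub ab by auto
  obtain x x' where x: "ends G a = {x, x'}" using loopless_ends[OF G aE(1)] .
  obtain y y' where y: "ends G b = {y, y'}" using loopless_ends[OF G aE(2)] .
  have S: "(\<Sum>x\<in>verts G. sgn_of (sg x)) = 2 * (sgn_of (sg x) + sgn_of (sg y))"
    using sum_sg_R1[OF ab(1,2)] x y by auto
  have c: "d1 x = d1 x'" "sg x = sg x'" "d1 y = d1 y'" "sg y = sg y'"
    using edge_R1[OF _ x] edge_R1[OF _ y] ab(1) by auto
  show ?thesis
  proof (cases "sg x = sg y")
    case True
    then show ?thesis using S ab(1) x y c by (intro exI[of _ "sg x"] disjI2) auto
  next
    case False
    then have "d1 x = d1 y" using d_rel(2)[of x] d_rel(2)[of y] ab(3,4) x y by auto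
    moreover have "sgn_of (sg x) + sgn_of (sg y) = 0" using False by (auto simp: sgn_of_def)
    ultimately show ?thesis using S ab(1) x y c by (intro exI[of _ "d1 x"] disjI1) auto
  qed
qed

end

text \<open>
  The signs \<open>d1\<close>, \<open>d2\<close>, \<open>d3\<close> split the vertices into at most four classes, joined only by edges of
  \<open>R1\<close>, \<open>R2\<close>, \<open>R3\<close>. In a \<open>K_type\<close> triple the classes are joined pairwise by single edges, as the
  vertices of \<open>K4\<close>; in a \<open>C_type\<close> triple the class where all signs are true is empty and the other three
  are joined by double edges, as the rungs of the prism.
\<close>

definition K_type :: "('v, 'e) mgraph \<Rightarrow> 'e set \<Rightarrow> 'e set \<Rightarrow> 'e set \<Rightarrow> ('v \<Rightarrow> bool) \<Rightarrow> ('v \<Rightarrow> bool) \<Rightarrow> ('v \<Rightarrow> bool) \<Rightarrow> bool" where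
  "K_type G R1 R2 R3 c1 c2 c3 \<longleftrightarrow> (\<forall>e\<in>R1 \<union> R2 \<union> R3. \<forall>x\<in>ends G e. (c1 x = c2 x) = c3 x) \<and>
     (\<forall>M. perfect_matching G M \<longrightarrow> R1 \<subseteq> M \<or> R2 \<subseteq> M \<or> R3 \<subseteq> M)"

definition C_type :: "('v, 'e) mgraph \<Rightarrow> ('v \<Rightarrow> bool) \<Rightarrow> ('v \<Rightarrow> bool) \<Rightarrow> ('v \<Rightarrow> bool) \<Rightarrow> bool" where
  "C_type G c1 c2 c3 \<longleftrightarrow> (\<forall>x\<in>verts G. \<not> (c1 x = c2 x \<and> c2 x = c3 x))"

text \<open>
  All three doublets give the same value to the sum of \<open>sg\<close> over the vertices. If it is not zero, the
  triple is of \<open>K_type\<close> up to sign. If it is zero, \<open>di\<close> has a constant value \<open>ti\<close> on the ends of \<open>Ri\<close>, and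
  replacing each \<open>ci\<close> by \<open>ci \<noteq> ti\<close> makes these three values equal.
\<close>

lemma (in doublet_triple) type_cases:
  "\<exists>k1 k2 k3. doublet_triple G R1 R2 R3 k1 k2 k3 \<and> (K_type G R1 R2 R3 k1 k2 k3 \<or> C_type G k1 k2 k3)"
proof -
  interpret r: doublet_triple G R2 R3 R1 c2 c3 c1 by (rule rotate)
  interpret rr: doublet_triple G R3 R1 R2 c3 c1 c2 by (rule r.rotate)
  have req: "r.sg x = sg x" "rr.sg x = sg x" "r.d1 x = d2 x" "rr.d1 x = d3 x" for x
    unfolding r.sg_def rr.sg_def sg_def r.d1_def rr.d1_def d2_def d3_def by auto
  define S where "S = (\<Sum>x\<in>verts G. sgn_of (sg x))"
  obtain t1 where t1: "(\<forall>e\<in>R1. \<forall>x\<in>ends G e. d1 x = t1) \<and> S = 0 \<or> (\<forall>e\<in>R1. \<forall>x\<in>ends G e. sg x = t1) \<and> S = 4 * sgn_of t1"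
    using R1_sg unfolding S_def by blast
  obtain t2 where t2: "(\<forall>e\<in>R2. \<forall>x\<in>ends G e. d2 x = t2) \<and> S = 0 \<or> (\<forall>e\<in>R2. \<forall>x\<in>ends G e. sg x = t2) \<and> S = 4 * sgn_of t2"
    using r.R1_sg unfolding S_def req by blast
  obtain t3 where t3: "(\<forall>e\<in>R3. \<forall>x\<in>ends G e. d3 x = t3) \<and> S = 0 \<or> (\<forall>e\<in>R3. \<forall>x\<in>ends G e. sg x = t3) \<and> S = 4 * sgn_of t3"
    using rr.R1_sg unfolding S_def req by blast
  have nz: "sgn_of t \<noteq> 0" for t by (simp add: sgn_of_def)
  show ?thesis
  proof (cases "S = 0")
    case False
    then have eq: "t2 = t1" "t3 = t1" using t1 t2 t3 by (metis mult_cancel_left sgn_of_inject zero_neq_numeral)+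
    have sg: "sg x = t1" if "e \<in> R1 \<union> R2 \<union> R3" "x \<in> ends G e" for e x
      using that t1 t2 t3 eq False by blast
    have some: "R1 \<subseteq> M \<or> R2 \<subseteq> M \<or> R3 \<subseteq> M" if M: "perfect_matching G M" for M
    proof (rule ccontr)
      assume "\<not> ?thesis"
      then have "M \<inter> (R1 \<union> R2 \<union> R3) = {}" using all_or_none[OF M] by blast
      then show False using sum_sg[OF M] False by (simp add: S_def)
    qed
    \<comment> \<open>Negating \<open>c1\<close> when \<open>t1\<close> is false makes
      \<open>sg\<close> true on all ends of the doublets.\<close>
    have "doublet_triple G R1 R2 R3 (\<lambda>x. c1 x \<noteq> (\<not> t1)) (\<lambda>x. c2 x \<noteq> False) (\<lambda>x. c3 x \<noteq> False)" by (rule shift)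
    moreover have "K_type G R1 R2 R3 (\<lambda>x. c1 x \<noteq> (\<not> t1)) (\<lambda>x. c2 x \<noteq> False) (\<lambda>x. c3 x \<noteq> False)"
      unfolding K_type_def
    proof (intro conjI ballI allI impI)
      fix e x assume "e \<in> R1 \<union> R2 \<union> R3" "x \<in> ends G e"
      then have "sg x = t1" by (rule sg)
      then show "((c1 x \<noteq> (\<not> t1)) = (c2 x \<noteq> False)) = (c3 x \<noteq> False)" unfolding sg_def by (cases t1) auto
    qed (rule some)
    ultimately show ?thesis by blast
  next
    case True
    \<comment> \<open>\<open>p\<close> is the product of \<open>t1\<close>, \<open>t2\<close>,
      \<open>t3\<close>. It is the value of each shifted \<open>di\<close> on the ends of
      \<open>Ri\<close>: the value \<open>ti\<close> times the two other shifts.\<close>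
    define p where "p = ((t1 \<noteq> t2) \<noteq> t3)"
    interpret s: doublet_triple G R1 R2 R3 "\<lambda>x. c1 x \<noteq> t1" "\<lambda>x. c2 x \<noteq> t2" "\<lambda>x. c3 x \<noteq> t3" by (rule shift)
    have sd: "s.d1 x = (d1 x = (t2 = t3))" "s.d2 x = (d2 x = (t1 = t3))" "s.d3 x = (d3 x = (t1 = t2))" for x
      unfolding s.d1_def s.d2_def s.d3_def d1_def d2_def d3_def by auto
    have S4: "S \<noteq> 4 * sgn_of t" for t using True nz[of t] by simp
    have D: "s.d1 x = p" if "e \<in> R1" "x \<in> ends G e" for e x using t1 S4 that unfolding sd p_def by blast
    have D2: "s.d2 x = p" if "e \<in> R2" "x \<in> ends G e" for e x using t2 S4 that unfolding sd p_def by blast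
    have D3: "s.d3 x = p" if "e \<in> R3" "x \<in> ends G e" for e x using t3 S4 that unfolding sd p_def by blast
    \<comment> \<open>A true common value would be the star configuration.\<close>
    have np: "\<not> p" using s.star_impossible D D2 D3 by blast
    have "\<not> (s.d1 z \<and> s.d2 z \<and> s.d3 z)" if "z \<in> verts G" for z
      using s.triangle_classes[OF _ _ _ that] D D2 D3 np by blast
    then have "C_type G (\<lambda>x. c1 x \<noteq> t1) (\<lambda>x. c2 x \<noteq> t2) (\<lambda>x. c3 x \<noteq> t3)"
      unfolding C_type_def s.d1_def s.d2_def s.d3_def by blast
    then show ?thesis using shift by blast
  qed
qed

section \<open>Forced edges at a vertex and a possible fourth doublet\<close>

context doublet_triple
begin

lemma matching_with_R1:
  obtains M where "perfect_matching G M" "R1 \<subseteq> M"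
proof -
  obtain e where e: "e \<in> R1" using nonempty by auto
  then have "e \<in> edges G" using sub by auto
  then obtain M where "perfect_matching G M" "e \<in> M" using matching_covered_edge[OF mc] by blast
  then show ?thesis using that all_or_none(1) e by blast
qed

text \<open>The product of the three signs is +1 and they are not all true, so exactly one is
  true.\<close>

lemma C_unique:
  assumes "C_type G c1 c2 c3" "x \<in> verts G"
  shows "d1 x \<longleftrightarrow> \<not> d2 x \<and> \<not> d3 x" "d2 x \<longleftrightarrow> \<not> d1 x \<and> \<not> d3 x" "d3 x \<longleftrightarrow> \<not> d1 x \<and> \<not> d2 x"
  using assms unfolding C_type_def d1_def d2_def d3_def by auto

lemma C_R1:
  assumes C: "C_type G c1 c2 c3" and e: "e \<in> R1" "x \<in> ends G e"
  shows "\<not> d1 x"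
proof -
  have eE: "e \<in> edges G" using e sub by auto
  obtain y where y: "ends G e = {x, y}" using loopless_other_end[OF G eE e(2)] .
  have "x \<in> verts G" "y \<in> verts G" using in_verts[OF eE] y by auto
  then show ?thesis using edge_R1[OF e(1) y] C_unique[OF C] by blast
qed

text \<open>Only \<open>R2\<close> and \<open>R3\<close> leave the class of \<open>d1\<close>, and
  \<open>R1\<close> lies outside it. A matching through \<open>f\<close> free of \<open>R2\<close>
  and \<open>R3\<close> could be joined there with one containing \<open>R1\<close>, which forces
  \<open>e1\<close> at \<open>v\<close> beside \<open>f\<close>.\<close>

lemma C_edge_at_d1:
  assumes C: "C_type G c1 c2 c3" and v: "v \<in> verts G" "d1 v"
    and e1: "v \<in> ends G e1" "\<And>M. perfect_matching G M \<Longrightarrow> R1 \<subseteq> M \<Longrightarrow> e1 \<in> M"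
    and f: "v \<in> ends G f" "f \<noteq> e1" and M: "perfect_matching G M" "f \<in> M"
  shows "R2 \<subseteq> M \<or> R3 \<subseteq> M"
proof (rule ccontr)
  assume n: "\<not> ?thesis"
  define X where "X = {x \<in> verts G. d1 x = True}"
  obtain N where N: "perfect_matching G N" "R1 \<subseteq> N" using matching_with_R1 .
  have "M \<inter> edge_cut G X = N \<inter> edge_cut G X"
    unfolding X_def cut_d1 using n all_or_none[OF M(1)] excl(1)[OF N] by blast
  then have S: "perfect_matching G (splice G X M N)" by (rule splice_perfect_matching[OF G M(1) N(1)])
  have "R1 \<subseteq> splice G X M N"
  proof
    fix e assume e: "e \<in> R1"
    then have "ends G e \<inter> X = {}" using C_R1[OF C e] by (auto simp: X_def)
    then show "e \<in> splice G X M N" using e N(2) by (auto simp: splice_avoids)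
  qed
  then have "e1 \<in> splice G X M N" by (rule e1(2)[OF S])
  moreover have "ends G f \<inter> X \<noteq> {}" using f v by (auto simp: X_def)
  then have "f \<in> splice G X M N" using M(2) by (simp add: splice_meets)
  ultimately show False using perfect_matching_unique[OF S _ _ e1(1) f(1)] f(2) by blast
qed

lemma K_edges_at:
  assumes K: "K_type G R1 R2 R3 c1 c2 c3"
    and e: "v \<in> ends G e1" "v \<in> ends G e2" "v \<in> ends G e3"
    and forced: "\<And>M. perfect_matching G M \<Longrightarrow> R1 \<subseteq> M \<Longrightarrow> e1 \<in> M"
      "\<And>M. perfect_matching G M \<Longrightarrow> R2 \<subseteq> M \<Longrightarrow> e2 \<in> M"
      "\<And>M. perfect_matching G M \<Longrightarrow> R3 \<subseteq> M \<Longrightarrow> e3 \<in> M"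
    and f: "f \<in> edges G" "v \<in> ends G f"
  shows "f = e1 \<or> f = e2 \<or> f = e3"
proof -
  obtain M where M: "perfect_matching G M" "f \<in> M" using matching_covered_edge[OF mc f(1)] .
  have "e1 \<in> M \<or> e2 \<in> M \<or> e3 \<in> M" using K forced M(1) unfolding K_type_def by blast
  then show ?thesis using perfect_matching_unique[OF M(1) M(2) _ f(2)] e by blast
qed

text \<open>A perfect matching through \<open>e1\<close> that avoids \<open>R1\<close> contains
  \<open>R2\<close> or \<open>R3\<close>, and so a second edge at \<open>v\<close>.\<close>

lemma K_edge_in_doublet:
  assumes K: "K_type G R1 R2 R3 c1 c2 c3"
    and e: "e1 \<in> edges G" "v \<in> ends G e1" "v \<in> ends G e2" "v \<in> ends G e3" "e1 \<noteq> e2" "e1 \<noteq> e3"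
    and forced: "\<And>M. perfect_matching G M \<Longrightarrow> R2 \<subseteq> M \<Longrightarrow> e2 \<in> M"
      "\<And>M. perfect_matching G M \<Longrightarrow> R3 \<subseteq> M \<Longrightarrow> e3 \<in> M"
  shows "e1 \<in> R1"
proof (rule ccontr)
  assume "e1 \<notin> R1"
  then obtain M where M: "perfect_matching G M" "e1 \<in> M" "M \<inter> R1 = {}"
    using matching_covered_delete_edge[OF doubletD(2)[OF doublet1] e(1)] by blast
  then have "\<not> R1 \<subseteq> M" using nonempty by blast
  then have "e2 \<in> M \<or> e3 \<in> M" using K forced M(1) unfolding K_type_def by blast
  then show False using perfect_matching_unique[OF M(1) M(2) _ e(2)] e by blast
qed

lemma C_edge_in_doublet:
  assumes C: "C_type G c1 c2 c3" and v: "v \<in> verts G" "d1 v"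
    and e: "e2 \<in> edges G" "v \<in> ends G e1" "v \<in> ends G e2" "v \<in> ends G e3" "e2 \<noteq> e1" "e2 \<noteq> e3"
    and forced: "\<And>M. perfect_matching G M \<Longrightarrow> R1 \<subseteq> M \<Longrightarrow> e1 \<in> M"
      "\<And>M. perfect_matching G M \<Longrightarrow> R3 \<subseteq> M \<Longrightarrow> e3 \<in> M"
  shows "e2 \<in> R2"
proof (rule ccontr)
  assume "e2 \<notin> R2"
  then obtain M where M: "perfect_matching G M" "e2 \<in> M" "M \<inter> R2 = {}"
    using matching_covered_delete_edge[OF doubletD(2)[OF doublet2] e(1)] by blast
  have "R2 \<subseteq> M \<or> R3 \<subseteq> M"
    by (rule C_edge_at_d1[OF C v e(2) forced(1) e(3,5) M(1,2)])
  then have "e3 \<in> M" using forced(2)[OF M(1)] M(3) nonempty by blast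
  then show False using perfect_matching_unique[OF M(1) M(2) _ e(3,4)] e(6) by blast
qed

text \<open>A matching containing \<open>R\<close> and one avoiding \<open>R\<close> can be chosen
  to agree on \<open>R2\<close> and \<open>R3\<close>. If \<open>e\<close> and \<open>f\<close> lay
  on different sides of \<open>d1\<close>, their exchange would contain \<open>e\<close> without
  \<open>f\<close>.\<close>

lemma doublet_ends_same_d1:
  assumes R: "doublet G R c" and disj: "R \<inter> (R1 \<union> R2 \<union> R3) = {}"
    and e: "e \<in> R" "x \<in> ends G e" and f: "f \<in> R" "y \<in> ends G f"
  shows "d1 x = d1 y"
proof (rule ccontr)
  assume ne: "d1 x \<noteq> d1 y"
  define X where "X = {z \<in> verts G. d1 z = d1 x}"
  have E: "e \<in> edges G" "f \<in> edges G" using e f doubletD(3)[OF R] by auto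
  obtain M where M: "perfect_matching G M" "e \<in> M" using matching_covered_edge[OF mc E(1)] .
  obtain N where N: "perfect_matching G N" "N \<inter> R = {}" "N \<inter> (R2 \<union> R3) = M \<inter> (R2 \<union> R3)"
  proof -
    have *: "\<exists>N. perfect_matching G N \<and> N \<inter> R = {} \<and> g \<in> N" if "g \<in> R1 \<union> R2 \<union> R3" for g
    proof -
      have "g \<in> edges G" "g \<notin> R" using that sub disj by auto
      then show ?thesis using matching_covered_delete_edge[OF doubletD(2)[OF R]] by metis
    qed
    obtain g1 g2 g3 where g: "g1 \<in> R1" "g2 \<in> R2" "g3 \<in> R3" using nonempty by blast
    consider "R2 \<subseteq> M" | "R3 \<subseteq> M" | "R2 \<inter> M = {}" "R3 \<inter> M = {}" using all_or_none[OF M(1)] by blast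
    then show ?thesis
    proof cases
      case 1
      obtain N where N: "perfect_matching G N" "N \<inter> R = {}" "g2 \<in> N" using *[of g2] g by auto
      then have "R2 \<subseteq> N" using all_or_none(2)[OF N(1)] g by blast
      then show ?thesis using that[OF N(1,2)] excl(2)[OF N(1)] excl(2)[OF M(1) 1] 1 by blast
    next
      case 2
      obtain N where N: "perfect_matching G N" "N \<inter> R = {}" "g3 \<in> N" using *[of g3] g by auto
      then have "R3 \<subseteq> N" using all_or_none(3)[OF N(1)] g by blast
      then show ?thesis using that[OF N(1,2)] excl(3)[OF N(1)] excl(3)[OF M(1) 2] 2 by blast
    next
      case 3
      obtain N where N: "perfect_matching G N" "N \<inter> R = {}" "g1 \<in> N" using *[of g1] g by auto
      then have "R1 \<subseteq> N" using all_or_none(1)[OF N(1)] g by blast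
      then show ?thesis using that[OF N(1,2)] excl(1)[OF N(1)] 3 by blast
    qed
  qed
  have "M \<inter> edge_cut G X = N \<inter> edge_cut G X" unfolding X_def cut_d1 using N(3) by blast
  then have S: "perfect_matching G (splice G X M N)" by (rule splice_perfect_matching[OF G M(1) N(1)])
  have "ends G e \<inter> X \<noteq> {}" using e(2) in_verts[OF E(1)] by (auto simp: X_def)
  then have "e \<in> splice G X M N" using M(2) by (simp add: splice_meets)
  then have fS: "f \<in> splice G X M N" using equivalent_edgesD[OF doubletD(1)[OF R] S e(1)] f(1) by blast
  obtain y' where y': "ends G f = {y, y'}" using loopless_other_end[OF G E(2) f(2)] .
  have "d1 y = d1 y'" using edge_free(1)[OF E(2) _ _ _ y'] f(1) disj by blast
  then have "ends G f \<inter> X = {}" using y' ne by (auto simp: X_def)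
  then have "f \<in> N" using fS by (simp add: splice_avoids)
  then show False using N(2) f(1) by blast
qed

text \<open>The equality \<open>c x = sg x\<close> is the product of the fourth colouring with
  \<open>sg\<close>, called \<open>\<tau>\<close> later. It is preserved away from the four doublets
  and changes along \<open>R1\<close>, \<open>R2\<close>, \<open>R3\<close>.\<close>

lemma tau_free:
  assumes R: "doublet G R c" and e: "e \<in> edges G" "e \<notin> R1" "e \<notin> R2" "e \<notin> R3" "e \<notin> R" "ends G e = {x, y}"
  shows "(c x = sg x) = (c y = sg y)"
  using doubletD(4)[OF R e(1,5,6)] edge_free(4)[OF e(1-4,6)] by auto

lemma tau_R1:
  assumes R: "doublet G R c" and disj: "R \<inter> (R1 \<union> R2 \<union> R3) = {}" and e: "e \<in> R1" "ends G e = {x, y}"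
  shows "(c x = sg x) \<noteq> (c y = sg y)"
proof -
  have "e \<in> edges G" "e \<notin> R" using e disj sub by auto
  then show ?thesis using doubletD(4)[OF R _ _ e(2)] edge_R1(5)[OF e] by auto
qed

text \<open>In a class away from \<open>R\<close>, let \<open>Y\<close> be the part where the
  product is true. A matching containing \<open>R1\<close> can leave \<open>Y\<close> only by the
  edge of \<open>R1\<close> at \<open>x\<close>. So the product at \<open>x\<close> is determined by
  the parity of \<open>Y\<close>, hence by the class alone.\<close>

lemma K_parity:
  assumes K: "K_type G R1 R2 R3 c1 c2 c3"
    and R: "doublet G R c" and disj: "R \<inter> (R1 \<union> R2 \<union> R3) = {}"
    and away: "\<And>g z. g \<in> R \<Longrightarrow> z \<in> ends G g \<Longrightarrow> \<not> (d1 z = b1 \<and> d2 z = b2 \<and> d3 z = b3)"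
    and e: "e \<in> R1" "x \<in> ends G e" "d1 x = b1" "d2 x = b2" "d3 x = b3"
  shows "odd (card {z \<in> verts G. d1 z = b1 \<and> d2 z = b2 \<and> d3 z = b3 \<and> c z = sg z}) \<longleftrightarrow> c x = sg x"
proof -
  define Y where "Y = {z \<in> verts G. d1 z = b1 \<and> d2 z = b2 \<and> d3 z = b3 \<and> c z = sg z}"
  have eE: "e \<in> edges G" using e sub by auto
  obtain M where M: "perfect_matching G M" "R1 \<subseteq> M" using matching_with_R1 .
  obtain x' where x': "ends G e = {x, x'}" using loopless_other_end[OF G eE e(2)] .
  have x'Y: "x' \<notin> Y" using edge_R1(3)[OF e(1) x'] e by (auto simp: Y_def)
  have only: "g = e \<and> c x = sg x" if g: "g \<in> M" "g \<in> edge_cut G Y" for g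
  proof -
    have gE: "g \<in> edges G" using g by (auto simp: edge_cut_def)
    obtain p where p: "p \<in> ends G g" "p \<in> Y" using g by (auto simp: edge_cut_def)
    obtain q where q: "ends G g = {p, q}" "q \<in> verts G" using loopless_other_end[OF G gE p(1)] .
    have qY: "q \<notin> Y" using g(2) in_edge_cut_doubleton[OF gE q(1)] p(2) by simp
    have "g \<notin> R2" "g \<notin> R3" using g(1) excl(1)[OF M] by blast+
    moreover have "g \<notin> R" using away[OF _ p(1)] p(2) by (auto simp: Y_def)
    ultimately have gR: "g \<in> R1"
      using edge_free(1-3)[OF gE _ _ _ q(1)] tau_free[OF R gE _ _ _ _ q(1)] qY q(2) p(2) by (auto simp: Y_def)
    \<comment> \<open>With \<open>sg\<close> true, \<open>d1\<close> determines \<open>c1\<close>,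
      and the two edges of \<open>R1\<close> have different \<open>c1\<close>; so only one of them
      meets the class.\<close>
    have "sg p" "sg x" using K gR e p(1) unfolding K_type_def sg_def by blast+
    then have "c1 p = c1 x" using d_rel(2)[of p] d_rel(2)[of x] p(2) e(3) by (auto simp: Y_def)
    moreover obtain a b where "R1 = {a, b}" "\<forall>x\<in>ends G a. c1 x" "\<forall>x\<in>ends G b. \<not> c1 x"
      using doublet1 by (auto simp: doublet_def)
    ultimately have ge: "g = e" using gR e(1,2) p(1) by auto
    then have "p = x" using p x' x'Y by auto
    then show ?thesis using ge p(2) by (auto simp: Y_def)
  qed
  have YV: "Y \<subseteq> verts G" by (auto simp: Y_def)
  note parity = perfect_matching_parity[OF G M(1) YV]
  have "odd (card Y) \<longleftrightarrow> c x = sg x"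
  proof (cases "c x = sg x")
    case True
    then have "x \<in> Y" using e in_verts[OF eE] by (auto simp: Y_def)
    then have "e \<in> edge_cut G Y" using in_edge_cut_doubleton[OF eE x'] x'Y by simp
    then have "M \<inter> edge_cut G Y = {e}" using only e(1) M(2) by blast
    then show ?thesis using parity True by simp
  next
    case False
    then have "M \<inter> edge_cut G Y = {}" using only by blast
    then show ?thesis using parity False by simp
  qed
  then show ?thesis by (simp add: Y_def)
qed

lemma K_type_rotate: "K_type G R1 R2 R3 c1 c2 c3 \<Longrightarrow> K_type G R2 R3 R1 c2 c3 c1"
  unfolding K_type_def by blast

lemma C_type_rotate: "C_type G c1 c2 c3 \<Longrightarrow> C_type G c2 c3 c1"
  unfolding C_type_def by blast

text \<open>On the ends of \<open>R1\<close> the signs \<open>d1\<close> and \<open>c1\<close>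
  coincide, so each side of \<open>d1\<close> contains one edge of \<open>R1\<close>, joining its
  two classes.\<close>

lemma K_edge_with_d1:
  assumes K: "K_type G R1 R2 R3 c1 c2 c3"
  obtains e x y where "e \<in> R1" "ends G e = {x, y}" "d1 x = t" "d1 y = t" "d2 x = s" "d2 y = (\<not> s)"
proof -
  obtain a b where ab: "R1 = {a, b}" "\<forall>x\<in>ends G a. c1 x" "\<forall>x\<in>ends G b. \<not> c1 x"
    using doublet1 by (auto simp: doublet_def)
  define e where "e = (if t then a else b)"
  have e: "e \<in> R1" "\<forall>x\<in>ends G e. c1 x = t" using ab by (auto simp: e_def)
  then have eE: "e \<in> edges G" using sub by auto
  obtain x y where xy: "ends G e = {x, y}" using loopless_ends[OF G eE] .
  have "sg x" "sg y" using K e(1) xy unfolding K_type_def sg_def by blast+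
  then have d: "d1 x = t" "d1 y = t" using d_rel(2)[of x] d_rel(2)[of y] e(2) xy by auto
  have ne: "d2 x \<noteq> d2 y" by (rule edge_R1(3)[OF e(1) xy])
  show ?thesis
  proof (cases "d2 x = s")
    case True
    then show ?thesis using that[OF e(1) xy d] ne by blast
  next
    case False
    have "ends G e = {y, x}" using xy by auto
    then show ?thesis using that[OF e(1) _ d(2,1)] ne False by blast
  qed
qed

text \<open>All ends of \<open>R\<close> lie in the class of \<open>w\<close>. The other three
  classes are joined in a triangle by an edge of each \<open>Ri\<close>; by \<open>K_parity\<close>
  the product has one value per class at these ends, yet it changes along each side of the
  triangle.\<close>

lemma K_no_other_doublet:
  assumes K: "K_type G R1 R2 R3 c1 c2 c3"
    and R: "doublet G R c" and disj: "R \<inter> (R1 \<union> R2 \<union> R3) = {}"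
  shows False
proof -
  interpret r: doublet_triple G R2 R3 R1 c2 c3 c1 by (rule rotate)
  interpret rr: doublet_triple G R3 R1 R2 c3 c1 c2 by (rule r.rotate)
  have req: "r.sg x = sg x" "rr.sg x = sg x" "r.d1 x = d2 x" "rr.d1 x = d3 x" "r.d2 x = d3 x" "rr.d2 x = d1 x"
     "r.d3 x = d1 x" "rr.d3 x = d2 x" for x
    unfolding r.sg_def rr.sg_def sg_def r.d1_def rr.d1_def d2_def d3_def r.d2_def rr.d2_def d1_def r.d3_def rr.d3_def by auto
  have disj': "R \<inter> (R2 \<union> R3 \<union> R1) = {}" "R \<inter> (R3 \<union> R1 \<union> R2) = {}" using disj by blast+
  note K' = K_type_rotate[OF K]
  note K'' = r.K_type_rotate[OF K']
  obtain a where a: "a \<in> R" using R by (auto simp: doublet_def)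
  then have aE: "a \<in> edges G" using doubletD(3)[OF R] by auto
  obtain w where w: "w \<in> ends G a" using ends_nonempty[OF G aE] by auto
  have same: "d1 z = d1 w" "d2 z = d2 w" "d3 z = d3 w" if "g \<in> R" "z \<in> ends G g" for g z
    using doublet_ends_same_d1[OF R disj that a w] r.doublet_ends_same_d1[OF R disj'(1) that a w]
      rr.doublet_ends_same_d1[OF R disj'(2) that a w] by (simp_all add: req)
  define \<tau> where "\<tau> x = (c x = sg x)" for x
  define n where "n b1 b2 b3 = odd (card {z \<in> verts G. d1 z = b1 \<and> d2 z = b2 \<and> d3 z = b3 \<and> c z = sg z})" for b1 b2 b3
  have away: "\<not> (d1 z = d1 x \<and> d2 z = d2 x \<and> d3 z = d3 x)"
    if "d1 x \<noteq> d1 w \<or> d2 x \<noteq> d2 w" "g \<in> R" "z \<in> ends G g" for x g z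
    using same[OF that(2,3)] that(1) by auto
  have away': "\<not> (d2 z = d2 x \<and> d3 z = d3 x \<and> d1 z = d1 x)" "\<not> (d3 z = d3 x \<and> d1 z = d1 x \<and> d2 z = d2 x)"
    if "d1 x \<noteq> d1 w \<or> d2 x \<noteq> d2 w" "g \<in> R" "z \<in> ends G g" for x g z
    using away[OF that] by auto
  have p1: "n (d1 x) (d2 x) (d3 x) = \<tau> x" if "e \<in> R1" "x \<in> ends G e" "d1 x \<noteq> d1 w \<or> d2 x \<noteq> d2 w" for e x
    unfolding n_def \<tau>_def by (rule K_parity[OF K R disj away[OF that(3)] that(1,2)]) auto
  have p2: "n (d1 x) (d2 x) (d3 x) = \<tau> x" if "e \<in> R2" "x \<in> ends G e" "d1 x \<noteq> d1 w \<or> d2 x \<noteq> d2 w" for e x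
  proof -
    have "odd (card {z \<in> verts G. d2 z = d2 x \<and> d3 z = d3 x \<and> d1 z = d1 x \<and> c z = sg z}) \<longleftrightarrow> c x = sg x"
      by (rule r.K_parity[OF K' R disj'(1), unfolded req, OF away'(1)[OF that(3)] that(1,2)]) auto
    moreover have "{z \<in> verts G. d2 z = d2 x \<and> d3 z = d3 x \<and> d1 z = d1 x \<and> c z = sg z} =
      {z \<in> verts G. d1 z = d1 x \<and> d2 z = d2 x \<and> d3 z = d3 x \<and> c z = sg z}" by blast
    ultimately show ?thesis unfolding n_def \<tau>_def by simp
  qed
  have p3: "n (d1 x) (d2 x) (d3 x) = \<tau> x" if "e \<in> R3" "x \<in> ends G e" "d1 x \<noteq> d1 w \<or> d2 x \<noteq> d2 w" for e x
  proof -
    have "odd (card {z \<in> verts G. d3 z = d3 x \<and> d1 z = d1 x \<and> d2 z = d2 x \<and> c z = sg z}) \<longleftrightarrow> c x = sg x"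
      by (rule rr.K_parity[OF K'' R disj'(2), unfolded req, OF away'(2)[OF that(3)] that(1,2)]) auto
    moreover have "{z \<in> verts G. d3 z = d3 x \<and> d1 z = d1 x \<and> d2 z = d2 x \<and> c z = sg z} =
      {z \<in> verts G. d1 z = d1 x \<and> d2 z = d2 x \<and> d3 z = d3 x \<and> c z = sg z}" by blast
    ultimately show ?thesis unfolding n_def \<tau>_def by simp
  qed
  obtain e1 x1 y1 where e1: "e1 \<in> R1" "ends G e1 = {x1, y1}" "d1 x1 = (\<not> d1 w)" "d1 y1 = (\<not> d1 w)" "d2 x1 = d2 w" "d2 y1 = (\<not> d2 w)"
    using K_edge_with_d1[OF K, of "\<not> d1 w" "d2 w"] by metis
  obtain e2 x2 y2 where e2: "e2 \<in> R2" "ends G e2 = {x2, y2}" "d2 x2 = (\<not> d2 w)" "d2 y2 = (\<not> d2 w)" "d3 x2 = d3 w" "d3 y2 = (\<not> d3 w)"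
    using r.K_edge_with_d1[OF K', of "\<not> d2 w" "d3 w"] unfolding req by metis
  obtain e3 x3 y3 where e3: "e3 \<in> R3" "ends G e3 = {x3, y3}" "d3 x3 = (\<not> d3 w)" "d3 y3 = (\<not> d3 w)" "d1 x3 = d1 w" "d1 y3 = (\<not> d1 w)"
    using rr.K_edge_with_d1[OF K'', of "\<not> d3 w" "d1 w"] unfolding req by metis
  have flip: "\<tau> x1 \<noteq> \<tau> y1" "\<tau> x2 \<noteq> \<tau> y2" "\<tau> x3 \<noteq> \<tau> y3"
    using tau_R1[OF R disj e1(1,2)] r.tau_R1[OF R disj'(1) e2(1,2)] rr.tau_R1[OF R disj'(2) e3(1,2)]
    unfolding req \<tau>_def by blast+
  note dr = d_rel(1)[of w] d_rel(1)[of x1] d_rel(1)[of y1] d_rel(1)[of x2] d_rel(1)[of y2] d_rel(1)[of x3] d_rel(1)[of y3]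
  have cls: "d3 x1 = (\<not> d3 w)" "d3 y1 = d3 w" "d1 x2 = (\<not> d1 w)" "d1 y2 = d1 w" "d2 x3 = (\<not> d2 w)" "d2 y3 = d2 w"
    using dr e1 e2 e3 by auto
  have "\<tau> x1 = n (\<not> d1 w) (d2 w) (\<not> d3 w)" "\<tau> y1 = n (\<not> d1 w) (\<not> d2 w) (d3 w)"
    using p1[of e1 x1] p1[of e1 y1] e1 cls by auto
  moreover have "\<tau> x2 = n (\<not> d1 w) (\<not> d2 w) (d3 w)" "\<tau> y2 = n (d1 w) (\<not> d2 w) (\<not> d3 w)"
    using p2[of e2 x2] p2[of e2 y2] e2 cls by auto
  moreover have "\<tau> x3 = n (d1 w) (\<not> d2 w) (\<not> d3 w)" "\<tau> y3 = n (\<not> d1 w) (d2 w) (\<not> d3 w)"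
    using p3[of e3 x3] p3[of e3 y3] e3 cls by auto
  ultimately show False using flip by auto
qed

end

section \<open>A fourth doublet beside a triple of prism type\<close>

context doublet_triple
begin

lemma C_cut:
  assumes C: "C_type G c1 c2 c3"
    and R: "doublet G R c" and away: "\<forall>g\<in>R. \<forall>z\<in>ends G g. \<not> d1 z"
    and g: "g \<in> edge_cut G {z \<in> verts G. d1 z \<and> c z = sg z}"
  obtains p q where "g \<in> R2 \<union> R3" "ends G g = {p, q}" "p \<in> verts G" "d1 p" "c p = sg p" "\<not> d1 q"
proof -
  let ?Y = "{z \<in> verts G. d1 z \<and> c z = sg z}"
  have gE: "g \<in> edges G" using g by (auto simp: edge_cut_def)
  have "ends G g \<inter> ?Y \<noteq> {}" using g unfolding in_edge_cut_iff[OF G gE] ..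
  then obtain p where p: "p \<in> ends G g" "p \<in> ?Y" by (meson disjoint_iff)
  obtain q where q: "ends G g = {p, q}" "q \<in> verts G" using loopless_other_end[OF G gE p(1)] .
  have qY: "q \<notin> ?Y" using g p(2) unfolding in_edge_cut_doubleton[OF gE q(1)] by blast
  have "g \<notin> R1" using C_R1[OF C _ p(1)] p(2) by auto
  have "g \<notin> R" using away p by blast
  have gR: "g \<in> R2 \<union> R3"
  proof (rule ccontr)
    assume "g \<notin> R2 \<union> R3"
    then have n: "g \<notin> R2" "g \<notin> R3" by auto
    have "d1 p = d1 q" by (rule edge_free(1)[OF gE \<open>g \<notin> R1\<close> n q(1)])
    moreover have "(c p = sg p) = (c q = sg q)" by (rule tau_free[OF R gE \<open>g \<notin> R1\<close> n \<open>g \<notin> R\<close> q(1)])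
    ultimately show False using qY q(2) p(2) by auto
  qed
  then have "\<not> d1 q" using edge_R2(3)[OF _ q(1)] edge_R3(3)[OF _ q(1)] p(2) by auto
  then show ?thesis using that[OF gR q(1)] p(2) by auto
qed

text \<open>By \<open>C_cut\<close> only edges of \<open>R2\<close> and \<open>R3\<close> leave the
  set, and a matching containing \<open>R1\<close> has none.\<close>

lemma C_even:
  assumes C: "C_type G c1 c2 c3"
    and R: "doublet G R c" and away: "\<forall>g\<in>R. \<forall>z\<in>ends G g. \<not> d1 z"
  shows "even (card {z \<in> verts G. d1 z \<and> c z = sg z})"
proof -
  let ?Y = "{z \<in> verts G. d1 z \<and> c z = sg z}"
  obtain M where M: "perfect_matching G M" "R1 \<subseteq> M" using matching_with_R1 .
  have "g \<notin> edge_cut G ?Y" if "g \<in> M" for g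
    using C_cut[OF C R away, of g] excl(1)[OF M] that by blast
  then have "M \<inter> edge_cut G ?Y = {}" by blast
  moreover have "?Y \<subseteq> verts G" by auto
  ultimately show ?thesis using perfect_matching_parity[OF G M(1), of ?Y] by simp
qed

text \<open>Otherwise exactly one of the two edges of \<open>R2\<close> leaves \<open>?Y\<close>,
  and a matching containing \<open>R2\<close> contradicts \<open>C_even\<close>.\<close>

lemma C_pair:
  assumes C: "C_type G c1 c2 c3"
    and R: "doublet G R c" and away: "\<forall>g\<in>R. \<forall>z\<in>ends G g. \<not> d1 z"
    and a: "a \<in> R2" "x \<in> ends G a" "d1 x" "c x = sg x" and b: "b \<in> R2" "y \<in> ends G b" "d1 y"
  shows "c y = sg y"
proof (rule ccontr)
  assume n: "c y \<noteq> sg y"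
  let ?Y = "{z \<in> verts G. d1 z \<and> c z = sg z}"
  have aE: "a \<in> edges G" and bE: "b \<in> edges G" using a b sub by auto
  obtain x' where x': "ends G a = {x, x'}" using loopless_other_end[OF G aE a(2)] .
  obtain y' where y': "ends G b = {y, y'}" using loopless_other_end[OF G bE b(2)] .
  have nd: "\<not> d1 x'" "\<not> d1 y'" using edge_R2(3)[OF a(1) x'] edge_R2(3)[OF b(1) y'] a b by auto
  have "a \<noteq> b" using x' b nd n a by auto
  then have R2: "R2 = {a, b}" using doublet2 a(1) b(1) by (auto simp: doublet_def)
  interpret r: doublet_triple G R2 R3 R1 c2 c3 c1 by (rule rotate)
  obtain M where M: "perfect_matching G M" "R2 \<subseteq> M" using r.matching_with_R1 .
  have "g = a" if g: "g \<in> M" "g \<in> edge_cut G ?Y" for g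
  proof -
    obtain p q where pq: "g \<in> R2 \<union> R3" "ends G g = {p, q}" "p \<in> verts G" "d1 p" "c p = sg p" "\<not> d1 q"
      using C_cut[OF C R away g(2)] by blast
    have "g \<in> R2" using pq(1) excl(2)[OF M] g(1) by blast
    moreover have "g \<noteq> b"
    proof
      assume "g = b"
      then have "p = y" using pq y' nd by auto
      then show False using pq n by simp
    qed
    ultimately show ?thesis using R2 by simp
  qed
  moreover have "a \<in> edge_cut G ?Y"
    using in_edge_cut_doubleton[OF aE x'] in_verts[OF aE a(2)] a nd by auto
  ultimately have "M \<inter> edge_cut G ?Y = {a}" using M(2) a(1) by blast
  moreover have "?Y \<subseteq> verts G" by auto
  ultimately have "odd (card ?Y)" using perfect_matching_parity[OF G M(1), of ?Y] by simp
  then show False using C_even[OF C R away] by simp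
qed

text \<open>If the values differed, connectedness without \<open>R2\<close> would give an edge of
  \<open>R3\<close> leaving \<open>?Y\<close>, and \<open>C_pair\<close> for \<open>R3\<close> would
  carry its value to \<open>y\<close>.\<close>

lemma C_link:
  assumes C: "C_type G c1 c2 c3"
    and R: "doublet G R c" and away: "\<forall>g\<in>R. \<forall>z\<in>ends G g. \<not> d1 z"
    and a: "a \<in> R2" "x \<in> ends G a" "d1 x" "c x = sg x" and b: "b \<in> R3" "y \<in> ends G b" "d1 y"
  shows "c y = sg y"
proof (rule ccontr)
  assume n: "c y \<noteq> sg y"
  let ?Y = "{z \<in> verts G. d1 z \<and> c z = sg z}"
  interpret s: doublet_triple G R2 R1 R3 c2 c1 c3 by (rule swap)
  interpret sw: doublet_triple G R1 R3 R2 c1 c3 c2 by (rule s.rotate)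
  have seq: "sw.sg x = sg x" "sw.d1 x = d1 x" for x
    by (auto simp: sw.sg_def sg_def sw.d1_def d1_def)
  have C': "C_type G c1 c3 c2" using C unfolding C_type_def by blast
  have aE: "a \<in> edges G" and bE: "b \<in> edges G" using a b sub by auto
  have xV: "x \<in> verts G" "x \<in> ?Y" using in_verts[OF aE a(2)] a by auto
  have yV: "y \<in> verts G" "y \<notin> ?Y" using in_verts[OF bE b(2)] n by auto
  obtain g where g: "g \<in> edge_cut G ?Y" "g \<notin> R2"
    using matching_covered_delete_crossing[OF doubletD(2)[OF doublet2] xV(1) yV(1) xV(2) yV(2)] .
  obtain p q where pq: "g \<in> R2 \<union> R3" "ends G g = {p, q}" "p \<in> verts G" "d1 p" "c p = sg p" "\<not> d1 q"
    using C_cut[OF C R away g(1)] by blast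
  have "g \<in> R3" "p \<in> ends G g" using pq g(2) by auto
  then show False using sw.C_pair[OF C' R, unfolded seq, OF away _ _ pq(4,5) b] n by blast
qed

lemma C_link_eq:
  assumes C: "C_type G c1 c2 c3"
    and R: "doublet G R c" and away: "\<forall>g\<in>R. \<forall>z\<in>ends G g. \<not> d1 z"
    and a: "a \<in> R2" "x \<in> ends G a" "d1 x" and b: "b \<in> R3" "y \<in> ends G b" "d1 y"
  shows "(c x = sg x) = (c y = sg y)"
proof -
  interpret s: doublet_triple G R2 R1 R3 c2 c1 c3 by (rule swap)
  interpret sw: doublet_triple G R1 R3 R2 c1 c3 c2 by (rule s.rotate)
  have seq: "sw.sg x = sg x" "sw.d1 x = d1 x" for x
    by (auto simp: sw.sg_def sg_def sw.d1_def d1_def)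
  have C': "C_type G c1 c3 c2" using C unfolding C_type_def by blast
  have "c x = sg x \<Longrightarrow> c y = sg y" using C_link[OF C R away a _ b] by blast
  moreover have "c y = sg y \<Longrightarrow> c x = sg x"
    using sw.C_link[OF C' R, unfolded seq, OF away b _ a] by blast
  ultimately show ?thesis by blast
qed

text \<open>In the classes of \<open>d1\<close> and \<open>d2\<close>, free of \<open>R\<close>, all
  ends of doublet edges have one value of \<open>\<tau>\<close>, and the two values are opposite
  because \<open>R3\<close> joins these classes. This permits a set that contains \<open>R1\<close>,
  avoids \<open>R2\<close> and is left only by \<open>R3\<close> and \<open>R\<close>.\<close>

lemma C_no_other_doublet_d3:
  assumes C: "C_type G c1 c2 c3"
    and R: "doublet G R c" and disj: "R \<inter> (R1 \<union> R2 \<union> R3) = {}"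
    and d3R: "\<And>g z. g \<in> R \<Longrightarrow> z \<in> ends G g \<Longrightarrow> d3 z"
  shows False
proof -
  interpret r: doublet_triple G R2 R3 R1 c2 c3 c1 by (rule rotate)
  interpret rr: doublet_triple G R3 R1 R2 c3 c1 c2 by (rule r.rotate)
  have req: "r.sg x = sg x" "rr.sg x = sg x" "r.d1 x = d2 x" "rr.d1 x = d3 x" for x
    unfolding r.sg_def rr.sg_def sg_def r.d1_def rr.d1_def d2_def d3_def by auto
  note C' = C_type_rotate[OF C]
  note C'' = r.C_type_rotate[OF C']
  have disj': "R \<inter> (R2 \<union> R3 \<union> R1) = {}" "R \<inter> (R3 \<union> R1 \<union> R2) = {}" using disj by blast+
  have V: "e \<in> edges G" "x \<in> verts G" if "e \<in> R1 \<union> R2 \<union> R3 \<union> R" "x \<in> ends G e" for e x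
  proof -
    show "e \<in> edges G" using that sub doubletD(3)[OF R] by blast
    then show "x \<in> verts G" using in_verts that(2) by blast
  qed
  have "\<not> d1 z \<and> \<not> d2 z" if "g \<in> R" "z \<in> ends G g" for g z
    using d3R[OF that] C_unique(3)[OF C V(2)[OF _ that(2)]] that(1) by blast
  then have away: "\<forall>g\<in>R. \<forall>z\<in>ends G g. \<not> d1 z" "\<forall>g\<in>R. \<forall>z\<in>ends G g. \<not> d2 z" by blast+
  have nd: "e \<in> R1 \<Longrightarrow> x \<in> ends G e \<Longrightarrow> \<not> d1 x" "e \<in> R2 \<Longrightarrow> x \<in> ends G e \<Longrightarrow> \<not> d2 x"
    "e \<in> R3 \<Longrightarrow> x \<in> ends G e \<Longrightarrow> \<not> d3 x" for e x
    using C_R1[OF C] r.C_R1[OF C'] rr.C_R1[OF C''] unfolding req by blast+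
  define \<tau> where "\<tau> x = (c x = sg x)" for x
  obtain e3 where e3: "e3 \<in> R3" using nonempty by auto
  obtain p3 q3 where pq3: "ends G e3 = {p3, q3}" "d1 p3" "\<not> d1 q3"
  proof -
    have "e3 \<in> edges G" using e3 sub by auto
    then obtain x y where xy: "ends G e3 = {x, y}" using loopless_ends[OF G] by metis
    then have "ends G e3 = {y, x}" by auto
    then show ?thesis using that[of x y] that[of y x] xy edge_R3(3)[OF e3 xy] by blast
  qed
  have q3: "q3 \<in> ends G e3" using pq3 by simp
  have "q3 \<in> verts G" using V(2)[OF _ q3] e3 by blast
  then have d2q3: "d2 q3" using C_unique[OF C, of q3] nd(3)[OF e3 q3] pq3(3) by blast
  define t where "t = \<tau> p3"
  have tq3: "\<tau> q3 = (\<not> t)"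
    using rr.tau_R1[OF R disj'(2) e3 pq3(1)] unfolding req t_def \<tau>_def by blast
  have R2t: "\<tau> x = t" if "e \<in> R2" "x \<in> ends G e" "d1 x" for e x
    using C_link_eq[OF C R away(1) that e3 _ pq3(2)] pq3 unfolding t_def \<tau>_def by auto
  have R1t: "\<tau> x = (\<not> t)" if "e \<in> R1" "x \<in> ends G e" "d2 x" for e x
    using r.C_link_eq[OF C' R, unfolded req, OF away(2) e3 _ d2q3 that] pq3 tq3 unfolding \<tau>_def by auto
  \<comment> \<open>Along \<open>R1\<close> and \<open>R2\<close> the value of \<open>\<tau>\<close>
    changes, so they reach the class of \<open>d3\<close> at \<open>t\<close> and at its negation
    respectively; the chosen half of that class separates them. An exchange along \<open>Z\<close>
    then produces a matching containing both \<open>R1\<close> and \<open>R2\<close>.\<close>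
  define Z where "Z = {z \<in> verts G. d2 z \<or> d3 z \<and> \<tau> z = t}"
  have R1Z: "x \<in> Z" if e: "e \<in> R1" "x \<in> ends G e" for e x
  proof (cases "d2 x")
    case True
    then show ?thesis using V(2)[of e x] e by (auto simp: Z_def)
  next
    case False
    have eE: "e \<in> edges G" using e sub by auto
    obtain y where y: "ends G e = {x, y}" using loopless_other_end[OF G eE e(2)] .
    have "d2 y" using edge_R1(3)[OF e(1) y] False by simp
    then have "\<tau> y = (\<not> t)" using R1t[OF e(1)] y by auto
    then have "\<tau> x = t" using tau_R1[OF R disj e(1) y] unfolding \<tau>_def by blast
    moreover have "d3 x" using C_unique[OF C V(2)[of e x]] e False nd(1) by blast
    ultimately show ?thesis using V(2)[of e x] e by (auto simp: Z_def)
  qed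
  have R2Z: "x \<notin> Z" if e: "e \<in> R2" "x \<in> ends G e" for e x
  proof (cases "d1 x")
    case True
    have "x \<in> verts G" using V(2)[OF _ e(2)] e(1) by blast
    then have "\<not> d2 x" "\<not> d3 x" using C_unique(1)[OF C] True by blast+
    then show ?thesis by (simp add: Z_def)
  next
    case False
    have eE: "e \<in> edges G" using e sub by auto
    obtain y where y: "ends G e = {x, y}" using loopless_other_end[OF G eE e(2)] .
    have "d1 y" using edge_R2(3)[OF e(1) y] False by simp
    then have "\<tau> y = t" using R2t[OF e(1)] y by auto
    then have "\<tau> x \<noteq> t" using r.tau_R1[OF R disj'(1) e(1) y] unfolding \<tau>_def req by blast
    moreover have "\<not> d2 x" using nd(2)[OF e] .
    ultimately show ?thesis by (auto simp: Z_def)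
  qed
  have cutZ: "edge_cut G Z \<subseteq> R3 \<union> R"
  proof
    fix g assume g: "g \<in> edge_cut G Z"
    then have gE: "g \<in> edges G" by (auto simp: edge_cut_def)
    obtain x y where xy: "ends G g = {x, y}" "x \<in> verts G" "y \<in> verts G" using loopless_ends[OF G gE] .
    have c: "(x \<in> Z) \<noteq> (y \<in> Z)" using g in_edge_cut_doubleton[OF gE xy(1)] by simp
    have "g \<notin> R1" using R1Z xy(1) c by blast
    moreover have "g \<notin> R2" using R2Z xy(1) c by blast
    ultimately show "g \<in> R3 \<union> R"
      using edge_free(2,3)[OF gE _ _ _ xy(1)] tau_free[OF R gE _ _ _ _ xy(1)] c xy(2,3)
      by (auto simp: Z_def \<tau>_def)
  qed
  have without: "\<exists>M. perfect_matching G M \<and> M \<inter> R = {} \<and> g \<in> M" if "g \<in> R1 \<union> R2 \<union> R3" for g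
  proof -
    have "g \<in> edges G" "g \<notin> R" using that sub disj by auto
    then show ?thesis using matching_covered_delete_edge[OF doubletD(2)[OF R]] by metis
  qed
  obtain g1 g2 where g: "g1 \<in> R1" "g2 \<in> R2" using nonempty by blast
  obtain M1 where M1: "perfect_matching G M1" "M1 \<inter> R = {}" "g1 \<in> M1" using without[of g1] g by auto
  obtain M2 where M2: "perfect_matching G M2" "M2 \<inter> R = {}" "g2 \<in> M2" using without[of g2] g by auto
  have "R1 \<subseteq> M1" "R2 \<subseteq> M2" using all_or_none[OF M1(1)] all_or_none[OF M2(1)] M1(3) M2(3) g by blast+
  then have "R3 \<inter> M1 = {}" "R3 \<inter> M2 = {}" using excl(1)[OF M1(1)] excl(2)[OF M2(1)] by simp_all
  then have "M1 \<inter> (R3 \<union> R) = {}" "M2 \<inter> (R3 \<union> R) = {}" using M1(2) M2(2) by auto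
  then have "M1 \<inter> edge_cut G Z = {}" "M2 \<inter> edge_cut G Z = {}" using cutZ by auto
  then have "M1 \<inter> edge_cut G Z = M2 \<inter> edge_cut G Z" by simp
  then have S: "perfect_matching G (splice G Z M1 M2)" by (rule splice_perfect_matching[OF G M1(1) M2(1)])
  have "ends G g1 \<noteq> {}" using ends_nonempty[OF G] g sub by blast
  then have "ends G g1 \<inter> Z \<noteq> {}" using R1Z[OF g(1)] by blast
  then have "g1 \<in> splice G Z M1 M2" using M1(3) by (simp add: splice_meets)
  moreover have "ends G g2 \<inter> Z = {}" using R2Z[OF g(2)] by blast
  then have "g2 \<in> splice G Z M1 M2" using M2(3) by (simp add: splice_avoids)
  ultimately have "R1 \<subseteq> splice G Z M1 M2" "R2 \<inter> splice G Z M1 M2 \<noteq> {}"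
    using all_or_none(1)[OF S] g by auto
  then show False using excl(1)[OF S] by simp
qed

lemma C_no_other_doublet:
  assumes C: "C_type G c1 c2 c3"
    and R: "doublet G R c" and disj: "R \<inter> (R1 \<union> R2 \<union> R3) = {}"
  shows False
proof -
  interpret r: doublet_triple G R2 R3 R1 c2 c3 c1 by (rule rotate)
  interpret rr: doublet_triple G R3 R1 R2 c3 c1 c2 by (rule r.rotate)
  have req: "r.d1 x = d2 x" "rr.d1 x = d3 x" "r.d3 x = d1 x" "rr.d3 x = d2 x" for x
    unfolding r.d1_def rr.d1_def d2_def d3_def d1_def r.d3_def rr.d3_def by auto
  note C' = C_type_rotate[OF C]
  note C'' = r.C_type_rotate[OF C']
  have disj': "R \<inter> (R2 \<union> R3 \<union> R1) = {}" "R \<inter> (R3 \<union> R1 \<union> R2) = {}" using disj by blast+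
  obtain a where a: "a \<in> R" using R by (auto simp: doublet_def)
  then have aE: "a \<in> edges G" using doubletD(3)[OF R] by auto
  obtain w where w: "w \<in> ends G a" using ends_nonempty[OF G aE] by auto
  have same: "d1 z = d1 w" "d2 z = d2 w" "d3 z = d3 w" if "g \<in> R" "z \<in> ends G g" for g z
    using doublet_ends_same_d1[OF R disj that a w] r.doublet_ends_same_d1[OF R disj'(1) that a w]
      rr.doublet_ends_same_d1[OF R disj'(2) that a w] by (simp_all add: req)
  have "d1 w \<or> d2 w \<or> d3 w" using d_rel(1)[of w] by blast
  then show False
    using C_no_other_doublet_d3[OF C R disj] r.C_no_other_doublet_d3[OF C' R disj'(1)]
      rr.C_no_other_doublet_d3[OF C'' R disj'(2)] same unfolding req by blast
qed

lemma no_other_doublet: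
  assumes "K_type G R1 R2 R3 c1 c2 c3 \<or> C_type G c1 c2 c3" and R: "doublet G R c"
  shows "R = R1 \<or> R = R2 \<or> R = R3"
proof (rule ccontr)
  assume n: "\<not> ?thesis"
  then have "R \<inter> (R1 \<union> R2 \<union> R3) = {}"
    using doublets_equal[OF R doublet1] doublets_equal[OF R doublet2] doublets_equal[OF R doublet3] by blast
  then show False using assms K_no_other_doublet C_no_other_doublet by blast
qed

end

section \<open>Recognizing the two exceptions\<close>

text \<open>The edge map is onto \<open>E'\<close> by assumption; the bound on the number of edges
  makes it injective, which excludes parallel edges.\<close>

lemma graph_iso_simple:
  assumes "bij_betw f (verts G) V'" "(\<lambda>e. f ` ends G e) ` edges G = E'" "finite (edges G)" "card (edges G) \<le> card E'"
  shows "graph_iso G (simple_graph V' E')"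
proof -
  have "card ((\<lambda>e. f ` ends G e) ` edges G) = card (edges G)"
    using assms(2-4) card_image_le[OF assms(3), of "\<lambda>e. f ` ends G e"] by simp
  then have "inj_on (\<lambda>e. f ` ends G e) (edges G)" using assms(3) by (intro eq_card_imp_inj_on)
  then have "bij_betw (\<lambda>e. f ` ends G e) (edges G) E'" using assms(2) by (simp add: bij_betw_def)
  then show ?thesis using assms(1) unfolding graph_iso_def simple_graph_def
    by (intro exI[of _ f] exI[of _ "\<lambda>e. f ` ends G e"]) auto
qed

lemma complete_graph_iso:
  assumes G: "loopless_multigraph G" and inj: "inj_on (ends G) (edges G)"
    and n: "card (verts G) = n" and E: "card (edges G) = n choose 2"
  shows "graph_iso G (complete_graph n)"
  unfolding complete_graph_def
proof -
  have fin: "finite (verts G)" "finite (edges G)" using G by (auto simp: loopless_multigraph_def)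
  obtain f where f: "bij_betw f (verts G) {..<n}"
    using fin(1) n by (metis card_lessThan finite_lessThan finite_same_card_bij)
  let ?g = "\<lambda>e. f ` ends G e"
  have sub: "?g e \<in> vertex_pairs {..<n}" if e: "e \<in> edges G" for e
  proof -
    have "ends G e \<subseteq> verts G" "card (ends G e) = 2" using G e by (auto simp: loopless_multigraph_def)
    moreover have "inj_on f (ends G e)" using f calculation(1) by (auto simp: bij_betw_def intro: inj_on_subset)
    ultimately show ?thesis using f by (auto simp: vertex_pairs_def bij_betw_def card_image)
  qed
  have "inj_on ?g (edges G)"
  proof (rule inj_onI)
    fix e e' assume e: "e \<in> edges G" "e' \<in> edges G" "?g e = ?g e'"
    then have "ends G e \<subseteq> verts G" "ends G e' \<subseteq> verts G" using G by (auto simp: loopless_multigraph_def)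
    then have "ends G e = ends G e'" using e(3) f by (metis bij_betw_def inj_on_image_eq_iff)
    then show "e = e'" using inj e by (auto simp: inj_on_def)
  qed
  then have c: "card (?g ` edges G) = card (edges G)" by (rule card_image)
  have fv: "finite (vertex_pairs {..<n})" by (rule finite_subset[of _ "Pow {..<n}"]) (auto simp: vertex_pairs_def)
  have cv: "card (vertex_pairs {..<n}) = n choose 2"
    using n_subsets[of "{..<n}" 2] by (simp add: vertex_pairs_def)
  have "?g ` edges G = vertex_pairs {..<n}"
    using sub c cv E by (intro card_subset_eq[OF fv]) auto
  then show "graph_iso G (simple_graph {..<n} (vertex_pairs {..<n}))"
    using graph_iso_simple[OF f] fin(2) E cv by simp
qed

lemma vertex_pairs_less:
  "vertex_pairs A = {e. \<exists>x\<in>A. \<exists>y\<in>A. x < y \<and> e = {x, y}}" for A :: "nat set"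
proof (intro equalityI subsetI)
  fix e assume "e \<in> vertex_pairs A"
  then have "e \<subseteq> A" "card e = 2" by (auto simp: vertex_pairs_def)
  then obtain x y where xy: "e = {x, y}" "x \<in> A" "y \<in> A" "x \<noteq> y" by (auto simp: card_2_iff)
  have "x < y \<or> y < x \<and> e = {y, x}" using xy by auto
  then show "e \<in> {e. \<exists>x\<in>A. \<exists>y\<in>A. x < y \<and> e = {x, y}}" using xy by blast
qed (auto simp: vertex_pairs_def)

lemma prism_edges:
  "vertex_pairs {..<6::nat} - {{i, Suc i mod 6} | i. i < 6} =
    {{0, 2}, {2, 4}, {0, 4}, {3, 5}, {1, 5}, {1, 3}, {0, 3}, {2, 5}, {1, 4}}" (is "?L = ?R")
proof -
  have six: "{..<6::nat} = {0, 1, 2, 3, 4, 5}" by auto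
  have cyc: "{{i, Suc i mod 6} | i. i < (6::nat)} = {{0, 1}, {1, 2}, {2, 3}, {3, 4}, {4, 5}, {0, 5}}"
  proof -
    have "{{i, Suc i mod 6} | i. i < (6::nat)} = (\<lambda>i. {i, (i + 1) mod 6}) ` {..<6}" by auto
    also have "\<dots> = {{0, 1}, {1, 2}, {2, 3}, {3, 4}, {4, 5}, {5, 0}}"
      unfolding six image_insert image_empty by (simp del: One_nat_def)
    finally show ?thesis by (simp only: insert_commute[of 5 0])
  qed
  have explicit: "vertex_pairs {..<6::nat} = {{0, 1}, {0, 2}, {0, 3}, {0, 4}, {0, 5}, {1, 2}, {1, 3}, {1, 4}, {1, 5}, {2, 3}, {2, 4}, {2, 5}, {3, 4}, {3, 5}, {4, 5}}"
    unfolding vertex_pairs_less six by (rule set_eqI) simp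
  have diff: "A - C = R" if "C \<inter> R = {}" "A = C \<union> R" for A C R :: "nat set set"
    using that by auto
  have "{{0, 1}, {1, 2}, {2, 3}, {3, 4}, {4, 5}, {0, 5::nat}} \<inter> ?R = {}"
    by (simp add: doubleton_eq_iff)
  moreover have "vertex_pairs {..<6} = {{0, 1}, {1, 2}, {2, 3}, {3, 4}, {4, 5}, {0, 5::nat}} \<union> ?R"
    unfolding explicit by (simp only: Un_insert_left Un_empty_left insert_commute)
  ultimately show ?thesis unfolding cyc by (rule diff)
qed

lemma prism_iso:
  assumes V: "verts G = {p1, p2, p3, q1, q2, q3}" and dist: "distinct [p1, p2, p3, q1, q2, q3]"
    and E: "edges G = {a1, a2, a3, b1, b2, b3, m1, m2, m3}"
    and a: "ends G a1 = {p2, p3}" "ends G a2 = {p1, p3}" "ends G a3 = {p1, p2}"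
    and b: "ends G b1 = {q2, q3}" "ends G b2 = {q1, q3}" "ends G b3 = {q1, q2}"
    and m: "ends G m1 = {p1, q1}" "ends G m2 = {p2, q2}" "ends G m3 = {p3, q3}"
  shows "graph_iso G (complement_graph (cycle_graph 6))"
proof -
  \<comment> \<open>In the complement of the 6-cycle the even and the odd residues form the
    triangles and \<open>i\<close> is opposite to \<open>i + 3\<close>. Hence 0, 2, 4 for
    \<open>p1\<close>, \<open>p2\<close>, \<open>p3\<close> and 3, 5, 1 for their partners.\<close>
  define f :: "'a \<Rightarrow> nat" where "f x = (if x = p1 then 0 else if x = p2 then 2 else if x = p3 then 4
    else if x = q1 then 3 else if x = q2 then 5 else 1)" for x
  have f: "f p1 = 0" "f p2 = 2" "f p3 = 4" "f q1 = 3" "f q2 = 5" "f q3 = 1"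
    using dist by (auto simp: f_def)
  have bij: "bij_betw f (verts G) {..<6}"
  proof -
    have "f ` verts G = {0, 2, 4, 3, 5, 1}" unfolding V by (simp add: f)
    also have "\<dots> = {..<6}" by auto
    finally have im: "f ` verts G = {..<6}" .
    have "card (verts G) = 6" unfolding V using dist by simp
    moreover have "finite (verts G)" unfolding V by simp
    ultimately have "inj_on f (verts G)" using im by (intro eq_card_imp_inj_on) simp_all
    then show ?thesis using im by (simp add: bij_betw_def)
  qed
  have "(\<lambda>e. f ` ends G e) ` edges G = {{0, 2}, {2, 4}, {0, 4}, {3, 5}, {1, 5}, {1, 3}, {0, 3}, {2, 5}, {1, 4}}"
    unfolding E by (simp add: a b m f insert_commute) (simp add: insert_commute)?
  moreover have "finite (edges G)" unfolding E by simp
  moreover have "card (edges G) \<le> 9" unfolding E by (auto intro!: card_insert_le_m1)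
  moreover have "card {{0, 2}, {2, 4}, {0, 4}, {3, 5}, {1, 5}, {1, 3}, {0, 3}, {2, 5}, {1, 4::nat}} = 9"
    by (simp add: doubleton_eq_iff)
  ultimately have "graph_iso G (simple_graph {..<6} {{0, 2::nat}, {2, 4}, {0, 4}, {3, 5}, {1, 5}, {1, 3}, {0, 3}, {2, 5}, {1, 4}})"
    using graph_iso_simple[OF bij] by simp
  then show ?thesis unfolding complement_graph_def cycle_graph_def prism_edges[symmetric] by (simp add: simple_graph_def)
qed

text \<open>Records what \<open>doublet_matched_with_edge\<close> yields at a vertex. The forced
  edge \<open>e\<close> need not belong to \<open>R\<close>.\<close>

definition linked :: "('v, 'e) mgraph \<Rightarrow> 'v \<Rightarrow> 'e \<Rightarrow> 'e set \<Rightarrow> bool" where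
  "linked G u e R \<longleftrightarrow> e \<in> edges G \<and> u \<in> ends G e \<and> (\<exists>c. doublet G R c) \<and>
     (\<forall>M. perfect_matching G M \<and> R \<subseteq> M \<longrightarrow> e \<in> M)"

definition linked_at :: "('v, 'e) mgraph \<Rightarrow> 'e set \<Rightarrow> 'e set \<Rightarrow> 'e set \<Rightarrow> 'v \<Rightarrow> bool" where
  "linked_at G R1 R2 R3 u \<longleftrightarrow> (\<exists>e1 e2 e3. e1 \<noteq> e2 \<and> e1 \<noteq> e3 \<and> e2 \<noteq> e3 \<and>
     linked G u e1 R1 \<and> linked G u e2 R2 \<and> linked G u e3 R3)"

lemma linked_at_rotate: "linked_at G R1 R2 R3 u \<Longrightarrow> linked_at G R2 R3 R1 u"
  unfolding linked_at_def by metis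

lemma linked_at_swap: "linked_at G R1 R2 R3 u \<Longrightarrow> linked_at G R1 R3 R2 u"
  unfolding linked_at_def by metis

lemma linkedD:
  assumes "linked G u e R"
  shows "e \<in> edges G" "u \<in> ends G e" "\<And>M. perfect_matching G M \<Longrightarrow> R \<subseteq> M \<Longrightarrow> e \<in> M"
  using assms by (auto simp: linked_def)

context doublet_triple
begin

text \<open>Every edge has an end of high degree, where all edges belong to the doublets. So the
  doublets are the whole edge set, and a perfect matching containing \<open>R1\<close> is
  \<open>R1\<close> itself: six edges on four vertices. Colours and signs tell parallel edges
  apart.\<close>

lemma K_complete:
  assumes K: "K_type G R1 R2 R3 c1 c2 c3"
    and at: "\<And>u. u \<in> verts G \<Longrightarrow> 3 \<le> vertex_degree G u \<Longrightarrow> linked_at G R1 R2 R3 u"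
    and high: "\<And>e. e \<in> edges G \<Longrightarrow> \<exists>u\<in>ends G e. 3 \<le> vertex_degree G u"
  shows "graph_iso G (complete_graph 4)"
proof (rule complete_graph_iso[OF G])
  interpret r: doublet_triple G R2 R3 R1 c2 c3 c1 by (rule rotate)
  interpret rr: doublet_triple G R3 R1 R2 c3 c1 c2 by (rule r.rotate)
  note K' = K_type_rotate[OF K]
  note K'' = r.K_type_rotate[OF K']
  have E: "edges G = R1 \<union> R2 \<union> R3"
  proof
    show "R1 \<union> R2 \<union> R3 \<subseteq> edges G" using sub by blast
    show "edges G \<subseteq> R1 \<union> R2 \<union> R3"
    proof
      fix f assume f: "f \<in> edges G"
      then obtain u where u: "u \<in> ends G f" "3 \<le> vertex_degree G u" using high by blast
      have "u \<in> verts G" using in_verts f u by blast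
      then obtain e1 e2 e3 where ne: "e1 \<noteq> e2" "e1 \<noteq> e3" "e2 \<noteq> e3"
        and l: "linked G u e1 R1" "linked G u e2 R2" "linked G u e3 R3"
        using at u(2) unfolding linked_at_def by blast
      note l1 = linkedD[OF l(1)] and l2 = linkedD[OF l(2)] and l3 = linkedD[OF l(3)]
      have "f = e1 \<or> f = e2 \<or> f = e3" by (rule K_edges_at[OF K l1(2) l2(2) l3(2) l1(3) l2(3) l3(3) f u(1)])
      moreover have "e1 \<in> R1" by (rule K_edge_in_doublet[OF K l1(1,2) l2(2) l3(2) ne(1,2) l2(3) l3(3)])
      moreover have "e2 \<in> R2" by (rule r.K_edge_in_doublet[OF K' l2(1,2) l3(2) l1(2) ne(3) ne(1)[symmetric] l3(3) l1(3)])
      moreover have "e3 \<in> R3" by (rule rr.K_edge_in_doublet[OF K'' l3(1,2) l1(2) l2(2) ne(2,3)[symmetric] l1(3) l2(3)])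
      ultimately show "f \<in> R1 \<union> R2 \<union> R3" by blast
    qed
  qed
  have two: "card R1 = 2" "card R2 = 2" "card R3 = 2"
    using doublet1 doublet2 doublet3 by (auto simp: doublet_def)
  then have fin: "finite R1" "finite R2" "finite R3" by (auto intro: card_ge_0_finite)
  have "card (R1 \<union> R2 \<union> R3) = card (R1 \<union> R2) + card R3"
    using fin disjoint13 disjoint23 by (intro card_Un_disjoint) auto
  also have "card (R1 \<union> R2) = card R1 + card R2" using fin disjoint12 by (intro card_Un_disjoint) auto
  finally show "card (edges G) = 4 choose 2" using two E by (simp add: choose_two)
  obtain M where M: "perfect_matching G M" "R1 \<subseteq> M" using matching_with_R1 .
  have "M = R1" using M(2) perfect_matching_subset[OF M(1)] excl(1)[OF M] E by blast
  then show "card (verts G) = 4" using perfect_matching_card[OF G M(1)] two by simp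
  show "inj_on (ends G) (edges G)"
  proof (rule inj_onI)
    fix e f assume ef: "e \<in> edges G" "f \<in> edges G" "ends G e = ends G f"
    obtain x y where xy: "ends G e = {x, y}" using loopless_ends[OF G ef(1)] .
    then have xy': "ends G f = {x, y}" using ef by simp
    have same: "e = f" if s: "e \<in> R" "f \<in> R" "doublet G R c" for R c
    proof -
      obtain a b where "R = {a, b}" "\<forall>x\<in>ends G a. c x" "\<forall>x\<in>ends G b. \<not> c x"
        using s(3) by (auto simp: doublet_def)
      then show ?thesis using s(1,2) xy xy' by auto
    qed
    consider "e \<in> R1" "f \<in> R1" | "e \<in> R2" "f \<in> R2" | "e \<in> R3" "f \<in> R3" | "e \<in> R1" "f \<in> R2 \<union> R3"
      | "e \<in> R2" "f \<in> R1 \<union> R3" | "e \<in> R3" "f \<in> R1 \<union> R2"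
      using ef E by blast
    then show "e = f"
    proof cases
      case 1
      then show ?thesis using same doublet1 by blast
    next
      case 2
      then show ?thesis using same doublet2 by blast
    next
      case 3
      then show ?thesis using same doublet3 by blast
    next
      case 4
      then show ?thesis using edge_R1(2)[OF _ xy] edge_R2(3)[OF _ xy'] edge_R3(3)[OF _ xy'] by blast
    next
      case 5
      then show ?thesis using edge_R2(2)[OF _ xy] edge_R1(3)[OF _ xy'] edge_R3(4)[OF _ xy'] by blast
    next
      case 6
      then show ?thesis using edge_R3(2)[OF _ xy] edge_R1(4)[OF _ xy'] edge_R2(4)[OF _ xy'] by blast
    qed
  qed
qed

end

section \<open>Reconstructing the prism class by class\<close>

context doublet_triple
begin

lemma swap23: "doublet_triple G R1 R3 R2 c1 c3 c2"
proof -
  interpret s: doublet_triple G R2 R1 R3 c2 c1 c3 by (rule swap)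
  show ?thesis by (rule s.rotate)
qed

lemma d1_same:
  assumes "e \<in> edges G" "e \<notin> R2" "e \<notin> R3" "ends G e = {x, y}"
  shows "d1 x = d1 y"
  using edge_free(1)[OF assms(1) _ assms(2,3,4)] edge_R1(2)[OF _ assms(4)] by blast

text \<open>In the class of \<open>d1\<close> the edges forced by \<open>R2\<close> and
  \<open>R3\<close> belong to these doublets, and there is at most one further edge
  \<open>e1\<close>.\<close>

lemma C_vertex:
  assumes C: "C_type G c1 c2 c3" and u: "u \<in> verts G" "d1 u" and at: "linked_at G R1 R2 R3 u"
  obtains e1 e2 e3 where "e2 \<in> R2" "u \<in> ends G e2" "e3 \<in> R3" "u \<in> ends G e3"
    "\<And>f. f \<in> edges G \<Longrightarrow> u \<in> ends G f \<Longrightarrow> f = e1 \<or> f = e2 \<or> f = e3"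
    "\<And>M. perfect_matching G M \<Longrightarrow> R2 \<subseteq> M \<Longrightarrow> e2 \<in> M"
proof -
  interpret sw: doublet_triple G R1 R3 R2 c1 c3 c2 by (rule swap23)
  have C': "C_type G c1 c3 c2" using C unfolding C_type_def by blast
  have "sw.d1 u" using u(2) by (auto simp: sw.d1_def d1_def)
  obtain e1 e2 e3 where ne: "e1 \<noteq> e2" "e1 \<noteq> e3" "e2 \<noteq> e3"
    and l: "linked G u e1 R1" "linked G u e2 R2" "linked G u e3 R3"
    using at unfolding linked_at_def by blast
  note l1 = linkedD[OF l(1)] and l2 = linkedD[OF l(2)] and l3 = linkedD[OF l(3)]
  have e2: "e2 \<in> R2"
    by (rule C_edge_in_doublet[OF C u l2(1) l1(2) l2(2) l3(2) ne(1)[symmetric] ne(3) l1(3) l3(3)])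
  have e3: "e3 \<in> R3"
    by (rule sw.C_edge_in_doublet[OF C' u(1) \<open>sw.d1 u\<close> l3(1) l1(2) l3(2) l2(2) ne(2)[symmetric] ne(3)[symmetric] l1(3) l2(3)])
  have all: "f = e1 \<or> f = e2 \<or> f = e3" if f: "f \<in> edges G" "u \<in> ends G f" for f
  proof (cases "f = e1")
    case False
    obtain M where M: "perfect_matching G M" "f \<in> M" using matching_covered_edge[OF mc f(1)] .
    have "R2 \<subseteq> M \<or> R3 \<subseteq> M" by (rule C_edge_at_d1[OF C u l1(2) l1(3) f(2) False M])
    then have "e2 \<in> M \<or> e3 \<in> M" using e2 e3 by blast
    then show ?thesis
      using perfect_matching_unique[OF M(1) M(2) _ f(2) l2(2)] perfect_matching_unique[OF M(1) M(2) _ f(2) l3(2)] by blast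
  qed simp
  show ?thesis by (rule that[OF e2 l2(2) e3 l3(2) all l2(3)])
qed

lemma C_inner_edge:
  assumes w: "w \<in> verts G"
  obtains m where "m \<in> edges G" "m \<notin> R2" "m \<notin> R3" "w \<in> ends G m"
proof -
  obtain M where M: "perfect_matching G M" "R1 \<subseteq> M" using matching_with_R1 .
  obtain m where m: "m \<in> M" "w \<in> ends G m" "m \<in> edges G" using perfect_matching_covers[OF M(1) w] .
  have "m \<notin> R2" "m \<notin> R3" using excl(1)[OF M] m(1) by blast+
  then show ?thesis using that m by blast
qed

text \<open>In a matching containing \<open>R2\<close>, a partner of \<open>w\<close> within the
  class would have high degree, hence already be matched by its own edge of
  \<open>R2\<close>.\<close>

lemma C_low_vertex:
  assumes C: "C_type G c1 c2 c3"
    and at0: "\<forall>u\<in>verts G. 3 \<le> vertex_degree G u \<longrightarrow> linked_at G R1 R2 R3 u"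
    and high0: "\<forall>e\<in>edges G. \<exists>u\<in>ends G e. 3 \<le> vertex_degree G u"
    and w: "w \<in> verts G" "d1 w" "\<not> 3 \<le> vertex_degree G w"
  shows "\<exists>g\<in>R2. w \<in> ends G g"
proof -
  note at = at0[rule_format] and high = high0[rule_format]
  interpret r: doublet_triple G R2 R3 R1 c2 c3 c1 by (rule rotate)
  obtain M where M: "perfect_matching G M" "R2 \<subseteq> M" using r.matching_with_R1 .
  obtain g where g: "g \<in> M" "w \<in> ends G g" "g \<in> edges G" using perfect_matching_covers[OF M(1) w(1)] .
  have gR3: "g \<notin> R3" using excl(2)[OF M] g(1) by blast
  have "g \<in> R2"
  proof (rule ccontr)
    assume gR2: "g \<notin> R2"
    obtain u where u: "ends G g = {w, u}" "u \<in> verts G" using loopless_other_end[OF G g(3,2)] .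
    have "d1 u" using d1_same[OF g(3) gR2 gR3 u(1)] w(2) by simp
    have "3 \<le> vertex_degree G u" using high[OF g(3)] u(1) w(3) by auto
    then obtain e2 where e2: "e2 \<in> R2" "u \<in> ends G e2"
      using C_vertex[OF C u(2) \<open>d1 u\<close> at[OF u(2)]] by metis
    have "u \<in> ends G g" using u by simp
    then have "g = e2" using perfect_matching_unique[OF M(1) g(1) _ _ e2(2)] M(2) e2(1) by blast
    then show False using e2 gR2 by simp
  qed
  then show ?thesis using g(2) by blast
qed

text \<open>A vertex of low degree in the class would have edges of \<open>R2\<close> and
  \<open>R3\<close> and an inner edge, which is too many. So every vertex of the class is an end of
  one of the two edges of \<open>R2\<close>, each with one end there; the class has two vertices and
  forms a rung.\<close>

lemma C_class:
  assumes C: "C_type G c1 c2 c3"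
    and at0: "\<forall>u\<in>verts G. 3 \<le> vertex_degree G u \<longrightarrow> linked_at G R1 R2 R3 u"
    and high0: "\<forall>e\<in>edges G. \<exists>u\<in>ends G e. 3 \<le> vertex_degree G u"
  shows "\<exists>p q m. {z \<in> verts G. d1 z} = {p, q} \<and> c2 p \<and> c3 p \<and> \<not> c2 q \<and> \<not> c3 q \<and> m \<in> edges G \<and> ends G m = {p, q} \<and>
    (\<forall>f\<in>edges G. p \<in> ends G f \<or> q \<in> ends G f \<longrightarrow> f = m \<or> f \<in> R2 \<or> f \<in> R3)"
proof -
  note at = at0[rule_format]
  have at0': "\<forall>u\<in>verts G. 3 \<le> vertex_degree G u \<longrightarrow> linked_at G R1 R3 R2 u"
  proof (intro ballI impI)
    fix u assume "u \<in> verts G" "3 \<le> vertex_degree G u"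
    then show "linked_at G R1 R3 R2 u" by (rule linked_at_swap[OF at0[rule_format]])
  qed
  interpret sw: doublet_triple G R1 R3 R2 c1 c3 c2 by (rule swap23)
  have C': "C_type G c1 c3 c2" using C unfolding C_type_def by blast
  have swd: "sw.d1 x = d1 x" for x by (auto simp: sw.d1_def d1_def)
  have deg: "3 \<le> vertex_degree G w" if w: "w \<in> verts G" "d1 w" for w
  proof (rule ccontr)
    assume low: "\<not> 3 \<le> vertex_degree G w"
    obtain g where g: "g \<in> R2" "w \<in> ends G g" using C_low_vertex[OF C at0 high0 w low] by blast
    obtain h where h: "h \<in> R3" "w \<in> ends G h"
      using sw.C_low_vertex[OF C' at0' high0 w(1) _ low] w(2) swd by blast
    obtain m where m: "m \<in> edges G" "m \<notin> R2" "m \<notin> R3" "w \<in> ends G m" using C_inner_edge[OF w(1)] .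
    have "g \<noteq> h" "m \<noteq> g" "m \<noteq> h" using g h m disjoint23 by auto
    then have "card {m, g, h} = 3" by simp
    moreover have "finite {e \<in> edges G. w \<in> ends G e}" using G by (simp add: loopless_multigraph_def)
    then have "card {m, g, h} \<le> vertex_degree G w"
      unfolding vertex_degree_def using g h m sub by (intro card_mono) auto
    ultimately show False using low by simp
  qed
  obtain a b where ab: "R2 = {a, b}" "\<forall>x\<in>ends G a. c2 x" "\<forall>x\<in>ends G b. \<not> c2 x"
    using doublet2 by (auto simp: doublet_def)
  have end_in: "\<exists>x y. ends G e = {x, y} \<and> x \<in> verts G \<and> d1 x \<and> \<not> d1 y" if e: "e \<in> R2" for e
  proof -
    have eE: "e \<in> edges G" using e sub by auto
    obtain x y where xy: "ends G e = {x, y}" "x \<in> verts G" "y \<in> verts G" using loopless_ends[OF G eE] .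
    have "ends G e = {y, x}" using xy by auto
    then show ?thesis using edge_R2(3)[OF e xy(1)] xy by blast
  qed
  obtain p p' where p: "ends G a = {p, p'}" "p \<in> verts G" "d1 p" "\<not> d1 p'" using end_in[of a] ab by auto
  obtain q q' where q: "ends G b = {q, q'}" "q \<in> verts G" "d1 q" "\<not> d1 q'" using end_in[of b] ab by auto
  have c: "c2 p" "c3 p" "\<not> c2 q" "\<not> c3 q" using ab p q by (auto simp: d1_def)
  have W: "w = p \<or> w = q" if w: "w \<in> verts G" "d1 w" for w
  proof -
    obtain e2 where e2: "e2 \<in> R2" "w \<in> ends G e2" using C_vertex[OF C w at[OF w(1) deg[OF w]]] by metis
    then have "w \<in> {p, p'} \<or> w \<in> {q, q'}" using ab(1) p(1) q(1) by auto
    then show ?thesis using w(2) p(4) q(4) by auto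
  qed
  obtain m where m: "m \<in> edges G" "m \<notin> R2" "m \<notin> R3" "p \<in> ends G m" using C_inner_edge[OF p(2)] .
  obtain x where x: "ends G m = {p, x}" "p \<noteq> x" "x \<in> verts G" using loopless_other_end[OF G m(1,4)] by blast
  have "d1 x" using d1_same[OF m(1-3) x(1)] p(3) by simp
  then have "x = q" using W[OF x(3)] x(2) by auto
  then have mpq: "ends G m = {p, q}" using x by simp
  have only: "f = m \<or> f \<in> R2 \<or> f \<in> R3" if f: "f \<in> edges G" "u \<in> ends G f" and u: "u \<in> {p, q}" for f u
  proof -
    have uV: "u \<in> verts G" "d1 u" using u p q by auto
    obtain e1 e2 e3 where e: "e2 \<in> R2" "e3 \<in> R3"
      "\<And>f. f \<in> edges G \<Longrightarrow> u \<in> ends G f \<Longrightarrow> f = e1 \<or> f = e2 \<or> f = e3"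
      using C_vertex[OF C uV at[OF uV(1) deg[OF uV]]] by metis
    have "m = e1" using e(3)[OF m(1)] e(1,2) m(2,3) mpq u by auto
    then show ?thesis using e(3)[OF f] e(1,2) by auto
  qed
  show ?thesis
    using W p(2,3) q(2,3) c m(1) mpq only by (intro exI[of _ p] exI[of _ q] exI[of _ m]) auto
qed

lemma C_prism:
  assumes C: "C_type G c1 c2 c3"
    and at0: "\<forall>u\<in>verts G. 3 \<le> vertex_degree G u \<longrightarrow> linked_at G R1 R2 R3 u"
    and high0: "\<forall>e\<in>edges G. \<exists>u\<in>ends G e. 3 \<le> vertex_degree G u"
  shows "graph_iso G (complement_graph (cycle_graph 6))"
proof -
  interpret r: doublet_triple G R2 R3 R1 c2 c3 c1 by (rule rotate)
  interpret rr: doublet_triple G R3 R1 R2 c3 c1 c2 by (rule r.rotate)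
  have req: "r.d1 x = d2 x" "rr.d1 x = d3 x" for x
    unfolding r.d1_def rr.d1_def d2_def d3_def by auto
  note C' = C_type_rotate[OF C]
  note C'' = r.C_type_rotate[OF C']
  have at': "\<forall>u\<in>verts G. 3 \<le> vertex_degree G u \<longrightarrow> linked_at G R2 R3 R1 u"
  proof (intro ballI impI)
    fix u assume "u \<in> verts G" "3 \<le> vertex_degree G u"
    then show "linked_at G R2 R3 R1 u" by (rule linked_at_rotate[OF at0[rule_format]])
  qed
  have at'': "\<forall>u\<in>verts G. 3 \<le> vertex_degree G u \<longrightarrow> linked_at G R3 R1 R2 u"
  proof (intro ballI impI)
    fix u assume "u \<in> verts G" "3 \<le> vertex_degree G u"
    then show "linked_at G R3 R1 R2 u" by (rule linked_at_rotate[OF at'[rule_format]])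
  qed
  obtain p1 q1 m1 where 1: "{z \<in> verts G. d1 z} = {p1, q1}" "c2 p1" "c3 p1" "\<not> c2 q1" "\<not> c3 q1" "m1 \<in> edges G"
    "ends G m1 = {p1, q1}" "\<forall>f\<in>edges G. p1 \<in> ends G f \<or> q1 \<in> ends G f \<longrightarrow> f = m1 \<or> f \<in> R2 \<or> f \<in> R3"
    using C_class[OF C at0 high0] by (elim exE conjE) (rule that)
  obtain p2 q2 m2 where 2: "{z \<in> verts G. d2 z} = {p2, q2}" "c3 p2" "c1 p2" "\<not> c3 q2" "\<not> c1 q2" "m2 \<in> edges G"
    "ends G m2 = {p2, q2}" "\<forall>f\<in>edges G. p2 \<in> ends G f \<or> q2 \<in> ends G f \<longrightarrow> f = m2 \<or> f \<in> R3 \<or> f \<in> R1"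
    using r.C_class[OF C' at' high0] unfolding req by (elim exE conjE) (rule that)
  obtain p3 q3 m3 where 3: "{z \<in> verts G. d3 z} = {p3, q3}" "c1 p3" "c2 p3" "\<not> c1 q3" "\<not> c2 q3" "m3 \<in> edges G"
    "ends G m3 = {p3, q3}" "\<forall>f\<in>edges G. p3 \<in> ends G f \<or> q3 \<in> ends G f \<longrightarrow> f = m3 \<or> f \<in> R1 \<or> f \<in> R2"
    using rr.C_class[OF C'' at'' high0] unfolding req by (elim exE conjE) (rule that)
  have d: "d1 p1" "d1 q1" "d2 p2" "d2 q2" "d3 p3" "d3 q3"
    and inV: "p1 \<in> verts G" "q1 \<in> verts G" "p2 \<in> verts G" "q2 \<in> verts G" "p3 \<in> verts G" "q3 \<in> verts G"
    using 1(1) 2(1) 3(1) by blast+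
  have V: "verts G = {p1, p2, p3, q1, q2, q3}"
  proof
    show "verts G \<subseteq> {p1, p2, p3, q1, q2, q3}"
    proof
      fix z assume z: "z \<in> verts G"
      have "d1 z \<or> d2 z \<or> d3 z" using d_rel(1)[of z] by blast
      then have "z \<in> {p1, q1} \<or> z \<in> {p2, q2} \<or> z \<in> {p3, q3}"
        unfolding 1(1)[symmetric] 2(1)[symmetric] 3(1)[symmetric] using z by blast
      then show "z \<in> {p1, p2, p3, q1, q2, q3}" by blast
    qed
  qed (use inV in simp)
  have nd: "\<not> d2 p1" "\<not> d3 p1" "\<not> d2 q1" "\<not> d3 q1" "\<not> d3 p2" "\<not> d3 q2"
    using C_unique(1)[OF C inV(1)] C_unique(1)[OF C inV(2)] C_unique(2)[OF C inV(3)] C_unique(2)[OF C inV(4)] d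
    by blast+
  have dist: "distinct [p1, p2, p3, q1, q2, q3]"
  proof -
    have "p1 \<noteq> q1" "p2 \<noteq> q2" "p3 \<noteq> q3" using 1 2 3 by metis+
    moreover have "p1 \<noteq> p2" "p1 \<noteq> p3" "p1 \<noteq> q2" "p1 \<noteq> q3" "q1 \<noteq> p2" "q1 \<noteq> p3" "q1 \<noteq> q2" "q1 \<noteq> q3"
      "p2 \<noteq> p3" "p2 \<noteq> q3" "q2 \<noteq> p3" "q2 \<noteq> q3" using d nd by metis+
    ultimately show ?thesis by auto
  qed
  \<comment> \<open>An edge of \<open>R1\<close> runs between the classes of \<open>d2\<close> and
    \<open>d3\<close>, and the common value of \<open>c1\<close> at its ends selects one vertex in
    each.\<close>
  have ends: "ends G e = {if c1 x then p2 else q2, if c1 x then p3 else q3}" if e: "e \<in> R1" "x \<in> ends G e" for e x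
  proof -
    have eE: "e \<in> edges G" using e sub by auto
    obtain u v where uv: "ends G e = {u, v}" "d2 u" "d3 v"
    proof -
      obtain y where y: "ends G e = {x, y}" using loopless_other_end[OF G eE e(2)] .
      have xy: "x \<in> verts G" "y \<in> verts G" "\<not> d1 x" "\<not> d1 y" "d2 x \<noteq> d2 y" "ends G e = {y, x}"
        using in_verts[OF eE] y C_R1[OF C e(1)] edge_R1(3)[OF e(1) y] by auto
      then show ?thesis using that[OF y] that[of y x] C_unique(3)[OF C xy(1)] C_unique(3)[OF C xy(2)] by blast
    qed
    have "u \<in> {p2, q2}" "v \<in> {p3, q3}"
      unfolding 2(1)[symmetric] 3(1)[symmetric] using uv in_verts[OF eE] by auto
    moreover have "c1 u = c1 x" "c1 v = c1 x" using doubletD(5)[OF doublet1 e(1) _ e(2)] uv(1) by auto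
    ultimately have "u = (if c1 x then p2 else q2)" "v = (if c1 x then p3 else q3)" using 2 3 by auto
    then show ?thesis using uv(1) by simp
  qed
  have ends2: "ends G e = {if c2 x then p3 else q3, if c2 x then p1 else q1}" if e: "e \<in> R2" "x \<in> ends G e" for e x
  proof -
    have eE: "e \<in> edges G" using e sub by auto
    obtain u v where uv: "ends G e = {u, v}" "d3 u" "d1 v"
    proof -
      obtain y where y: "ends G e = {x, y}" using loopless_other_end[OF G eE e(2)] .
      have xy: "x \<in> verts G" "y \<in> verts G" "\<not> d2 x" "\<not> d2 y" "d3 x \<noteq> d3 y" "ends G e = {y, x}"
        using in_verts[OF eE] y r.C_R1[OF C' e(1)] edge_R2(4)[OF e(1) y] unfolding req by auto
      then show ?thesis using that[OF y] that[of y x] C_unique(1)[OF C xy(1)] C_unique(1)[OF C xy(2)] by blast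
    qed
    have "u \<in> {p3, q3}" "v \<in> {p1, q1}"
      unfolding 1(1)[symmetric] 3(1)[symmetric] using uv in_verts[OF eE] by auto
    moreover have "c2 u = c2 x" "c2 v = c2 x" using doubletD(5)[OF doublet2 e(1) _ e(2)] uv(1) by auto
    ultimately have "u = (if c2 x then p3 else q3)" "v = (if c2 x then p1 else q1)" using 1 3 by auto
    then show ?thesis using uv(1) by simp
  qed
  have ends3: "ends G e = {if c3 x then p1 else q1, if c3 x then p2 else q2}" if e: "e \<in> R3" "x \<in> ends G e" for e x
  proof -
    have eE: "e \<in> edges G" using e sub by auto
    obtain u v where uv: "ends G e = {u, v}" "d1 u" "d2 v"
    proof -
      obtain y where y: "ends G e = {x, y}" using loopless_other_end[OF G eE e(2)] .
      have xy: "x \<in> verts G" "y \<in> verts G" "\<not> d3 x" "\<not> d3 y" "d1 x \<noteq> d1 y" "ends G e = {y, x}"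
        using in_verts[OF eE] y rr.C_R1[OF C'' e(1)] edge_R3(3)[OF e(1) y] unfolding req by auto
      then show ?thesis using that[OF y] that[of y x] C_unique(2)[OF C xy(1)] C_unique(2)[OF C xy(2)] by blast
    qed
    have "u \<in> {p1, q1}" "v \<in> {p2, q2}"
      unfolding 1(1)[symmetric] 2(1)[symmetric] using uv in_verts[OF eE] by auto
    moreover have "c3 u = c3 x" "c3 v = c3 x" using doubletD(5)[OF doublet3 e(1) _ e(2)] uv(1) by auto
    ultimately have "u = (if c3 x then p1 else q1)" "v = (if c3 x then p2 else q2)" using 1 2 by auto
    then show ?thesis using uv(1) by simp
  qed
  obtain a1 b1 where R1: "R1 = {a1, b1}" "\<forall>x\<in>ends G a1. c1 x" "\<forall>x\<in>ends G b1. \<not> c1 x"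
    using doublet1 by (auto simp: doublet_def)
  obtain a2 b2 where R2: "R2 = {a2, b2}" "\<forall>x\<in>ends G a2. c2 x" "\<forall>x\<in>ends G b2. \<not> c2 x"
    using doublet2 by (auto simp: doublet_def)
  obtain a3 b3 where R3: "R3 = {a3, b3}" "\<forall>x\<in>ends G a3. c3 x" "\<forall>x\<in>ends G b3. \<not> c3 x"
    using doublet3 by (auto simp: doublet_def)
  have ne: "\<exists>x. x \<in> ends G e" if "e \<in> R1 \<union> R2 \<union> R3" for e
    using that ends_nonempty[OF G] sub by blast
  have "ends G a1 = {p2, p3}" "ends G b1 = {q2, q3}"
    using ends[of a1] ends[of b1] ne[of a1] ne[of b1] R1 by auto
  moreover have "ends G a2 = {p1, p3}" "ends G b2 = {q1, q3}"
    using ends2[of a2] ends2[of b2] ne[of a2] ne[of b2] R2 by (auto simp: insert_commute)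
  moreover have "ends G a3 = {p1, p2}" "ends G b3 = {q1, q2}"
    using ends3[of a3] ends3[of b3] ne[of a3] ne[of b3] R3 by auto
  moreover have "edges G = {a1, a2, a3, b1, b2, b3, m1, m2, m3}"
  proof
    show "{a1, a2, a3, b1, b2, b3, m1, m2, m3} \<subseteq> edges G" using sub R1 R2 R3 1(6) 2(6) 3(6) by auto
    show "edges G \<subseteq> {a1, a2, a3, b1, b2, b3, m1, m2, m3}"
    proof
      fix f assume f: "f \<in> edges G"
      then obtain x where x: "x \<in> ends G f" using ends_nonempty[OF G] by blast
      then have "x \<in> {p1, p2, p3, q1, q2, q3}" using in_verts[OF f] V by blast
      then have "f \<in> {m1, m2, m3} \<union> R1 \<union> R2 \<union> R3"
        using x bspec[OF 1(8) f] bspec[OF 2(8) f] bspec[OF 3(8) f] by auto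
      then show "f \<in> {a1, a2, a3, b1, b2, b3, m1, m2, m3}" using R1 R2 R3 by auto
    qed
  qed
  ultimately show ?thesis using prism_iso[OF V dist] 1(7) 2(7) 3(7) by blast
qed

end

section \<open>Counting removable edges\<close>

lemma removable_edge_iff:
  "matching_covered G \<Longrightarrow> removable_edge G e \<longleftrightarrow> e \<in> edges G \<and> matching_covered (delete_edges G {e})"
  by (simp add: removable_edge_def delete_edge_eq)

text \<open>Classes of different edges at \<open>v\<close> are disjoint, so the singleton classes
  inject into the removable edges. More than two edges at \<open>v\<close> remain, and their classes
  are doublets.\<close>

lemma vertex_structure:
  assumes mc: "matching_covered G" and irr: "irreducible_graph G" and dp: "doublet_property G"
    and v: "v \<in> verts G" and many: "card {e. removable_edge G e} + 2 < vertex_degree G v"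
  shows "\<exists>e1 e2 e3 R1 R2 R3. e1 \<noteq> e2 \<and> e1 \<noteq> e3 \<and> e2 \<noteq> e3 \<and>
    linked G v e1 R1 \<and> linked G v e2 R2 \<and> linked G v e3 R3"
proof -
  note G = matching_coveredD(1)[OF mc]
  define N where "N = {e \<in> edges G. v \<in> ends G e}"
  have finE: "finite (edges G)" using G by (simp add: loopless_multigraph_def)
  then have finN: "finite N" by (simp add: N_def)
  have cN: "card N = vertex_degree G v" by (simp add: N_def vertex_degree_def)
  have "\<forall>e\<in>N. \<exists>R. R \<noteq> {} \<and> equivalent_edges G R \<and> matching_covered (delete_edges G R) \<and> R \<inter> core G v e = {}"
    using exists_removable_class[OF mc irr v] many by (auto simp: N_def)
  from bchoice[OF this] obtain R where R: "\<And>e. e \<in> N \<Longrightarrow> R e \<noteq> {}"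
    "\<And>e. e \<in> N \<Longrightarrow> equivalent_edges G (R e)" "\<And>e. e \<in> N \<Longrightarrow> matching_covered (delete_edges G (R e))"
    "\<And>e. e \<in> N \<Longrightarrow> R e \<inter> core G v e = {}" by blast
  have RE: "R e \<subseteq> edges G" if "e \<in> N" for e using R(2)[OF that] by (simp add: equivalent_edges_def)
  \<comment> \<open>\<open>cores_cover\<close> compares two edges at \<open>v\<close> by means of a
    third.\<close>
  have third: "\<exists>g\<in>N. g \<noteq> e \<and> g \<noteq> f" for e f
  proof (rule ccontr)
    assume "\<not> ?thesis"
    then have "N \<subseteq> {e, f}" by blast
    then have "card N \<le> card {e, f}" by (intro card_mono) auto
    also have "\<dots> \<le> 2" by (simp add: card_insert_if)
    finally show False using many cN by simp
  qed
  have disj: "R e \<inter> R f = {}" if ef: "e \<in> N" "f \<in> N" "e \<noteq> f" for e f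
  proof -
    obtain g where g: "g \<in> N" "g \<noteq> e" "g \<noteq> f" using third by blast
    have "edges G \<subseteq> core G v e \<union> core G v f"
      using cores_cover[OF mc v, of g e f] g ef by (simp add: N_def)
    then show ?thesis using R(4)[OF ef(1)] R(4)[OF ef(2)] RE[OF ef(1)] by blast
  qed
  define S where "S = {e \<in> N. card (R e) = 1}"
  have single: "R e = {the_elem (R e)}" if e: "e \<in> S" for e
  proof -
    have "is_singleton (R e)" using e by (simp add: S_def is_singleton_altdef)
    then show ?thesis by (simp only: is_singleton_the_elem)
  qed
  have "inj_on (\<lambda>e. the_elem (R e)) S"
  proof (rule inj_onI)
    fix e f assume ef: "e \<in> S" "f \<in> S" "the_elem (R e) = the_elem (R f)"
    then have "R e = R f" using single[OF ef(1)] single[OF ef(2)] by metis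
    moreover have N: "e \<in> N" "f \<in> N" using ef by (auto simp: S_def)
    ultimately have "R e \<inter> R f \<noteq> {}" using R(1)[OF N(1)] by simp
    then show "e = f" using disj[OF N] by auto
  qed
  moreover have "(\<lambda>e. the_elem (R e)) ` S \<subseteq> {e. removable_edge G e}"
  proof clarify
    fix e assume e: "e \<in> S"
    then have eN: "e \<in> N" by (simp add: S_def)
    have "the_elem (R e) \<in> R e" using single[OF e] by (metis singletonI)
    moreover have "matching_covered (delete_edges G {the_elem (R e)})" using R(3)[OF eN] single[OF e] by metis
    ultimately show "removable_edge G (the_elem (R e))"
      using RE[OF eN] removable_edge_iff[OF mc] by blast
  qed
  moreover have "finite {e. removable_edge G e}"
    using finE by (rule rev_finite_subset) (auto simp: removable_edge_def)
  ultimately have "card S \<le> card {e. removable_edge G e}" by (metis card_inj_on_le)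
  moreover have "card (N - S) = card N - card S" using finN by (intro card_Diff_subset) (auto simp: S_def)
  ultimately have "3 \<le> card (N - S)" using many cN by linarith
  then obtain T where T: "T \<subseteq> N - S" "card T = 3" by (rule obtain_subset_with_card_n)
  then obtain e1 e2 e3 where e: "T = {e1, e2, e3}" "e1 \<noteq> e2" "e1 \<noteq> e3" "e2 \<noteq> e3"
    by (auto simp: card_3_iff)
  then have eN: "e1 \<in> N - S" "e2 \<in> N - S" "e3 \<in> N - S" using T by auto
  have dbl: "\<exists>c. doublet G (R f) c" if f: "f \<in> N - S" for f
  proof -
    have "finite (R f)" using RE finE f by (auto intro: finite_subset)
    then have "card (R f) \<noteq> 0" using R(1) f by auto
    moreover have "card (R f) \<noteq> 1" using f by (auto simp: S_def)
    ultimately have "2 \<le> card (R f)" by linarith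
    then show ?thesis using dp R(2,3) f by (auto simp: doublet_property_def)
  qed
  have linked: "linked G v f (R f)" if f: "f \<in> N - S" "g \<in> N - S" "h \<in> N - S" "f \<noteq> g" "f \<noteq> h" "g \<noteq> h" for f g h
  proof -
    obtain c where c: "doublet G (R f) c" using dbl[OF f(1)] by blast
    obtain c' where c': "doublet G (R g) c'" using dbl[OF f(2)] by blast
    have "f \<in> M" if M: "perfect_matching G M" "R f \<subseteq> M" for M
      using doublet_matched_with_edge[OF mc v _ _ _ _ _ _ _ _ c R(4) c' R(4) M, of h] f by (simp add: N_def)
    then show ?thesis using c f(1) by (auto simp: linked_def N_def)
  qed
  show ?thesis
    using linked[OF eN e(2,3,4)] linked[OF eN(2,1,3)] linked[OF eN(3,1,2)] e(2,3,4) by metis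
qed

lemma linked_exclusive:
  assumes "linked G v e R" "linked G v f S" "e \<noteq> f" "perfect_matching G M" "R \<subseteq> M"
  shows "S \<inter> M = {}"
proof (rule ccontr)
  assume "S \<inter> M \<noteq> {}"
  moreover obtain c where "doublet G S c" using assms(2) by (auto simp: linked_def)
  ultimately have "S \<subseteq> M" using equivalent_edgesD[OF doubletD(1) assms(4)] by blast
  then have "e \<in> M" "f \<in> M" using assms by (auto simp: linked_def)
  then show False
    using perfect_matching_unique[OF assms(4)] assms(1-3) unfolding linked_def by blast
qed

lemma linked_triple:
  assumes mc: "matching_covered G" and ne: "e1 \<noteq> e2" "e1 \<noteq> e3" "e2 \<noteq> e3"
    and l: "linked G v e1 R1" "linked G v e2 R2" "linked G v e3 R3"
  shows "\<exists>c1 c2 c3. doublet_triple G R1 R2 R3 c1 c2 c3"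
proof -
  obtain c1 c2 c3 where "doublet G R1 c1" "doublet G R2 c2" "doublet G R3 c3"
    using l unfolding linked_def by blast
  then have "doublet_triple G R1 R2 R3 c1 c2 c3"
    using linked_exclusive[OF l(1,2) ne(1)] linked_exclusive[OF l(1,3) ne(2)] linked_exclusive[OF l(2,3) ne(3)] mc
    by unfold_locales
  then show ?thesis by blast
qed

theorem theorem1p2:
  fixes G :: "('v, 'e) mgraph"
  assumes "near_brick G"
    and "irreducible_graph G"
    and "\<not> graph_iso G (complete_graph 4)"
    and "\<not> graph_iso G (complement_graph (cycle_graph 6))"
  shows "card {e. removable_edge G e} \<ge> max_degree G - 2"
proof (rule ccontr)
  assume "\<not> ?thesis"
  \<comment> \<open>When the bound fails, the truncated difference is positive and can be
    cleared.\<close>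
  then have few: "card {e. removable_edge G e} + 2 < max_degree G" by simp
  have mc: "matching_covered G" using assms(1) by (simp add: near_brick_def)
  note G = matching_coveredD(1)[OF mc]
  note dp = near_brick_doublet_property[OF assms(1)]
  have fV: "finite (verts G)" "verts G \<noteq> {}"
    using G matching_coveredD(3)[OF mc] by (auto simp: loopless_multigraph_def)
  have "max_degree G \<in> vertex_degree G ` verts G" unfolding max_degree_def using fV by (intro Max_in) auto
  then obtain v where v: "v \<in> verts G" "vertex_degree G v = max_degree G" by auto
  have le: "vertex_degree G u \<le> max_degree G" if "u \<in> verts G" for u
    unfolding max_degree_def using fV that by (intro Max_ge) auto
  obtain e1 e2 e3 R1 R2 R3 where ne: "e1 \<noteq> e2" "e1 \<noteq> e3" "e2 \<noteq> e3"
    and l: "linked G v e1 R1" "linked G v e2 R2" "linked G v e3 R3"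
    using vertex_structure[OF mc assms(2) dp v(1), unfolded v(2), OF few] by (elim exE conjE) (rule that)
  obtain k1 k2 k3 where k: "doublet_triple G R1 R2 R3 k1 k2 k3" using linked_triple[OF mc ne l] by blast
  obtain c1 c2 c3 where t: "doublet_triple G R1 R2 R3 c1 c2 c3"
    and type: "K_type G R1 R2 R3 c1 c2 c3 \<or> C_type G c1 c2 c3"
    using doublet_triple.type_cases[OF k] by blast
  interpret doublet_triple G R1 R2 R3 c1 c2 c3 by (rule t)
  interpret r: doublet_triple G R2 R3 R1 c2 c3 c1 by (rule rotate)
  interpret rr: doublet_triple G R3 R1 R2 c3 c1 c2 by (rule r.rotate)
  have req: "r.d1 x = d2 x" "rr.d1 x = d3 x" for x
    unfolding r.d1_def rr.d1_def d2_def d3_def by auto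
  note l1 = linkedD[OF l(1)] and l2 = linkedD[OF l(2)] and l3 = linkedD[OF l(3)]
  \<comment> \<open>In either type, a perfect matching through an edge at \<open>v\<close> other
    than \<open>e1\<close>, \<open>e2\<close>, \<open>e3\<close> would contain one of the three
    doublets and with it a forced edge at \<open>v\<close>. So \<open>v\<close> has degree three and
    no removable edge exists.\<close>
  have only: "f = e1 \<or> f = e2 \<or> f = e3" if f: "f \<in> edges G" "v \<in> ends G f" for f
    using type
  proof
    assume "K_type G R1 R2 R3 c1 c2 c3"
    then show ?thesis by (rule K_edges_at[OF _ l1(2) l2(2) l3(2) l1(3) l2(3) l3(3) f])
  next
    assume C: "C_type G c1 c2 c3"
    note C' = C_type_rotate[OF C]
    note C'' = r.C_type_rotate[OF C']
    have at: "linked_at G R1 R2 R3 v" using ne l unfolding linked_at_def by blast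
    obtain M where M: "perfect_matching G M" "f \<in> M" using matching_covered_edge[OF mc f(1)] .
    have "R1 \<subseteq> M \<or> R2 \<subseteq> M \<or> R3 \<subseteq> M" if "f \<noteq> e1" "f \<noteq> e2" "f \<noteq> e3"
    proof -
      have "d1 v \<or> d2 v \<or> d3 v" using d_rel(1)[of v] by blast
      then show ?thesis
        using C_edge_at_d1[OF C v(1) _ l1(2,3) f(2) that(1) M] r.C_edge_at_d1[OF C' v(1) _ l2(2,3) f(2) that(2) M]
          rr.C_edge_at_d1[OF C'' v(1) _ l3(2,3) f(2) that(3) M] unfolding req by blast
    qed
    then have "f \<noteq> e1 \<and> f \<noteq> e2 \<and> f \<noteq> e3 \<Longrightarrow> e1 \<in> M \<or> e2 \<in> M \<or> e3 \<in> M"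
      using l1(3)[OF M(1)] l2(3)[OF M(1)] l3(3)[OF M(1)] by blast
    then show ?thesis
      using perfect_matching_unique[OF M _ f(2)] l1(2) l2(2) l3(2) by blast
  qed
  have "{e \<in> edges G. v \<in> ends G e} \<subseteq> {e1, e2, e3}" using only by blast
  then have "vertex_degree G v \<le> card {e1, e2, e3}" unfolding vertex_degree_def by (intro card_mono) auto
  then have three: "max_degree G = 3" "card {e. removable_edge G e} = 0" using ne v(2) few by auto
  \<comment> \<open>Without removable edges \<open>vertex_structure\<close> applies at every vertex
    of degree at least three. Its three doublets are distinct, and \<open>no_other_doublet\<close>
    identifies them with \<open>R1\<close>, \<open>R2\<close>, \<open>R3\<close> in some
    order.\<close>
  have at: "linked_at G R1 R2 R3 u" if u: "u \<in> verts G" "3 \<le> vertex_degree G u" for u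
  proof -
    have "card {e. removable_edge G e} + 2 < vertex_degree G u" using u(2) three(2) by simp
    then obtain f1 f2 f3 S1 S2 S3 where nf: "f1 \<noteq> f2" "f1 \<noteq> f3" "f2 \<noteq> f3"
      and m: "linked G u f1 S1" "linked G u f2 S2" "linked G u f3 S3"
      using vertex_structure[OF mc assms(2) dp u(1)] by metis
    have "S1 \<noteq> S2" "S1 \<noteq> S3" "S2 \<noteq> S3"
    proof -
      have *: "S \<noteq> S'" if d: "linked G u f S" "linked G u f' S'" "f \<noteq> f'" for S S' f f'
      proof
        assume eq: "S = S'"
        obtain c where c: "doublet G S c" using d(1) by (auto simp: linked_def)
        then obtain g where g: "g \<in> S" "g \<in> edges G" using doubletD(3)[OF c] by (auto simp: doublet_def)
        obtain M where M: "perfect_matching G M" "g \<in> M" using matching_covered_edge[OF mc g(2)] .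
        then have "S \<subseteq> M" using equivalent_edgesD[OF doubletD(1)[OF c] M(1) g(1)] by blast
        then show False using linked_exclusive[OF d M(1)] eq g(1) by blast
      qed
      show "S1 \<noteq> S2" "S1 \<noteq> S3" "S2 \<noteq> S3" using *[OF m(1,2) nf(1)] *[OF m(1,3) nf(2)] *[OF m(2,3) nf(3)] by auto
    qed
    moreover have "S1 = R1 \<or> S1 = R2 \<or> S1 = R3" "S2 = R1 \<or> S2 = R2 \<or> S2 = R3" "S3 = R1 \<or> S3 = R2 \<or> S3 = R3"
      using m no_other_doublet[OF type] unfolding linked_def by blast+
    ultimately show ?thesis using m nf unfolding linked_at_def by metis
  qed
  have high: "\<exists>u\<in>ends G e. 3 \<le> vertex_degree G u" if e: "e \<in> edges G" for e
  proof -
    obtain x y where "ends G e = {x, y}" "x \<noteq> y" using loopless_ends[OF G e] .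
    then show ?thesis using adjacent_degree_three[OF mc assms(2) v(1) _ e] v(2) three(1) by auto
  qed
  show False
    using type K_complete[OF _ at high] C_prism at high assms(3,4) by blast
qed

end
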